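(* Let $N\ge1$, $\rho\in[0,1)$, $\alpha\in[0,1]$, $q\in(0,1)$, and let $(r_n)_{n\ge0}$ satisfy $0\le r_n<1$ and $\lim_{n\to\infty}n^\gamma r_n=c>0$ for some $\gamma\in(\tfrac12,1]$. Let $Z_n(i)\in[0,1]$ ($i=1,\dots,N$, $n\ge0$) evolve by $Z_{n+1}(i)=(1-r_n)Z_n(i)+r_n(\rho I_{n+1}(i)+(1-\rho)q)$, where, with $\mathcal F_n=\sigma(Z_k(i):\,1\le i\le N,\ 0\le k\le n)$ and $Z_n=\frac1N\sum_{i=1}^N Z_n(i)$, the $I_{n+1}(1),\dots,I_{n+1}(N)\in\{0,1\}$ are conditionally independent given $\mathcal F_n$ with $P(I_{n+1}(i)=1\mid\mathcal F_n)=(1-\alpha)Z_n(i)+\alpha Z_n$. Assume the law of $(Z_0(1),\dots,Z_0(N))$ is permutation invariant, $E[Z_0(i)]=\tfrac12$ and $E[Z_0(1-Z_0)]>0$. (i) If $\tfrac12<\gamma<1$, then \[\Big(n^{\gamma/2}e^{c(1-\rho)t}\big(Z_{\lfloor n+n^\gamma t\rfloor}-q\big)\Big)_{t\ge0}\xrightarrow{d}(W_{V_t})_{t\ge0},\quad V_t=\frac{cq(1-q)\rho^2}{2N(1-\rho)}e^{2c(1-\rho)t}.\] (ii) If $\gamma=1$ and $2c(1-\rho)>1$, then \[\Big(n^{1/2}(1+t)^{c(1-\rho)}\big(Z_{\lfloor n+nt\rfloor}-q\big)\Big)_{t\ge0}\xrightarrow{d}(W_{V_t})_{t\ge0},\quad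 V_t=\frac{c^2q(1-q)\rho^2}{N(2c(1-\rho)-1)}(1+t)^{2c(1-\rho)-1}.\] Here $W$ is a standard Brownian motion and convergence in distribution is with respect to the Skorohod topology on $D[0,+\infty)$. *)

theory Defs
  imports "HOL-Probability.Probability" "HOL-Combinatorics.Permutations"
begin

(* Skorohod space D[0,+oo): cadlag paths on [0,+oo).  Paths are functions real => real;
   values at negative times are irrelevant. *)
definition cadlag_paths :: "(real \<Rightarrow> real) set" where
  "cadlag_paths = {f. \<forall>t\<ge>0. (f \<longlongrightarrow> f t) (at_right t) \<and>
                        (t > 0 \<longrightarrow> (\<exists>l. (f \<longlongrightarrow> l) (at_left t)))}"

definition time_changes :: "(real \<Rightarrow> real) set" where
  "time_changes = {l. strict_mono_on {0..} l \<and> continuous_on {0..} l \<and> l ` {0..} = {0..}}"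

(* Convergence in the Skorohod (J1) topology on D[0,+oo)
   (Ethier--Kurtz, Ch. 3, Prop. 5.3) *)
definition skorohod_conv :: "(nat \<Rightarrow> real \<Rightarrow> real) \<Rightarrow> (real \<Rightarrow> real) \<Rightarrow> bool" where
  "skorohod_conv xs x \<longleftrightarrow>
     (\<exists>ls. (\<forall>k. ls k \<in> time_changes) \<and>
        (\<forall>e>0. eventually (\<lambda>k. \<forall>t\<ge>0. \<bar>ls k t - t\<bar> \<le> e) sequentially) \<and>
        (\<forall>T>0. \<forall>e>0. eventually (\<lambda>k. \<forall>t\<in>{0..T}. \<bar>xs k (ls k t) - x t\<bar> \<le> e) sequentially))"

(* Continuity on D[0,+oo) w.r.t. the (metrizable) Skorohod topology *)
definition skorohod_continuous :: "((real \<Rightarrow> real) \<Rightarrow> real) \<Rightarrow> bool" where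
  "skorohod_continuous \<Phi> \<longleftrightarrow>
     (\<forall>xs x. x \<in> cadlag_paths \<longrightarrow> (\<forall>k. xs k \<in> cadlag_paths) \<longrightarrow> skorohod_conv xs x \<longrightarrow>
        (\<lambda>k. \<Phi> (xs k)) \<longlonglongrightarrow> \<Phi> x)"

definition conv_distr_D ::
  "'a measure \<Rightarrow> (nat \<Rightarrow> 'a \<Rightarrow> real \<Rightarrow> real) \<Rightarrow> 'b measure \<Rightarrow> ('b \<Rightarrow> real \<Rightarrow> real) \<Rightarrow> bool" where
  "conv_distr_D M X M' Y \<longleftrightarrow>
     (\<forall>\<Phi>. (\<exists>B. \<forall>f\<in>cadlag_paths. \<bar>\<Phi> f\<bar> \<le> B) \<longrightarrow> skorohod_continuous \<Phi> \<longrightarrow>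
        (\<lambda>n. \<integral>\<omega>. \<Phi> (X n \<omega>) \<partial>M) \<longlonglongrightarrow> (\<integral>\<omega>. \<Phi> (Y \<omega>) \<partial>M'))"

definition brownian_motion :: "'b measure \<Rightarrow> (real \<Rightarrow> 'b \<Rightarrow> real) \<Rightarrow> bool" where
  "brownian_motion M W \<longleftrightarrow> prob_space M \<and>
     (\<forall>t\<ge>0. W t \<in> borel_measurable M) \<and>
     (\<forall>\<omega>\<in>space M. W 0 \<omega> = 0 \<and> continuous_on {0..} (\<lambda>t. W t \<omega>)) \<and>
     (\<forall>s t. 0 \<le> s \<longrightarrow> s < t \<longrightarrow>
        distributed M lborel (\<lambda>\<omega>. W t \<omega> - W s \<omega>) (normal_density 0 (sqrt (t - s)))) \<and>
     (\<forall>ts. sorted_wrt (<) ts \<longrightarrow> (\<forall>t\<in>set ts. 0 \<le> t) \<longrightarrow>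
        prob_space.indep_vars M (\<lambda>_. borel) (\<lambda>k \<omega>. W (ts ! Suc k) \<omega> - W (ts ! k) \<omega>)
          {..<length ts - 1})"

definition avg :: "nat \<Rightarrow> (nat \<Rightarrow> nat \<Rightarrow> 'a \<Rightarrow> real) \<Rightarrow> nat \<Rightarrow> 'a \<Rightarrow> real" where
  "avg N Z n \<omega> = (\<Sum>i=1..N. Z n i \<omega>) / real N"

definition nat_filtration :: "'a measure \<Rightarrow> nat \<Rightarrow> (nat \<Rightarrow> nat \<Rightarrow> 'a \<Rightarrow> real) \<Rightarrow> nat \<Rightarrow> 'a measure" where
  "nat_filtration M N Z n = sigma (space M)
     {Z k i -` A \<inter> space M | k i A. k \<le> n \<and> i \<in> {1..N} \<and> A \<in> sets borel}"

definition cond_indep :: "'a measure \<Rightarrow> 'a measure \<Rightarrow> nat \<Rightarrow> (nat \<Rightarrow> 'a \<Rightarrow> real) \<Rightarrow> bool" where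
  "cond_indep M F N X \<longleftrightarrow>
     (\<forall>A. (\<forall>i. A i \<in> sets borel) \<longrightarrow>
        (AE \<omega> in M. real_cond_exp M F (\<lambda>\<omega>. \<Prod>i=1..N. indicator (A i) (X i \<omega>)) \<omega>
           = (\<Prod>i=1..N. real_cond_exp M F (\<lambda>\<omega>. indicator (A i) (X i \<omega>)) \<omega>)))"

end

theory Submission
  imports Defs "HOL-Real_Asymp.Real_Asymp"
begin

text \<open>
  Let \<open>b\<^sub>m\<close> be the product of the factors \<open>1 / (1 - (1 - \<rho>) r\<^sub>k)\<close> over \<open>k < m\<close>. Then \<open>b\<^sub>m (Z\<^sub>m - q)\<close> is a
  martingale whose increments are bounded by \<open>\<rho> r\<^sub>k b\<^sub>k\<^sub>+\<^sub>1\<close> and whose conditional variances, in units of the squared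
  bounds, tend to \<open>q (1 - q) / N\<close> because each \<open>Z\<^sub>m(i)\<close> tends to \<open>q\<close> in mean square. The rescaled process is
  this martingale multiplied by \<open>n\<^bsup>\<gamma>/2\<^esup> / b\<^sub>n\<close> and by a deterministic factor that tends to \<open>1\<close> locally
  uniformly, and the Stolz-Cesaro theorem gives the limit of its quadratic variation.

  Every Skorohod-continuous functional is continuous for locally uniform convergence, and its inf-convolutions
  with the metric of that convergence are Lipschitz and increase to it. It therefore suffices to treat bounded
  Lipschitz functionals, for which no compactness argument is needed: the path is replaced by its values on a grid
  (the error is controlled by fourth moments and a maximal inequality), and the increments over
  the grid are replaced one at a time by independent Gaussians, using characteristic functions weighted by a
  function of the earlier increments.
\<close>

section \<open>Locally uniform convergence of cadlag paths\<close>

text \<open>Two obstacles shape the proof. First, the path space with the locally uniform metric is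
  not separable, so continuity of a functional does not by itself make it measurable on random
  paths. It does here because every path that occurs is determined by countably many real random
  variables. Second, the limit does not start at 0: for \<rho> > 0 the clock \<open>V\<close> is
  positive at time 0, since at rescaled time 0 the martingale already carries the history of
  \<open>n\<close> steps. Hence every grid has an initial block reaching back to step 0.

  The variance constants come from one limit. With \<beta> = 1 - \<rho>, the sum of
  \<open>r_k^2 b_{k+1}^2\<close> over \<open>k < n\<close>, multiplied by
  \<open>n^\<gamma> / b_n^2\<close>, tends to \<open>c^2 / D\<close>, where \<open>D\<close> is
  \<open>2 c \<beta>\<close> for \<gamma> < 1 and \<open>2 c \<beta> - 1\<close> for \<gamma> = 1.
  The condition \<open>2 c (1 - \<rho>) > 1\<close> says that \<open>D\<close> is positive. The
  factor \<open>\<rho>^2\<close> comes from the increments, \<open>q (1 - q) / N\<close> from their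
  conditional variances, and the dependence on \<open>t\<close> from comparing both ends of the time
  window.\<close>

definition path_dist :: "(real \<Rightarrow> real) \<Rightarrow> (real \<Rightarrow> real) \<Rightarrow> real" where
  "path_dist x y = (SUP t\<in>{0..}. min \<bar>x t - y t\<bar> (1 / (1 + t)))"

lemma path_dist_least:
  assumes "\<And>t. t \<ge> 0 \<Longrightarrow> min \<bar>x t - y t\<bar> (1 / (1 + t)) \<le> e"
  shows "path_dist x y \<le> e"
  unfolding path_dist_def by (rule cSUP_least) (use assms in auto)

text \<open>The cap \<open>1 / (1 + t)\<close> keeps the supremum finite for unbounded paths and
  makes late times count little, which is what turns \<open>path_dist\<close> into a metric for
  locally uniform convergence.\<close>

lemma path_dist_upper:
  assumes "t \<ge> 0"
  shows "min \<bar>x t - y t\<bar> (1 / (1 + t)) \<le> path_dist x y"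
  unfolding path_dist_def
proof (rule cSUP_upper)
  show "bdd_above ((\<lambda>t. min \<bar>x t - y t\<bar> (1 / (1 + t))) ` {0..})"
  proof (rule bdd_aboveI2)
    fix t :: real assume "t \<in> {0..}"
    then have "1 / (1 + t) \<le> 1" by simp
    then show "min \<bar>x t - y t\<bar> (1 / (1 + t)) \<le> 1" by linarith
  qed
qed (use assms in auto)

lemma path_dist_nonneg: "0 \<le> path_dist x y"
proof -
  have "0 \<le> min \<bar>x 0 - y 0\<bar> (1 / (1 + 0))" by simp
  also have "\<dots> \<le> path_dist x y" by (rule path_dist_upper) simp
  finally show ?thesis .
qed

lemma path_dist_self [simp]: "path_dist x x = 0"
  by (rule antisym[OF path_dist_least path_dist_nonneg]) auto

lemma path_dist_commute: "path_dist x y = path_dist y x"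
  unfolding path_dist_def by (simp add: abs_minus_commute)

lemma path_dist_triangle: "path_dist x z \<le> path_dist x y + path_dist y z"
proof (rule path_dist_least)
  fix t :: real assume t: "t \<ge> 0"
  have "min \<bar>x t - z t\<bar> (1 / (1 + t))
      \<le> min \<bar>x t - y t\<bar> (1 / (1 + t)) + min \<bar>y t - z t\<bar> (1 / (1 + t))"
  proof -
    have "0 \<le> 1 / (1 + t)" using t by simp
    then show ?thesis by linarith
  qed
  also have "\<dots> \<le> path_dist x y + path_dist y z"
    using path_dist_upper[OF t, of x y] path_dist_upper[OF t, of y z] by linarith
  finally show "min \<bar>x t - z t\<bar> (1 / (1 + t)) \<le> path_dist x y + path_dist y z" .
qed

text \<open>From time \<open>T\<close> on, the cap alone is at most \<open>1 / (1 + T)\<close>. The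
  strict bound \<open>t < T\<close> suits grids of mesh \<open>1 / r\<close>, where such a time lies
  in a cell with index below \<open>r * T\<close>.\<close>

lemma path_dist_le_compact:
  assumes "T \<ge> 0" "\<And>t. 0 \<le> t \<Longrightarrow> t < T \<Longrightarrow> \<bar>x t - y t\<bar> \<le> e" "0 \<le> e"
  shows "path_dist x y \<le> e + 1 / (1 + T)"
proof (rule path_dist_least)
  fix t :: real assume t: "t \<ge> 0"
  show "min \<bar>x t - y t\<bar> (1 / (1 + t)) \<le> e + 1 / (1 + T)"
  proof (cases "t < T")
    case True
    then have "\<bar>x t - y t\<bar> \<le> e" using assms t by auto
    moreover have "0 \<le> 1 / (1 + T)" using assms by simp
    ultimately show ?thesis by linarith
  next
    case False
    then have "1 / (1 + t) \<le> 1 / (1 + T)" using assms(1) by (intro divide_left_mono) auto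
    then show ?thesis using assms(3) by linarith
  qed
qed

lemma path_dist_le_uniform:
  assumes "\<And>t. 0 \<le> t \<Longrightarrow> \<bar>x t - y t\<bar> \<le> e"
  shows "path_dist x y \<le> e"
  by (rule path_dist_least) (use assms in \<open>force simp: min_le_iff_disj\<close>)

lemma path_dist_tendsto_0I:
  assumes "\<And>T e. T > 0 \<Longrightarrow> e > 0 \<Longrightarrow>
    eventually (\<lambda>k. \<forall>t. 0 \<le> t \<longrightarrow> t < T \<longrightarrow> \<bar>xs k t - x t\<bar> \<le> e) sequentially"
  shows "(\<lambda>k. path_dist (xs k) x) \<longlonglongrightarrow> 0"
proof (rule tendstoI)
  fix e :: real assume e: "e > 0"
  \<comment> \<open>This makes \<open>1 / (1 + T)\<close> equal to \<open>e / (e + 3)\<close>, which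
    is below \<open>e / 2\<close>.\<close>
  define T where "T = 3 / e"
  have T: "T > 0" using e by (simp add: T_def)
  have "1 / (1 + T) < e / 2" using e unfolding T_def by (simp add: field_simps add_pos_pos)
  moreover have "eventually (\<lambda>k. \<forall>t. 0 \<le> t \<longrightarrow> t < T \<longrightarrow> \<bar>xs k t - x t\<bar> \<le> e/2) sequentially"
    using assms[OF T, of "e/2"] e by simp
  ultimately show "eventually (\<lambda>k. dist (path_dist (xs k) x) 0 < e) sequentially"
  proof (elim eventually_mono)
    fix k assume 1: "1 / (1 + T) < e / 2"
      and "\<forall>t. 0 \<le> t \<longrightarrow> t < T \<longrightarrow> \<bar>xs k t - x t\<bar> \<le> e/2"
    then have "path_dist (xs k) x \<le> e/2 + 1 / (1 + T)"
      using T e by (intro path_dist_le_compact) auto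
    then show "dist (path_dist (xs k) x) 0 < e"
      using 1 path_dist_nonneg[of "xs k" x] by (simp add: dist_real_def)
  qed
qed

lemma path_dist_tendsto_0D:
  assumes "(\<lambda>k. path_dist (xs k) x) \<longlonglongrightarrow> 0" "T > 0" "e > 0"
  shows "eventually (\<lambda>k. \<forall>t\<in>{0..T}. \<bar>xs k t - x t\<bar> \<le> e) sequentially"
proof -
  have "eventually (\<lambda>k. path_dist (xs k) x < min e (1 / (1 + T))) sequentially"
    by (rule order_tendstoD(2)[OF assms(1)]) (use assms in auto)
  then show ?thesis
  proof (elim eventually_mono, intro ballI)
    fix k t assume k: "path_dist (xs k) x < min e (1 / (1 + T))" and t: "t \<in> {0..T}"
    have "min \<bar>xs k t - x t\<bar> (1 / (1 + t)) < min e (1 / (1 + T))"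
      using path_dist_upper[of t "xs k" x] t k by auto
    moreover have "1 / (1 + T) \<le> 1 / (1 + t)" using t by (intro divide_left_mono) auto
    ultimately show "\<bar>xs k t - x t\<bar> \<le> e" by linarith
  qed
qed

section \<open>Functionals continuous for locally uniform convergence\<close>

definition loc_unif_continuous :: "((real \<Rightarrow> real) \<Rightarrow> real) \<Rightarrow> bool" where
  "loc_unif_continuous \<Phi> \<longleftrightarrow>
     (\<forall>xs x. x \<in> cadlag_paths \<longrightarrow> (\<forall>k. xs k \<in> cadlag_paths) \<longrightarrow>
        (\<lambda>k. path_dist (xs k) x) \<longlonglongrightarrow> 0 \<longrightarrow> (\<lambda>k. \<Phi> (xs k)) \<longlonglongrightarrow> \<Phi> x)"

lemma loc_unif_continuousD:
  assumes "loc_unif_continuous \<Phi>" "x \<in> cadlag_paths" "\<And>k. xs k \<in> cadlag_paths"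
    "(\<lambda>k. path_dist (xs k) x) \<longlonglongrightarrow> 0"
  shows "(\<lambda>k. \<Phi> (xs k)) \<longlonglongrightarrow> \<Phi> x"
  using assms unfolding loc_unif_continuous_def by blast

lemma loc_unif_continuous_minus:
  "loc_unif_continuous \<Phi> \<Longrightarrow> loc_unif_continuous (\<lambda>x. - \<Phi> x)"
  unfolding loc_unif_continuous_def by (intro allI impI tendsto_minus) simp

text \<open>Locally uniform convergence is Skorohod convergence with the identity as every time
  change, hence the stronger of the two, and it has more continuous functionals.\<close>

lemma skorohod_continuous_imp_loc_unif_continuous:
  assumes "skorohod_continuous \<Phi>"
  shows "loc_unif_continuous \<Phi>"
  unfolding loc_unif_continuous_def
proof (intro allI impI)
  fix xs x assume *: "x \<in> cadlag_paths" "\<forall>k. xs k \<in> cadlag_paths"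
    "(\<lambda>k. path_dist (xs k) x) \<longlonglongrightarrow> 0"
  have "(\<lambda>t. t) \<in> time_changes"
    unfolding time_changes_def by (auto simp: strict_mono_on_def)
  then have "skorohod_conv xs x"
    unfolding skorohod_conv_def using path_dist_tendsto_0D[OF *(3)]
    by (intro exI[of _ "\<lambda>_ t. t"]) auto
  then show "(\<lambda>k. \<Phi> (xs k)) \<longlonglongrightarrow> \<Phi> x"
    using assms * unfolding skorohod_continuous_def by blast
qed

section \<open>Lipschitz functionals and inf-convolutions\<close>

definition lipschitz_functional :: "real \<Rightarrow> ((real \<Rightarrow> real) \<Rightarrow> real) \<Rightarrow> bool" where
  "lipschitz_functional L \<Psi> \<longleftrightarrow>
     (\<forall>x\<in>cadlag_paths. \<forall>y\<in>cadlag_paths. \<bar>\<Psi> x - \<Psi> y\<bar> \<le> L * path_dist x y)"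

lemma lipschitz_functional_imp_continuous:
  assumes "lipschitz_functional L \<Psi>"
  shows "loc_unif_continuous \<Psi>"
  unfolding loc_unif_continuous_def
proof (intro allI impI)
  fix xs x assume *: "x \<in> cadlag_paths" "\<forall>k. xs k \<in> cadlag_paths"
    "(\<lambda>k. path_dist (xs k) x) \<longlonglongrightarrow> 0"
  have "(\<lambda>k. L * path_dist (xs k) x) \<longlonglongrightarrow> 0"
    using tendsto_mult[OF tendsto_const *(3), of L] by simp
  then have "(\<lambda>k. \<Psi> (xs k) - \<Psi> x) \<longlonglongrightarrow> 0"
    by (rule Lim_null_comparison[rotated])
      (use assms * in \<open>auto simp: lipschitz_functional_def\<close>)
  then show "(\<lambda>k. \<Psi> (xs k)) \<longlonglongrightarrow> \<Psi> x" by (simp add: LIM_zero_iff)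
qed

text \<open>The Pasch-Hausdorff envelope, the largest \<open>k\<close>-Lipschitz minorant. The
  infimum ranges over cadlag paths because \<open>\<Phi>\<close> is controlled only there.\<close>

definition inf_conv :: "((real \<Rightarrow> real) \<Rightarrow> real) \<Rightarrow> nat \<Rightarrow> (real \<Rightarrow> real) \<Rightarrow> real" where
  "inf_conv \<Phi> k x = (INF y\<in>cadlag_paths. \<Phi> y + real k * path_dist x y)"

lemma zero_cadlag: "(\<lambda>_. 0) \<in> cadlag_paths"
  unfolding cadlag_paths_def by auto

lemma inf_conv_lower:
  assumes "\<forall>f\<in>cadlag_paths. \<bar>\<Phi> f\<bar> \<le> B" "y \<in> cadlag_paths"
  shows "inf_conv \<Phi> k x \<le> \<Phi> y + real k * path_dist x y"
  unfolding inf_conv_def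
proof (rule cINF_lower)
  show "bdd_below ((\<lambda>y. \<Phi> y + real k * path_dist x y) ` cadlag_paths)"
  proof (rule bdd_belowI2)
    fix y assume "y \<in> cadlag_paths"
    then have "- B \<le> \<Phi> y" using assms(1)[THEN bspec, of y] by linarith
    then show "- B \<le> \<Phi> y + real k * path_dist x y"
      using path_dist_nonneg[of x y] by (simp add: add_increasing2)
  qed
qed (use assms in auto)

lemma inf_conv_greatest:
  assumes "\<And>y. y \<in> cadlag_paths \<Longrightarrow> e \<le> \<Phi> y + real k * path_dist x y"
  shows "e \<le> inf_conv \<Phi> k x"
  unfolding inf_conv_def by (rule cINF_greatest) (use assms zero_cadlag in auto)

lemma inf_conv_le:
  assumes "\<forall>f\<in>cadlag_paths. \<bar>\<Phi> f\<bar> \<le> B" "x \<in> cadlag_paths"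
  shows "inf_conv \<Phi> k x \<le> \<Phi> x"
  using inf_conv_lower[OF assms, where k=k and x=x] by simp

lemma inf_conv_abs_le:
  assumes "\<forall>f\<in>cadlag_paths. \<bar>\<Phi> f\<bar> \<le> B" "x \<in> cadlag_paths"
  shows "\<bar>inf_conv \<Phi> k x\<bar> \<le> B"
proof -
  have "- B \<le> inf_conv \<Phi> k x"
  proof (rule inf_conv_greatest)
    fix y assume "y \<in> cadlag_paths"
    then have "- B \<le> \<Phi> y" using assms(1)[THEN bspec, of y] by linarith
    then show "- B \<le> \<Phi> y + real k * path_dist x y"
      using path_dist_nonneg[of x y] by (simp add: add_increasing2)
  qed
  moreover have "inf_conv \<Phi> k x \<le> B"
    using inf_conv_le[OF assms, where k=k] assms(1)[THEN bspec, OF assms(2)] by linarith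
  ultimately show ?thesis by auto
qed

text \<open>By the triangle inequality each function under the infimum is \<open>k\<close>-Lipschitz
  in \<open>x\<close>, and infima preserve this.\<close>

lemma inf_conv_lipschitz:
  assumes "\<forall>f\<in>cadlag_paths. \<bar>\<Phi> f\<bar> \<le> B"
  shows "lipschitz_functional (real k) (inf_conv \<Phi> k)"
proof -
  have *: "inf_conv \<Phi> k x - real k * path_dist x z \<le> inf_conv \<Phi> k z" for x z
  proof (rule inf_conv_greatest)
    fix y assume "y \<in> cadlag_paths"
    then have "inf_conv \<Phi> k x \<le> \<Phi> y + real k * path_dist x y"
      by (rule inf_conv_lower[OF assms])
    also have "\<dots> \<le> \<Phi> y + real k * (path_dist x z + path_dist z y)"
      by (intro add_left_mono mult_left_mono path_dist_triangle) auto
    finally show "inf_conv \<Phi> k x - real k * path_dist x z \<le> \<Phi> y + real k * path_dist z y"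
      by (simp add: algebra_simps)
  qed
  show ?thesis
    unfolding lipschitz_functional_def
  proof (intro ballI)
    fix x z
    show "\<bar>inf_conv \<Phi> k x - inf_conv \<Phi> k z\<bar> \<le> real k * path_dist x z"
      using *[of x z] *[of z x] path_dist_commute[of x z] by auto
  qed
qed

text \<open>Competitors \<open>y\<close> within \<delta> of \<open>x\<close> have
  \<open>\<Phi> y\<close> close to \<open>\<Phi> x\<close>. All others pay a penalty of at least
  \<open>k * \<delta>\<close>, which for large \<open>k\<close> exceeds the oscillation
  \<open>2 * B\<close>.\<close>

lemma inf_conv_tendsto:
  assumes bd: "\<forall>f\<in>cadlag_paths. \<bar>\<Phi> f\<bar> \<le> B" and cont: "loc_unif_continuous \<Phi>"
    and x: "x \<in> cadlag_paths"
  shows "(\<lambda>k. inf_conv \<Phi> k x) \<longlonglongrightarrow> \<Phi> x"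
proof (rule LIMSEQ_I)
  fix e :: real assume e: "e > 0"
  \<comment> \<open>Continuity is assumed along sequences only. If no \<delta> worked, choosing a
    bad path at distance below \<open>1 / Suc k\<close> for each \<open>k\<close> would give a
    sequence contradicting it.\<close>
  have "\<exists>\<delta>>0. \<forall>y\<in>cadlag_paths. path_dist y x < \<delta> \<longrightarrow> \<bar>\<Phi> y - \<Phi> x\<bar> < e/2"
  proof (rule ccontr)
    assume neg: "\<not> ?thesis"
    have "\<exists>y\<in>cadlag_paths. path_dist y x < 1 / real (Suc k) \<and> \<not> \<bar>\<Phi> y - \<Phi> x\<bar> < e/2" for k
    proof -
      have "1 / real (Suc k) > 0" by simp
      then show ?thesis using neg by blast
    qed
    then obtain ys where ys: "\<And>k. ys k \<in> cadlag_paths"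
      "\<And>k. path_dist (ys k) x < 1 / real (Suc k)" "\<And>k. \<not> \<bar>\<Phi> (ys k) - \<Phi> x\<bar> < e/2"
      by metis
    have "(\<lambda>k. path_dist (ys k) x) \<longlonglongrightarrow> 0"
    proof (rule tendsto_sandwich[OF _ _ tendsto_const LIMSEQ_inverse_real_of_nat])
      show "eventually (\<lambda>k. 0 \<le> path_dist (ys k) x) sequentially" by (simp add: path_dist_nonneg)
      show "eventually (\<lambda>k. path_dist (ys k) x \<le> inverse (real (Suc k))) sequentially"
        using ys(2) by (auto simp: inverse_eq_divide less_imp_le)
    qed
    then have "(\<lambda>k. \<Phi> (ys k)) \<longlonglongrightarrow> \<Phi> x"
      by (intro loc_unif_continuousD[OF cont x ys(1)])
    then have "eventually (\<lambda>k. dist (\<Phi> (ys k)) (\<Phi> x) < e/2) sequentially"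
      using e by (intro tendstoD) auto
    then show False using ys(3) by (auto simp: dist_real_def eventually_sequentially)
  qed
  then obtain \<delta> where \<delta>: "\<delta> > 0"
    "\<And>y. y \<in> cadlag_paths \<Longrightarrow> path_dist y x < \<delta> \<Longrightarrow> \<bar>\<Phi> y - \<Phi> x\<bar> < e/2" by blast
  obtain K :: nat where K: "2 * B / \<delta> \<le> real K" using real_arch_simple by blast
  have "norm (inf_conv \<Phi> k x - \<Phi> x) < e" if k: "k \<ge> K" for k
  proof -
    have "\<Phi> x - e/2 \<le> inf_conv \<Phi> k x"
    proof (rule inf_conv_greatest)
      fix y assume y: "y \<in> cadlag_paths"
      show "\<Phi> x - e/2 \<le> \<Phi> y + real k * path_dist x y"
      proof (cases "path_dist y x < \<delta>")
        case True
        then have "\<Phi> x - e/2 \<le> \<Phi> y" using \<delta>(2)[OF y True] by linarith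
        then show ?thesis using path_dist_nonneg[of x y] by (simp add: add_increasing2)
      next
        case False
        have "2 * B \<le> real k * \<delta>"
          using order_trans[OF K, of "real k"] k \<delta>(1) by (simp add: pos_divide_le_eq)
        also have "\<dots> \<le> real k * path_dist x y"
          using False path_dist_commute[of x y] by (intro mult_left_mono) auto
        finally show ?thesis using bd[THEN bspec, OF y] bd[THEN bspec, OF x] e by linarith
      qed
    qed
    moreover have "inf_conv \<Phi> k x \<le> \<Phi> x" by (rule inf_conv_le[OF bd x])
    ultimately show ?thesis using e by auto
  qed
  then show "\<exists>no. \<forall>n\<ge>no. norm (inf_conv \<Phi> n x - \<Phi> x) < e" by blast
qed

section \<open>Step paths and the measurability of functionals along them\<close>

lemma continuous_imp_cadlag:
  assumes "continuous_on {0..} x"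
  shows "x \<in> cadlag_paths"
  unfolding cadlag_paths_def
proof (intro CollectI allI impI conjI)
  fix t :: real assume t: "t \<ge> 0"
  have *: "(x \<longlongrightarrow> x t) (at t within {0..})" using assms t by (auto simp: continuous_on_def)
  show "(x \<longlongrightarrow> x t) (at_right t)"
    by (rule tendsto_within_subset[OF *]) (use t in auto)
  show "\<exists>l. (x \<longlongrightarrow> l) (at_left t)" if "t > 0"
  proof -
    have "at_left t = at t within {0..<t}"
      by (rule at_within_nhd[of _ "{0<..}"]) (use that in auto)
    then show ?thesis
      using tendsto_within_subset[OF *, of "{0..<t}"] by force
  qed
qed

text \<open>The common shape of the rescaled process and of the grid paths: a deterministic factor
  \<open>h\<close> times a sequence read at index \<open>p + s * t\<close> rounded down. Randomness
  enters only through \<open>a\<close>, so measurability can be studied on the sequence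
  space.\<close>

definition step_path :: "(real \<Rightarrow> real) \<Rightarrow> real \<Rightarrow> real \<Rightarrow> (nat \<Rightarrow> real) \<Rightarrow> real \<Rightarrow> real" where
  "step_path h p s a = (\<lambda>t. h t * a (nat \<lfloor>p + s * t\<rfloor>))"

lemma step_path_cadlag:
  assumes "continuous_on {0..} h" "s \<ge> 0"
  shows "step_path h p s a \<in> cadlag_paths"
  unfolding cadlag_paths_def
proof (intro CollectI allI impI conjI)
  fix t :: real assume t: "t \<ge> 0"
  have h: "h \<in> cadlag_paths" by (rule continuous_imp_cadlag[OF assms(1)])
  have "eventually (\<lambda>u. \<lfloor>p + s * u\<rfloor> = \<lfloor>p + s * t\<rfloor>) (at_right t)"
  proof -
    have "((\<lambda>u. p + s * u) \<longlongrightarrow> p + s * t) (at_right t)" by (intro tendsto_intros)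
    then have "eventually (\<lambda>u. p + s * u < of_int \<lfloor>p + s * t\<rfloor> + 1) (at_right t)"
      by (rule order_tendstoD) linarith
    moreover have "eventually (\<lambda>u. u > t) (at_right t)" by (simp add: eventually_at_filter)
    ultimately show ?thesis
    proof eventually_elim
      case (elim u)
      have "p + s * t \<le> p + s * u" using elim(2) assms(2) by (simp add: mult_left_mono)
      then show ?case using elim(1) by linarith
    qed
  qed
  then have "eventually (\<lambda>u. h u * a (nat \<lfloor>p + s * t\<rfloor>) = step_path h p s a u) (at_right t)"
    by eventually_elim (simp add: step_path_def)
  moreover have "((\<lambda>u. h u * a (nat \<lfloor>p + s * t\<rfloor>)) \<longlongrightarrow> step_path h p s a t) (at_right t)"
    unfolding step_path_def
    using h t by (intro tendsto_intros) (auto simp: cadlag_paths_def)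
  ultimately show "(step_path h p s a \<longlongrightarrow> step_path h p s a t) (at_right t)"
    by (rule Lim_transform_eventually[rotated])
  show "\<exists>l. (step_path h p s a \<longlongrightarrow> l) (at_left t)" if t0: "t > 0"
  proof -
    obtain l where l: "(h \<longlongrightarrow> l) (at_left t)" using h t0 less_imp_le[OF t0] unfolding cadlag_paths_def by blast
    \<comment> \<open>The index just to the left of \<open>t\<close>. For \<open>s > 0\<close> it is
      one below the ceiling, which also covers the times \<open>t\<close> at which the path
      jumps.\<close>
    define c where "c = (if s = 0 then \<lfloor>p\<rfloor> else \<lceil>p + s * t\<rceil> - 1)"
    have "eventually (\<lambda>u. \<lfloor>p + s * u\<rfloor> = c) (at_left t)"
    proof (cases "s = 0")
      case False
      have "((\<lambda>u. p + s * u) \<longlongrightarrow> p + s * t) (at_left t)" by (intro tendsto_intros)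
      then have "eventually (\<lambda>u. p + s * u > of_int \<lceil>p + s * t\<rceil> - 1) (at_left t)"
        by (rule order_tendstoD) linarith
      moreover have "eventually (\<lambda>u. u < t) (at_left t)" by (simp add: eventually_at_filter)
      ultimately show ?thesis
      proof eventually_elim
        case (elim u)
        have "p + s * u < p + s * t" using elim(2) assms(2) False by simp
        then show ?case using elim(1) False unfolding c_def by simp linarith
      qed
    qed (simp add: c_def)
    then have "eventually (\<lambda>u. h u * a (nat c) = step_path h p s a u) (at_left t)"
      by eventually_elim (simp add: step_path_def)
    moreover have "((\<lambda>u. h u * a (nat c)) \<longlongrightarrow> l * a (nat c)) (at_left t)"
      by (intro tendsto_intros l)
    ultimately have "(step_path h p s a \<longlongrightarrow> l * a (nat c)) (at_left t)"
      by (rule Lim_transform_eventually[rotated])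
    then show ?thesis by blast
  qed
qed

text \<open>Before time \<open>T\<close> only the finitely many entries up to \<open>m\<close> are
  read, so pointwise convergence of the sequences is uniform there, and \<open>h\<close> is bounded
  on the compact interval.\<close>

lemma step_path_tendsto:
  assumes h: "continuous_on {0..} h" and s: "s \<ge> 0" and a: "\<And>i. (\<lambda>k. as k i) \<longlonglongrightarrow> a i"
  shows "(\<lambda>k. path_dist (step_path h p s (as k)) (step_path h p s a)) \<longlonglongrightarrow> 0"
proof (rule path_dist_tendsto_0I)
  fix T e :: real assume T: "T > 0" and e: "e > 0"
  have "compact (h ` {0..T})"
    by (intro compact_continuous_image continuous_on_subset[OF h]) auto
  then obtain C where C: "C > 0" "\<And>t. t \<in> {0..T} \<Longrightarrow> \<bar>h t\<bar> \<le> C"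
    by (auto dest!: compact_imp_bounded simp: bounded_pos)
  define m where "m = nat \<lfloor>p + s * T\<rfloor>"
  have "eventually (\<lambda>k. \<bar>as k i - a i\<bar> < e / C) sequentially" for i
    using tendstoD[OF a[of i], of "e / C"] e C(1) by (simp add: dist_real_def)
  then have "eventually (\<lambda>k. \<forall>i\<in>{..m}. \<bar>as k i - a i\<bar> < e / C) sequentially"
    by (intro eventually_ball_finite) auto
  then show "eventually (\<lambda>k. \<forall>t. 0 \<le> t \<longrightarrow> t < T \<longrightarrow>
      \<bar>step_path h p s (as k) t - step_path h p s a t\<bar> \<le> e) sequentially"
  proof (elim eventually_mono, intro allI impI)
    fix k t assume k: "\<forall>i\<in>{..m}. \<bar>as k i - a i\<bar> < e / C" and t: "0 \<le> t" "t < T"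
    define i where "i = nat \<lfloor>p + s * t\<rfloor>"
    have "p + s * t \<le> p + s * T" using t s by (simp add: mult_left_mono)
    then have "i \<le> m" unfolding i_def m_def by (intro nat_mono floor_mono)
    then have "\<bar>as k i - a i\<bar> \<le> e / C" using k by (auto simp: less_imp_le)
    then have "\<bar>h t\<bar> * \<bar>as k i - a i\<bar> \<le> C * (e / C)"
      using C(2)[of t] t C(1) by (intro mult_mono) auto
    then show "\<bar>step_path h p s (as k) t - step_path h p s a t\<bar> \<le> e"
      using C(1) unfolding step_path_def i_def[symmetric]
      by (simp add: abs_mult[symmetric] right_diff_distrib)
  qed
qed

text \<open>The product topology on \<open>nat \<Rightarrow> real\<close> is first countable, so
  sequential continuity suffices.\<close>

lemma continuous_step_path_functional:
  assumes \<Psi>: "loc_unif_continuous \<Psi>" and h: "continuous_on {0..} h" and s: "s \<ge> 0"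
  shows "continuous_on UNIV (\<lambda>a. \<Psi> (step_path h p s a))"
  unfolding continuous_on_sequentially
proof (intro allI ballI impI)
  fix as and a :: "nat \<Rightarrow> real" assume as: "(\<forall>n. as n \<in> UNIV) \<and> as \<longlonglongrightarrow> a"
  have "(\<lambda>k. as k i) \<longlonglongrightarrow> a i" for i
    using as continuous_on_tendsto_compose[OF continuous_on_product_coordinates[of i], of as a]
    by auto
  then show "((\<lambda>a. \<Psi> (step_path h p s a)) \<circ> as) \<longlonglongrightarrow> \<Psi> (step_path h p s a)"
    unfolding comp_def
    by (intro loc_unif_continuousD[OF \<Psi>] step_path_cadlag step_path_tendsto h s)
qed

lemma measurable_step_path_functional:
  assumes \<Psi>: "loc_unif_continuous \<Psi>" and h: "continuous_on {0..} h" and s: "s \<ge> 0"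
    and [measurable]: "\<And>i. \<xi> i \<in> borel_measurable M"
  shows "(\<lambda>\<omega>. \<Psi> (step_path h p s (\<lambda>i. \<xi> i \<omega>))) \<in> borel_measurable M"
proof -
  have "(\<lambda>\<omega>. (\<lambda>i. \<xi> i \<omega>)) \<in> borel_measurable M"
    by (rule measurable_coordinatewise_then_product) simp
  moreover have "(\<lambda>a. \<Psi> (step_path h p s a)) \<in> borel_measurable borel"
    by (rule borel_measurable_continuous_onI[OF continuous_step_path_functional[OF \<Psi> h s]])
  ultimately show ?thesis by (rule measurable_compose)
qed

text \<open>The inf-convolutions lie below \<open>\<Phi>\<close>, and by dominated convergence one
  of them nearly attains the integral of \<open>\<Phi>\<close> in the limit space. Convergence for
  this Lipschitz functional bounds the lower limit for \<open>\<Phi>\<close> from below; the same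
  bound for \<open>- \<Phi>\<close> gives the upper limit.\<close>

lemma conv_distr_D_lipschitzI:
  assumes M: "prob_space M" and M': "prob_space M'"
    and Xc: "\<And>n \<omega>. \<omega> \<in> space M \<Longrightarrow> X n \<omega> \<in> cadlag_paths"
    and Yc: "\<And>\<omega>. \<omega> \<in> space M' \<Longrightarrow> Y \<omega> \<in> cadlag_paths"
    and Xm: "\<And>n \<Psi>. loc_unif_continuous \<Psi> \<Longrightarrow> (\<lambda>\<omega>. \<Psi> (X n \<omega>)) \<in> borel_measurable M"
    and Ym: "\<And>\<Psi>. loc_unif_continuous \<Psi> \<Longrightarrow> (\<lambda>\<omega>. \<Psi> (Y \<omega>)) \<in> borel_measurable M'"
    and lip: "\<And>\<Psi> L B. lipschitz_functional L \<Psi> \<Longrightarrow> L \<ge> 0 \<Longrightarrow>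
        (\<forall>f\<in>cadlag_paths. \<bar>\<Psi> f\<bar> \<le> B) \<Longrightarrow>
        (\<lambda>n. \<integral>\<omega>. \<Psi> (X n \<omega>) \<partial>M) \<longlonglongrightarrow> (\<integral>\<omega>. \<Psi> (Y \<omega>) \<partial>M')"
  shows "conv_distr_D M X M' Y"
  unfolding conv_distr_D_def
proof (intro allI impI)
  interpret M: prob_space M by fact
  interpret M': prob_space M' by fact
  have lower: "\<forall>e>0. eventually (\<lambda>n. (\<integral>\<omega>. \<Phi> (Y \<omega>) \<partial>M') - e < (\<integral>\<omega>. \<Phi> (X n \<omega>) \<partial>M)) sequentially"
    if \<Phi>: "loc_unif_continuous \<Phi>" and B: "\<forall>f\<in>cadlag_paths. \<bar>\<Phi> f\<bar> \<le> B" for \<Phi> B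
  proof (intro allI impI)
    fix e :: real assume e: "e > 0"
    have icm: "loc_unif_continuous (inf_conv \<Phi> k)" for k
      by (rule lipschitz_functional_imp_continuous[OF inf_conv_lipschitz[OF B]])
    have "(\<lambda>k. \<integral>\<omega>. inf_conv \<Phi> k (Y \<omega>) \<partial>M') \<longlonglongrightarrow> (\<integral>\<omega>. \<Phi> (Y \<omega>) \<partial>M')"
    proof (rule integral_dominated_convergence[where w="\<lambda>_. B"])
      show "AE \<omega> in M'. (\<lambda>k. inf_conv \<Phi> k (Y \<omega>)) \<longlonglongrightarrow> \<Phi> (Y \<omega>)"
        by (intro AE_I2 inf_conv_tendsto[OF B \<Phi> Yc])
      show "AE \<omega> in M'. norm (inf_conv \<Phi> k (Y \<omega>)) \<le> B" for k
        by (simp add: inf_conv_abs_le[OF B Yc] AE_I2)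
    qed (simp_all add: Ym icm \<Phi>)
    then have "eventually (\<lambda>k. (\<integral>\<omega>. \<Phi> (Y \<omega>) \<partial>M') - e/2 < (\<integral>\<omega>. inf_conv \<Phi> k (Y \<omega>) \<partial>M')) sequentially"
      by (rule order_tendstoD) (use e in auto)
    then obtain k where k: "(\<integral>\<omega>. \<Phi> (Y \<omega>) \<partial>M') - e/2 < (\<integral>\<omega>. inf_conv \<Phi> k (Y \<omega>) \<partial>M')"
      by (auto simp: eventually_sequentially)
    have "(\<lambda>n. \<integral>\<omega>. inf_conv \<Phi> k (X n \<omega>) \<partial>M) \<longlonglongrightarrow> (\<integral>\<omega>. inf_conv \<Phi> k (Y \<omega>) \<partial>M')"
      by (rule lip[OF inf_conv_lipschitz[OF B], where B=B]) (simp_all add: inf_conv_abs_le[OF B])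
    then have "eventually (\<lambda>n. (\<integral>\<omega>. inf_conv \<Phi> k (Y \<omega>) \<partial>M') - e/2 < (\<integral>\<omega>. inf_conv \<Phi> k (X n \<omega>) \<partial>M)) sequentially"
      by (rule order_tendstoD) (use e in auto)
    then show "eventually (\<lambda>n. (\<integral>\<omega>. \<Phi> (Y \<omega>) \<partial>M') - e < (\<integral>\<omega>. \<Phi> (X n \<omega>) \<partial>M)) sequentially"
    proof eventually_elim
      case (elim n)
      have "(\<integral>\<omega>. inf_conv \<Phi> k (X n \<omega>) \<partial>M) \<le> (\<integral>\<omega>. \<Phi> (X n \<omega>) \<partial>M)"
      proof (rule integral_mono)
        show "integrable M (\<lambda>\<omega>. inf_conv \<Phi> k (X n \<omega>))"
          by (rule M.integrable_const_bound[where B=B])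
            (simp_all add: Xm[OF icm] inf_conv_abs_le[OF B Xc] AE_I2)
        show "integrable M (\<lambda>\<omega>. \<Phi> (X n \<omega>))"
          by (rule M.integrable_const_bound[where B=B]) (simp_all add: Xm[OF \<Phi>] B[THEN bspec, OF Xc] AE_I2)
      qed (rule inf_conv_le[OF B Xc])
      then show ?case using elim k by linarith
    qed
  qed
  fix \<Phi> assume "\<exists>B. \<forall>f\<in>cadlag_paths. \<bar>\<Phi> f\<bar> \<le> B" and sk: "skorohod_continuous \<Phi>"
  then obtain B where B: "\<forall>f\<in>cadlag_paths. \<bar>\<Phi> f\<bar> \<le> B" by blast
  have \<Phi>: "loc_unif_continuous \<Phi>" by (rule skorohod_continuous_imp_loc_unif_continuous[OF sk])
  show "(\<lambda>n. \<integral>\<omega>. \<Phi> (X n \<omega>) \<partial>M) \<longlonglongrightarrow> (\<integral>\<omega>. \<Phi> (Y \<omega>) \<partial>M')"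
  proof (rule order_tendstoI)
    fix a assume "a < (\<integral>\<omega>. \<Phi> (Y \<omega>) \<partial>M')"
    then show "eventually (\<lambda>n. a < (\<integral>\<omega>. \<Phi> (X n \<omega>) \<partial>M)) sequentially"
      using lower[OF \<Phi> B, rule_format, of "(\<integral>\<omega>. \<Phi> (Y \<omega>) \<partial>M') - a"] by simp
  next
    fix a assume "a > (\<integral>\<omega>. \<Phi> (Y \<omega>) \<partial>M')"
    then show "eventually (\<lambda>n. a > (\<integral>\<omega>. \<Phi> (X n \<omega>) \<partial>M)) sequentially"
      using lower[OF loc_unif_continuous_minus[OF \<Phi>], of B, rule_format,
          of "a - (\<integral>\<omega>. \<Phi> (Y \<omega>) \<partial>M')"] B by simp
  qed
qed

section \<open>Martingales with bounded increments\<close>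

text \<open>Both bounds come from \<open>exp y \<ge> 1 + y\<close>, once at \<open>- x\<close> and
  once at \<open>x\<close>, where the reciprocal \<open>1 / (1 + x)\<close> is at most
  \<open>1 - x + x^2\<close>.\<close>

lemma exp_minus_taylor:
  fixes x :: real assumes "x \<ge> 0"
  shows "\<bar>exp (- x) - (1 - x)\<bar> \<le> x\<^sup>2"
proof -
  have 1: "1 - x \<le> exp (- x)" using exp_ge_add_one_self[of "- x"] by simp
  have "exp (- x) \<le> 1 / (1 + x)"
    using exp_ge_add_one_self[of x] assms by (simp add: exp_minus inverse_eq_divide divide_left_mono)
  also have "\<dots> \<le> 1 - x + x\<^sup>2"
    using assms by (simp add: field_simps power2_eq_square)
  finally show ?thesis using 1 by simp
qed

lemma norm_mult_le_bound:
  fixes a b :: "'a::real_normed_div_algebra"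
  assumes "norm a \<le> 1" "norm b \<le> C"
  shows "norm (a * b) \<le> C"
  using mult_mono[OF assms] assms order_trans[OF norm_ge_zero assms(2)] by (simp add: norm_mult)

lemma norm_integral_le:
  fixes f :: "'a \<Rightarrow> 'b::{banach, second_countable_topology}"
  assumes "integrable M f" "integrable M g" "\<And>\<omega>. \<omega> \<in> space M \<Longrightarrow> norm (f \<omega>) \<le> g \<omega>"
  shows "norm (\<integral>\<omega>. f \<omega> \<partial>M) \<le> (\<integral>\<omega>. g \<omega> \<partial>M)"
  by (rule order_trans[OF integral_norm_bound integral_mono]) (use assms in auto)

text \<open>The martingale property and the conditional variance are expressed by testing against
  bounded \<open>F k\<close>-measurable weights, so no conditional expectation appears. The number
  \<open>s k\<close> bounds the increment and is also its unit of scale: \<open>\<kappa> k\<close>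
  is the conditional variance divided by \<open>(s k)^2\<close>.\<close>

locale bounded_martingale = prob_space M for M :: "'a measure" +
  fixes F :: "nat \<Rightarrow> 'a measure" and \<zeta> :: "nat \<Rightarrow> 'a \<Rightarrow> real" and s :: "nat \<Rightarrow> real"
    and \<kappa> :: "nat \<Rightarrow> 'a \<Rightarrow> real" and \<sigma>2 :: real
  assumes F_sub: "\<And>k. subalgebra M (F k)"
    and F_mono: "\<And>k. subalgebra (F (Suc k)) (F k)"
    and \<zeta>_meas: "\<And>k. \<zeta> k \<in> borel_measurable (F (Suc k))"
    and \<zeta>_bound: "\<And>k \<omega>. \<omega> \<in> space M \<Longrightarrow> \<bar>\<zeta> k \<omega>\<bar> \<le> s k"
    and \<kappa>_meas [measurable]: "\<And>k. \<kappa> k \<in> borel_measurable M"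
    and \<kappa>_bound: "\<And>k \<omega>. \<omega> \<in> space M \<Longrightarrow> \<bar>\<kappa> k \<omega>\<bar> \<le> 1"
    and mean_0: "\<And>k H B. H \<in> borel_measurable (F k) \<Longrightarrow> \<forall>\<omega>\<in>space M. \<bar>H \<omega>\<bar> \<le> B \<Longrightarrow>
          expectation (\<lambda>\<omega>. H \<omega> * \<zeta> k \<omega>) = 0"
    and variance: "\<And>k H B. H \<in> borel_measurable (F k) \<Longrightarrow> \<forall>\<omega>\<in>space M. \<bar>H \<omega>\<bar> \<le> B \<Longrightarrow>
          expectation (\<lambda>\<omega>. H \<omega> * (\<zeta> k \<omega>)\<^sup>2) = (s k)\<^sup>2 * expectation (\<lambda>\<omega>. H \<omega> * \<kappa> k \<omega>)"
    and \<sigma>2: "0 \<le> \<sigma>2" "\<sigma>2 \<le> 1"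
    and \<kappa>_conv: "(\<lambda>k. expectation (\<lambda>\<omega>. \<bar>\<kappa> k \<omega> - \<sigma>2\<bar>)) \<longlonglongrightarrow> 0"
begin

definition S :: "nat \<Rightarrow> 'a \<Rightarrow> real" where "S n \<omega> = (\<Sum>k<n. \<zeta> k \<omega>)"

text \<open>The deterministic clock. It dominates the second moments, and
  \<open>\<sigma>2 * Q\<close> is what the quadratic variation approaches.\<close>

definition Q :: "nat \<Rightarrow> real" where "Q n = (\<Sum>k<n. (s k)\<^sup>2)"

text \<open>The mean error made when the normalised conditional variance of step \<open>k\<close> is
  replaced by its limit.\<close>

definition dev :: "nat \<Rightarrow> real" where "dev k = expectation (\<lambda>\<omega>. \<bar>\<kappa> k \<omega> - \<sigma>2\<bar>)"

lemma s_nonneg: "0 \<le> s k"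
proof -
  obtain \<omega> where "\<omega> \<in> space M" using not_empty by blast
  then show ?thesis using \<zeta>_bound[of \<omega> k] by linarith
qed

lemma Q_mono: "a \<le> b \<Longrightarrow> Q a \<le> Q b"
  unfolding Q_def by (intro sum_mono2) auto

lemma space_F [simp]: "space (F k) = space M"
  using F_sub[of k] by (simp add: subalgebra_def)

lemma F_measD: "f \<in> borel_measurable (F k) \<Longrightarrow> f \<in> borel_measurable M"
  by (rule measurable_from_subalg[OF F_sub])

lemma F_meas_mono:
  assumes "j \<le> k" "f \<in> borel_measurable (F j)"
  shows "f \<in> borel_measurable (F k)"
  using assms by (induction k rule: dec_induct) (auto intro: measurable_from_subalg[OF F_mono])

lemma \<zeta>_measM [measurable]: "\<zeta> k \<in> borel_measurable M"
  by (rule F_measD[OF \<zeta>_meas])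

lemma S_meas: "j \<le> k \<Longrightarrow> S j \<in> borel_measurable (F k)"
  unfolding S_def by (intro borel_measurable_sum F_meas_mono[OF _ \<zeta>_meas]) auto

lemma S_measM [measurable]: "S j \<in> borel_measurable M"
  unfolding S_def by measurable

lemma S_Suc: "S (Suc b) \<omega> = S b \<omega> + \<zeta> b \<omega>" by (simp add: S_def)

lemma S_bound: "\<omega> \<in> space M \<Longrightarrow> \<bar>S b \<omega>\<bar> \<le> (\<Sum>k<b. s k)"
  unfolding S_def by (rule order_trans[OF sum_abs sum_mono]) (auto simp: \<zeta>_bound)

lemma S_diff_bound: "\<omega> \<in> space M \<Longrightarrow> \<bar>S b \<omega> - S a \<omega>\<bar> \<le> (\<Sum>k<b. s k) + (\<Sum>k<a. s k)"
  using S_bound[of \<omega> a] S_bound[of \<omega> b] by linarith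

lemma integrable_bounded:
  fixes f :: "'a \<Rightarrow> 'b::{banach, second_countable_topology}"
  assumes "f \<in> borel_measurable M" "\<And>\<omega>. \<omega> \<in> space M \<Longrightarrow> norm (f \<omega>) \<le> B"
  shows "integrable M f"
  using assms by (intro integrable_const_bound[where B=B] AE_I2) auto

lemma integrable_power: "integrable M (\<lambda>\<omega>. (S b \<omega> - S a \<omega>) ^ p)"
  by (rule integrable_bounded[where B="((\<Sum>k<b. s k) + (\<Sum>k<a. s k)) ^ p"])
    (auto simp: power_abs intro!: power_mono S_diff_bound)

lemma expectation_\<zeta>_power:
  assumes H: "H \<in> borel_measurable (F k)" and B: "\<And>\<omega>. \<omega> \<in> space M \<Longrightarrow> \<bar>H \<omega>\<bar> \<le> B"
  shows "integrable M (\<lambda>\<omega>. H \<omega> * (\<zeta> k \<omega>) ^ p)"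
proof (rule integrable_bounded[where B="B * s k ^ p"])
  have [measurable]: "H \<in> borel_measurable M" by (rule F_measD[OF H])
  show "(\<lambda>\<omega>. H \<omega> * (\<zeta> k \<omega>) ^ p) \<in> borel_measurable M" by measurable
  fix \<omega> assume \<omega>: "\<omega> \<in> space M"
  show "norm (H \<omega> * (\<zeta> k \<omega>) ^ p) \<le> B * s k ^ p"
    using B[OF \<omega>] \<zeta>_bound[OF \<omega>, of k]
    by (auto simp: abs_mult power_abs intro!: mult_mono power_mono)
qed

text \<open>A new increment is orthogonal to the sum collected so far, and its square is at most
  \<open>(s b)^2\<close>.\<close>

lemma second_moment:
  assumes "a \<le> b"
  shows "expectation (\<lambda>\<omega>. (S b \<omega> - S a \<omega>)\<^sup>2) \<le> Q b - Q a"
  using assms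
proof (induction b rule: dec_induct)
  case (step b)
  define T where "T \<omega> = S b \<omega> - S a \<omega>" for \<omega>
  have Tm: "T \<in> borel_measurable (F b)"
    unfolding T_def using step by (intro borel_measurable_diff S_meas) auto
  have Tb: "\<bar>T \<omega>\<bar> \<le> (\<Sum>k<b. s k) + (\<Sum>k<a. s k)" if "\<omega> \<in> space M" for \<omega>
    unfolding T_def by (rule S_diff_bound[OF that])
  have i1: "integrable M (\<lambda>\<omega>. T \<omega> * \<zeta> b \<omega>)"
    using expectation_\<zeta>_power[OF Tm Tb, where p=1] by simp
  have i2: "integrable M (\<lambda>\<omega>. (\<zeta> b \<omega>)\<^sup>2)"
    using expectation_\<zeta>_power[of "\<lambda>_. 1" b 1, where p=2] by simp
  have i3: "integrable M (\<lambda>\<omega>. (T \<omega>)\<^sup>2)" unfolding T_def by (rule integrable_power)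
  have "expectation (\<lambda>\<omega>. (S (Suc b) \<omega> - S a \<omega>)\<^sup>2) =
      expectation (\<lambda>\<omega>. (T \<omega>)\<^sup>2 + 2 * (T \<omega> * \<zeta> b \<omega>) + (\<zeta> b \<omega>)\<^sup>2)"
    by (intro Bochner_Integration.integral_cong) (auto simp: S_Suc T_def power2_eq_square algebra_simps)
  also have "\<dots> = expectation (\<lambda>\<omega>. (T \<omega>)\<^sup>2) + 2 * expectation (\<lambda>\<omega>. T \<omega> * \<zeta> b \<omega>)
      + expectation (\<lambda>\<omega>. (\<zeta> b \<omega>)\<^sup>2)"
    using i1 i2 i3 by simp
  also have "expectation (\<lambda>\<omega>. T \<omega> * \<zeta> b \<omega>) = 0" using Tb by (intro mean_0[OF Tm]) auto
  also have "expectation (\<lambda>\<omega>. (\<zeta> b \<omega>)\<^sup>2) \<le> expectation (\<lambda>\<omega>. (s b)\<^sup>2)"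
    using i2 \<zeta>_bound s_nonneg by (intro integral_mono) (auto simp: abs_le_square_iff[symmetric])
  also have "expectation (\<lambda>\<omega>. (T \<omega>)\<^sup>2) \<le> Q b - Q a"
    unfolding T_def using step by simp
  finally show ?case by (simp add: Q_def prob_space)
qed simp

text \<open>The constant 4 is forced by the induction. With \<open>A = Q b - Q a\<close> and
  \<open>u = (s b)^2\<close>, a step adds at most \<open>8 u A + 3 u^2\<close>, while
  \<open>4 (A + u)^2 - 4 A^2\<close> is \<open>8 u A + 4 u^2\<close>.\<close>

lemma fourth_moment:
  assumes "a \<le> b"
  shows "expectation (\<lambda>\<omega>. (S b \<omega> - S a \<omega>) ^ 4) \<le> 4 * (Q b - Q a)\<^sup>2"
  using assms
proof (induction b rule: dec_induct)
  case (step b)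
  define T where "T \<omega> = S b \<omega> - S a \<omega>" for \<omega>
  have Tm: "T \<in> borel_measurable (F b)"
    unfolding T_def using step by (intro borel_measurable_diff S_meas) auto
  have Tb: "\<bar>T \<omega>\<bar> \<le> (\<Sum>k<b. s k) + (\<Sum>k<a. s k)" if "\<omega> \<in> space M" for \<omega>
    unfolding T_def by (rule S_diff_bound[OF that])
  have T3: "\<bar>T \<omega> ^ 3\<bar> \<le> ((\<Sum>k<b. s k) + (\<Sum>k<a. s k)) ^ 3" if "\<omega> \<in> space M" for \<omega>
    using Tb[OF that] by (simp add: power_abs power_mono)
  have T3m: "(\<lambda>\<omega>. T \<omega> ^ 3) \<in> borel_measurable (F b)" using Tm by measurable
  have i1: "integrable M (\<lambda>\<omega>. T \<omega> ^ 3 * \<zeta> b \<omega>)"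
    using expectation_\<zeta>_power[OF T3m T3, where p=1] by simp
  have i2: "integrable M (\<lambda>\<omega>. (T \<omega>)\<^sup>2)" unfolding T_def by (rule integrable_power)
  have i4: "integrable M (\<lambda>\<omega>. T \<omega> ^ 4)" unfolding T_def by (rule integrable_power)
  have "expectation (\<lambda>\<omega>. (S (Suc b) \<omega> - S a \<omega>) ^ 4) \<le>
      expectation (\<lambda>\<omega>. T \<omega> ^ 4 + 4 * (T \<omega> ^ 3 * \<zeta> b \<omega>) + 8 * (s b)\<^sup>2 * (T \<omega>)\<^sup>2 + 3 * (s b) ^ 4)"
  proof (rule integral_mono[OF integrable_power])
    fix \<omega> assume \<omega>: "\<omega> \<in> space M"
    define z t where "z = \<zeta> b \<omega>" and "t = T \<omega>"
    have z: "z\<^sup>2 \<le> (s b)\<^sup>2" using \<zeta>_bound[OF \<omega>, of b] unfolding z_def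
      using s_nonneg[of b] by (simp add: abs_le_square_iff[symmetric])
    \<comment> \<open>Orthogonality removes only the term linear in \<open>z\<close>. The cubic term
      \<open>4 t z^3\<close> has no sign and is absorbed by completing the square
      \<open>2 z^2 (t - z)^2\<close>.\<close>
    have "(t + z) ^ 4 = t ^ 4 + 4 * (t ^ 3 * z) + 8 * z\<^sup>2 * t\<^sup>2 + 3 * (z\<^sup>2)\<^sup>2 - 2 * z\<^sup>2 * (t - z)\<^sup>2"
      by (simp add: power2_eq_square power4_eq_xxxx power3_eq_cube algebra_simps)
    also have "\<dots> \<le> t ^ 4 + 4 * (t ^ 3 * z) + 8 * z\<^sup>2 * t\<^sup>2 + 3 * (z\<^sup>2)\<^sup>2"
      by simp
    also have "\<dots> \<le> t ^ 4 + 4 * (t ^ 3 * z) + 8 * (s b)\<^sup>2 * t\<^sup>2 + 3 * ((s b)\<^sup>2)\<^sup>2"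
      using mult_right_mono[OF z, of "8 * t\<^sup>2"] power_mono[OF z, of 2] by (simp add: algebra_simps)
    finally show "(S (Suc b) \<omega> - S a \<omega>) ^ 4 \<le>
        T \<omega> ^ 4 + 4 * (T \<omega> ^ 3 * \<zeta> b \<omega>) + 8 * (s b)\<^sup>2 * (T \<omega>)\<^sup>2 + 3 * (s b) ^ 4"
      unfolding t_def z_def T_def by (simp add: S_Suc algebra_simps)
  qed (use i1 i2 i4 in auto)
  also have "\<dots> = expectation (\<lambda>\<omega>. T \<omega> ^ 4) + 4 * expectation (\<lambda>\<omega>. T \<omega> ^ 3 * \<zeta> b \<omega>)
      + 8 * (s b)\<^sup>2 * expectation (\<lambda>\<omega>. (T \<omega>)\<^sup>2) + 3 * (s b) ^ 4"
    using i1 i2 i4 by (simp add: prob_space)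
  also have "expectation (\<lambda>\<omega>. T \<omega> ^ 3 * \<zeta> b \<omega>) = 0" using T3 by (intro mean_0[OF T3m]) auto
  also have "expectation (\<lambda>\<omega>. T \<omega> ^ 4) + 4 * 0 + 8 * (s b)\<^sup>2 * expectation (\<lambda>\<omega>. (T \<omega>)\<^sup>2) + 3 * (s b) ^ 4
      \<le> 4 * (Q b - Q a)\<^sup>2 + 4 * 0 + 8 * (s b)\<^sup>2 * (Q b - Q a) + 3 * (s b) ^ 4"
    unfolding T_def using step second_moment[of a b] by (intro add_mono mult_left_mono) auto
  also have "\<dots> \<le> 4 * (Q (Suc b) - Q a)\<^sup>2"
    using zero_le_even_power'[of "s b" 2] by (simp add: Q_def power2_eq_square power4_eq_xxxx algebra_simps)
  finally show ?case .
qed simp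

section \<open>A maximal inequality\<close>

definition exceeds :: "real \<Rightarrow> nat \<Rightarrow> nat \<Rightarrow> 'a set" where
  "exceeds e a b = {\<omega>\<in>space M. \<exists>k\<in>{a..b}. \<bar>S k \<omega> - S a \<omega>\<bar> \<ge> e}"

lemma exceeds_meas: "exceeds e a b \<in> sets (F b)"
proof -
  have [measurable]: "(\<lambda>\<omega>. S k \<omega> - S a \<omega>) \<in> borel_measurable (F b)" if "k \<in> {a..b}" for k
    using that by (intro borel_measurable_diff S_meas) auto
  have "{\<omega>\<in>space (F b). \<exists>k\<in>{a..b}. \<bar>S k \<omega> - S a \<omega>\<bar> \<ge> e} \<in> sets (F b)"
    by (intro sets.sets_Collect_finite_Ex) measurable
  then show ?thesis by (simp add: exceeds_def)
qed

lemma exceeds_measM [measurable]: "exceeds e a b \<in> sets M"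
  using exceeds_meas[of e a b] F_sub[of b] by (auto simp: subalgebra_def)

text \<open>The tangent inequality \<open>(x + z)\<^sup>4 \<ge> x\<^sup>4 + 4 x\<^sup>3 z\<close> keeps the mass already collected on the exceedance
  event from decreasing, which gives Doob's inequality by induction on the right end point.\<close>

lemma maximal_inequality:
  assumes "a \<le> b" "e > 0"
  shows "e ^ 4 * prob (exceeds e a b) \<le> 4 * (Q b - Q a)\<^sup>2"
proof -
  have int: "integrable M (\<lambda>\<omega>. (S b \<omega> - S a \<omega>) ^ 4 * indicator (exceeds e a c) \<omega>)" for b c
    using integrable_mult_indicator[OF exceeds_measM integrable_power[of b a 4], of e a c]
    by (simp add: mult.commute)
  have "e ^ 4 * prob (exceeds e a b) \<le> expectation (\<lambda>\<omega>. (S b \<omega> - S a \<omega>) ^ 4 * indicator (exceeds e a b) \<omega>)"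
    using assms(1)
  proof (induction b rule: dec_induct)
    case base
    have "exceeds e a a = {}" using assms(2) by (auto simp: exceeds_def)
    then show ?case by simp
  next
    case (step b)
    define T where "T \<omega> = S b \<omega> - S a \<omega>" for \<omega>
    define E where "E = exceeds e a b"
    \<comment> \<open>The paths that exceed the level for the first time at \<open>Suc b\<close>. On
      them the fourth power is at least \<open>e ^ 4\<close> at that moment.\<close>
    define D where "D = exceeds e a (Suc b) - E"
    have ED: "exceeds e a (Suc b) = E \<union> D" "E \<inter> D = {}"
      using step(1) unfolding D_def E_def exceeds_def by auto
    have [measurable]: "E \<in> sets M" "D \<in> sets M" unfolding E_def D_def by measurable
    have D: "\<bar>S (Suc b) \<omega> - S a \<omega>\<bar> \<ge> e" if "\<omega> \<in> D" for \<omega>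
      using that unfolding D_def E_def exceeds_def by (auto simp: le_Suc_eq)
    \<comment> \<open>The coefficient of the linear term in the tangent inequality. It is determined
      by time \<open>b\<close>, so its product with the next increment has mean 0.\<close>
    define H where "H \<omega> = T \<omega> ^ 3 * indicator E \<omega>" for \<omega>
    have Hm: "H \<in> borel_measurable (F b)"
    proof -
      have [measurable]: "T \<in> borel_measurable (F b)"
        unfolding T_def using step by (intro borel_measurable_diff S_meas) auto
      have [measurable]: "E \<in> sets (F b)" unfolding E_def by (rule exceeds_meas)
      show ?thesis unfolding H_def by measurable
    qed
    have Hb: "\<bar>H \<omega>\<bar> \<le> ((\<Sum>k<b. s k) + (\<Sum>k<a. s k)) ^ 3" if "\<omega> \<in> space M" for \<omega>
      using S_diff_bound[OF that, of b a]
      by (auto simp: H_def T_def abs_mult power_abs indicator_def intro!: power_mono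
          zero_le_power add_nonneg_nonneg sum_nonneg s_nonneg)
    have iH: "integrable M (\<lambda>\<omega>. H \<omega> * \<zeta> b \<omega>)"
      using expectation_\<zeta>_power[OF Hm Hb, where p=1] by simp
    have iD: "integrable M (\<lambda>\<omega>. indicator D \<omega> :: real)" by (simp add: emeasure_eq_measure)
    have "e ^ 4 * prob (exceeds e a (Suc b)) = e ^ 4 * prob E + e ^ 4 * prob D"
      unfolding ED(1) by (subst finite_measure_Union) (auto simp: ED(2) algebra_simps)
    also have "\<dots> \<le> expectation (\<lambda>\<omega>. T \<omega> ^ 4 * indicator E \<omega>) + 4 * expectation (\<lambda>\<omega>. H \<omega> * \<zeta> b \<omega>)
        + e ^ 4 * expectation (indicator D)"
      using step(3) mean_0[OF Hm ballI, OF Hb] unfolding T_def E_def by simp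
    also have "\<dots> = expectation (\<lambda>\<omega>. T \<omega> ^ 4 * indicator E \<omega> + 4 * (H \<omega> * \<zeta> b \<omega>) + e ^ 4 * indicator D \<omega>)"
      using iH iD int[of b b] unfolding T_def E_def by simp
    also have "\<dots> \<le> expectation (\<lambda>\<omega>. (S (Suc b) \<omega> - S a \<omega>) ^ 4 * indicator (exceeds e a (Suc b)) \<omega>)"
    proof (rule integral_mono)
      fix \<omega> assume \<omega>: "\<omega> \<in> space M"
      show "T \<omega> ^ 4 * indicator E \<omega> + 4 * (H \<omega> * \<zeta> b \<omega>) + e ^ 4 * indicator D \<omega>
          \<le> (S (Suc b) \<omega> - S a \<omega>) ^ 4 * indicator (exceeds e a (Suc b)) \<omega>"
      proof (cases "\<omega> \<in> E")
        case True
        then have "\<omega> \<notin> D" "\<omega> \<in> exceeds e a (Suc b)" using ED by auto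
        define t z where "t = T \<omega>" and "z = \<zeta> b \<omega>"
        have "(t + z) ^ 4 - (t ^ 4 + 4 * (t ^ 3 * z)) = z\<^sup>2 * (2 * t\<^sup>2 + (2 * t + z)\<^sup>2)"
          by (simp add: power2_eq_square power4_eq_xxxx power3_eq_cube algebra_simps)
        moreover have "0 \<le> z\<^sup>2 * (2 * t\<^sup>2 + (2 * t + z)\<^sup>2)" by simp
        ultimately have "t ^ 4 + 4 * (t ^ 3 * z) \<le> (t + z) ^ 4" by linarith
        moreover have "S (Suc b) \<omega> - S a \<omega> = t + z" by (simp add: t_def z_def T_def S_Suc)
        ultimately show ?thesis
          using True \<open>\<omega> \<notin> D\<close> \<open>\<omega> \<in> exceeds e a (Suc b)\<close>
          by (simp add: H_def t_def[symmetric] z_def[symmetric])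
      next
        case False
        show ?thesis
        proof (cases "\<omega> \<in> D")
          case True
          then have "e ^ 4 \<le> \<bar>S (Suc b) \<omega> - S a \<omega>\<bar> ^ 4"
            using D assms(2) by (intro power_mono) auto
          then show ?thesis using True False ED by (simp add: H_def)
        qed (use False ED in \<open>simp add: H_def\<close>)
      qed
    qed (use iH iD int[of b b] int in \<open>auto simp: T_def E_def\<close>)
    finally show ?case .
  qed
  also have "\<dots> \<le> expectation (\<lambda>\<omega>. (S b \<omega> - S a \<omega>) ^ 4)"
    by (intro integral_mono int integrable_power) (auto simp: indicator_def)
  also have "\<dots> \<le> 4 * (Q b - Q a)\<^sup>2" by (rule fourth_moment[OF assms(1)])
  finally show ?thesis .
qed

section \<open>Characteristic functions of blocks of increments\<close>

lemma complex_orthogonality: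
  fixes h :: "'a \<Rightarrow> complex" and f g :: "'a \<Rightarrow> real"
  assumes h: "h \<in> borel_measurable (F k)" and hB: "\<And>\<omega>. \<omega> \<in> space M \<Longrightarrow> cmod (h \<omega>) \<le> 1"
    and fm: "f \<in> borel_measurable M" "\<And>\<omega>. \<omega> \<in> space M \<Longrightarrow> \<bar>f \<omega>\<bar> \<le> C"
    and real: "\<And>H. H \<in> borel_measurable (F k) \<Longrightarrow> \<forall>\<omega>\<in>space M. \<bar>H \<omega>\<bar> \<le> 1 \<Longrightarrow>
      expectation (\<lambda>\<omega>. H \<omega> * f \<omega>) = 0"
  shows "(CLINT \<omega>|M. h \<omega> * complex_of_real (f \<omega>)) = 0"
proof -
  note [measurable] = F_measD[OF h] fm(1)
  have hm: "(\<lambda>\<omega>. Re (h \<omega>)) \<in> borel_measurable (F k)" "(\<lambda>\<omega>. Im (h \<omega>)) \<in> borel_measurable (F k)"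
    using h by measurable
  have "C \<ge> 0" using not_empty fm(2) by (meson abs_ge_zero all_not_in_conv order_trans)
  have int: "complex_integrable M (\<lambda>\<omega>. h \<omega> * complex_of_real (f \<omega>))"
    by (rule integrable_bounded[where B="C"])
      (use hB fm(2) \<open>C \<ge> 0\<close> in \<open>auto intro!: norm_mult_le_bound\<close>)
  have "(CLINT \<omega>|M. h \<omega> * complex_of_real (f \<omega>))
      = Complex (\<integral>\<omega>. Re (h \<omega>) * f \<omega> \<partial>M) (\<integral>\<omega>. Im (h \<omega>) * f \<omega> \<partial>M)"
    using integral_Re[OF int] integral_Im[OF int] by (simp add: complex_eq_iff)
  moreover have "\<forall>\<omega>\<in>space M. \<bar>Re (h \<omega>)\<bar> \<le> 1" "\<forall>\<omega>\<in>space M. \<bar>Im (h \<omega>)\<bar> \<le> 1"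
    using hB abs_Re_le_cmod abs_Im_le_cmod order_trans by blast+
  ultimately show ?thesis using real[OF hm(1)] real[OF hm(2)] by (simp add: complex_eq_iff)
qed

text \<open>The exponential is expanded to second order. The linear term vanishes, replacing the
  conditional variance by its limit costs \<open>dev k\<close>, the remainder is cubic, and
  replacing \<open>1 - x\<close> by \<open>exp (- x)\<close> costs \<open>x^2\<close>, which is of
  fourth order in \<open>\<theta> * s k\<close>.\<close>

lemma char_step:
  assumes h: "h \<in> borel_measurable (F k)" and hB: "\<And>\<omega>. \<omega> \<in> space M \<Longrightarrow> cmod (h \<omega>) \<le> 1"
  shows "cmod ((CLINT \<omega>|M. h \<omega> * iexp (\<theta> * \<zeta> k \<omega>)) -
            complex_of_real (exp (- (\<theta>\<^sup>2 * (s k)\<^sup>2 * \<sigma>2 / 2))) * (CLINT \<omega>|M. h \<omega>))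
       \<le> \<theta>\<^sup>2 * (s k)\<^sup>2 * dev k + \<bar>\<theta>\<bar> ^ 3 * s k ^ 3 + \<theta> ^ 4 * s k ^ 4"
proof -
  note [measurable] = F_measD[OF h]
  define x where "x = \<theta>\<^sup>2 * (s k)\<^sup>2 * \<sigma>2 / 2"
  define R where "R \<omega> = iexp (\<theta> * \<zeta> k \<omega>) - (1 + \<i> * (\<theta> * \<zeta> k \<omega>) - (\<theta> * \<zeta> k \<omega>)\<^sup>2 / 2)" for \<omega>
  have [measurable]: "R \<in> borel_measurable M" unfolding R_def by measurable
  have x: "0 \<le> x" "x\<^sup>2 \<le> \<theta> ^ 4 * s k ^ 4"
  proof -
    show "0 \<le> x" using \<sigma>2 by (simp add: x_def)
    have "x \<le> \<theta>\<^sup>2 * (s k)\<^sup>2 * 1 / 1" unfolding x_def using \<sigma>2 by (intro frac_le mult_mono) auto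
    then have "x\<^sup>2 \<le> (\<theta>\<^sup>2 * (s k)\<^sup>2)\<^sup>2" using \<open>0 \<le> x\<close> by (intro power_mono) auto
    then show "x\<^sup>2 \<le> \<theta> ^ 4 * s k ^ 4" by (simp add: power_mult_distrib power_mult[symmetric])
  qed
  have Rb: "cmod (R \<omega>) \<le> \<bar>\<theta>\<bar> ^ 3 * s k ^ 3" if \<omega>: "\<omega> \<in> space M" for \<omega>
  proof -
    have "cmod (R \<omega>) \<le> \<bar>\<theta> * \<zeta> k \<omega>\<bar> ^ 3 / 6"
      using iexp_approx1[of "\<theta> * \<zeta> k \<omega>" 2] unfolding R_def
      by (simp add: eval_nat_numeral power_mult_distrib algebra_simps)
    also have "\<dots> \<le> \<bar>\<theta> * \<zeta> k \<omega>\<bar> ^ 3" by simp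
    also have "\<dots> \<le> (\<bar>\<theta>\<bar> * s k) ^ 3"
      using \<zeta>_bound[OF \<omega>, of k] by (intro power_mono) (auto simp: abs_mult intro!: mult_left_mono)
    finally show ?thesis by (simp add: power_mult_distrib)
  qed
  have ih: "complex_integrable M h" by (rule integrable_bounded[OF _ hB]) measurable
  have i\<zeta>: "complex_integrable M (\<lambda>\<omega>. h \<omega> * complex_of_real (\<zeta> k \<omega>))"
    by (rule integrable_bounded[where B="s k"])
      (use hB \<zeta>_bound s_nonneg in \<open>auto intro!: norm_mult_le_bound\<close>)
  have \<kappa>b: "\<bar>\<kappa> k \<omega> - \<sigma>2\<bar> \<le> 2" if "\<omega> \<in> space M" for \<omega>
    using \<kappa>_bound[OF that, of k] \<sigma>2 by linarith
  have i\<kappa>: "complex_integrable M (\<lambda>\<omega>. h \<omega> * complex_of_real (\<kappa> k \<omega> - \<sigma>2))"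
    by (rule integrable_bounded[where B="2"])
      (use hB \<kappa>b in \<open>auto intro!: norm_mult_le_bound simp del: of_real_diff\<close>)
  have zb: "\<bar>(\<zeta> k \<omega>)\<^sup>2 - (s k)\<^sup>2 * \<kappa> k \<omega>\<bar> \<le> 2 * (s k)\<^sup>2" if \<omega>: "\<omega> \<in> space M" for \<omega>
  proof -
    have "(\<zeta> k \<omega>)\<^sup>2 \<le> (s k)\<^sup>2"
      using \<zeta>_bound[OF \<omega>, of k] s_nonneg[of k] by (intro abs_le_square_iff[THEN iffD1]) auto
    moreover have "\<bar>(s k)\<^sup>2 * \<kappa> k \<omega>\<bar> \<le> (s k)\<^sup>2 * 1"
      unfolding abs_mult using \<kappa>_bound[OF \<omega>, of k] by (intro mult_mono) auto
    moreover have "0 \<le> (\<zeta> k \<omega>)\<^sup>2" by simp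
    ultimately show ?thesis unfolding abs_le_iff by linarith
  qed
  have iz: "complex_integrable M (\<lambda>\<omega>. h \<omega> * complex_of_real ((\<zeta> k \<omega>)\<^sup>2 - (s k)\<^sup>2 * \<kappa> k \<omega>))"
    by (rule integrable_bounded[where B="(2 * (s k)\<^sup>2)"])
      (use hB zb in \<open>auto intro!: norm_mult_le_bound simp del: of_real_diff\<close>)
  have iR: "complex_integrable M (\<lambda>\<omega>. h \<omega> * R \<omega>)"
    by (rule integrable_bounded[where B="(\<bar>\<theta>\<bar> ^ 3 * s k ^ 3)"])
      (use hB Rb in \<open>auto intro!: norm_mult_le_bound\<close>)
  have 1: "(CLINT \<omega>|M. h \<omega> * complex_of_real (\<zeta> k \<omega>)) = 0"
    by (rule complex_orthogonality[OF h hB \<zeta>_measM \<zeta>_bound]) (auto intro: mean_0)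
  have 2: "(CLINT \<omega>|M. h \<omega> * complex_of_real ((\<zeta> k \<omega>)\<^sup>2 - (s k)\<^sup>2 * \<kappa> k \<omega>)) = 0"
  proof (rule complex_orthogonality[OF h hB _ zb])
    fix H :: "'a \<Rightarrow> real" assume H: "H \<in> borel_measurable (F k)" "\<forall>\<omega>\<in>space M. \<bar>H \<omega>\<bar> \<le> 1"
    note [measurable] = F_measD[OF H(1)]
    have i1: "integrable M (\<lambda>\<omega>. H \<omega> * (\<zeta> k \<omega>)\<^sup>2)" using expectation_\<zeta>_power[OF H(1)] H(2) by blast
    have i2: "integrable M (\<lambda>\<omega>. H \<omega> * \<kappa> k \<omega>)"
      by (rule integrable_bounded[where B="1"])
      (use H \<kappa>_bound in \<open>auto simp del: real_norm_def simp: real_norm_def[symmetric] intro!: norm_mult_le_bound\<close>)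
    have "expectation (\<lambda>\<omega>. H \<omega> * ((\<zeta> k \<omega>)\<^sup>2 - (s k)\<^sup>2 * \<kappa> k \<omega>))
        = expectation (\<lambda>\<omega>. H \<omega> * (\<zeta> k \<omega>)\<^sup>2 - (s k)\<^sup>2 * (H \<omega> * \<kappa> k \<omega>))"
      by (intro Bochner_Integration.integral_cong) (auto simp: algebra_simps)
    also have "\<dots> = 0" using i1 i2 variance[OF H] by simp
    finally show "expectation (\<lambda>\<omega>. H \<omega> * ((\<zeta> k \<omega>)\<^sup>2 - (s k)\<^sup>2 * \<kappa> k \<omega>)) = 0" .
  qed measurable
  \<comment> \<open>An exact identity whose five terms are the main term, two terms of integral zero
    (the increment, and its square minus its conditional variance), the variance error and the
    Taylor remainder.\<close>
  have eq: "h \<omega> * iexp (\<theta> * \<zeta> k \<omega>) = (1 - x) * h \<omega> + \<i> * \<theta> * (h \<omega> * complex_of_real (\<zeta> k \<omega>))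
      - \<theta>\<^sup>2 / 2 * (h \<omega> * complex_of_real ((\<zeta> k \<omega>)\<^sup>2 - (s k)\<^sup>2 * \<kappa> k \<omega>))
      - \<theta>\<^sup>2 * (s k)\<^sup>2 / 2 * (h \<omega> * complex_of_real (\<kappa> k \<omega> - \<sigma>2)) + h \<omega> * R \<omega>" for \<omega>
    by (simp add: R_def x_def power_mult_distrib algebra_simps diff_divide_distrib)
  have "(CLINT \<omega>|M. h \<omega> * iexp (\<theta> * \<zeta> k \<omega>)) =
      (1 - x) * (CLINT \<omega>|M. h \<omega>) - \<theta>\<^sup>2 * (s k)\<^sup>2 / 2 * (CLINT \<omega>|M. h \<omega> * complex_of_real (\<kappa> k \<omega> - \<sigma>2))
      + (CLINT \<omega>|M. h \<omega> * R \<omega>)"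
    unfolding eq using ih i\<zeta> iz i\<kappa> iR 1 2 by simp
  then have "(CLINT \<omega>|M. h \<omega> * iexp (\<theta> * \<zeta> k \<omega>)) - complex_of_real (exp (- x)) * (CLINT \<omega>|M. h \<omega>) =
      - (\<theta>\<^sup>2 * (s k)\<^sup>2 / 2 * (CLINT \<omega>|M. h \<omega> * complex_of_real (\<kappa> k \<omega> - \<sigma>2)))
      + (CLINT \<omega>|M. h \<omega> * R \<omega>) - complex_of_real (exp (- x) - (1 - x)) * (CLINT \<omega>|M. h \<omega>)"
    by (simp add: algebra_simps)
  also have "cmod \<dots> \<le> cmod (\<theta>\<^sup>2 * (s k)\<^sup>2 / 2 * (CLINT \<omega>|M. h \<omega> * complex_of_real (\<kappa> k \<omega> - \<sigma>2)))
      + cmod (CLINT \<omega>|M. h \<omega> * R \<omega>) + cmod (complex_of_real (exp (- x) - (1 - x)) * (CLINT \<omega>|M. h \<omega>))"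
    by (rule order_trans[OF norm_triangle_ineq4 add_right_mono[OF order_trans[OF norm_triangle_ineq]]]) simp
  also have "\<dots> \<le> \<theta>\<^sup>2 * (s k)\<^sup>2 * dev k + \<bar>\<theta>\<bar> ^ 3 * s k ^ 3 + \<theta> ^ 4 * s k ^ 4"
  proof (intro add_mono)
    have "cmod (CLINT \<omega>|M. h \<omega> * complex_of_real (\<kappa> k \<omega> - \<sigma>2)) \<le> dev k"
      unfolding dev_def
    proof (rule norm_integral_le[OF i\<kappa>])
      show "integrable M (\<lambda>\<omega>. \<bar>\<kappa> k \<omega> - \<sigma>2\<bar>)" by (rule integrable_bounded[where B=2]) (use \<kappa>b in auto)
      fix \<omega> assume "\<omega> \<in> space M"
      then show "cmod (h \<omega> * complex_of_real (\<kappa> k \<omega> - \<sigma>2)) \<le> \<bar>\<kappa> k \<omega> - \<sigma>2\<bar>"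
        using hB[of \<omega>] unfolding norm_mult norm_of_real by (intro mult_left_le_one_le) auto
    qed
    moreover have "cmod (complex_of_real (\<theta>\<^sup>2 * (s k)\<^sup>2 / 2)) \<le> \<theta>\<^sup>2 * (s k)\<^sup>2"
      unfolding norm_of_real by (simp add: abs_mult)
    ultimately show "cmod (\<theta>\<^sup>2 * (s k)\<^sup>2 / 2 * (CLINT \<omega>|M. h \<omega> * complex_of_real (\<kappa> k \<omega> - \<sigma>2)))
        \<le> \<theta>\<^sup>2 * (s k)\<^sup>2 * dev k"
      unfolding norm_mult by (intro mult_mono) auto
    have "cmod (CLINT \<omega>|M. h \<omega> * R \<omega>) \<le> (\<integral>\<omega>. \<bar>\<theta>\<bar> ^ 3 * s k ^ 3 \<partial>M)"
    proof (rule norm_integral_le[OF iR])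
      fix \<omega> assume \<omega>: "\<omega> \<in> space M"
      have "cmod (h \<omega> * R \<omega>) \<le> 1 * (\<bar>\<theta>\<bar> ^ 3 * s k ^ 3)"
        unfolding norm_mult using hB[OF \<omega>] Rb[OF \<omega>] by (intro mult_mono) auto
      then show "cmod (h \<omega> * R \<omega>) \<le> \<bar>\<theta>\<bar> ^ 3 * s k ^ 3" by simp
    qed simp
    then show "cmod (CLINT \<omega>|M. h \<omega> * R \<omega>) \<le> \<bar>\<theta>\<bar> ^ 3 * s k ^ 3" by (simp add: prob_space)
    have "cmod (CLINT \<omega>|M. h \<omega>) \<le> (\<integral>\<omega>. 1 \<partial>M)"
      by (rule norm_integral_le[OF ih]) (use hB in auto)
    then have "cmod (complex_of_real (exp (- x) - (1 - x)) * (CLINT \<omega>|M. h \<omega>)) \<le> x\<^sup>2 * 1"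
      unfolding norm_mult norm_of_real using exp_minus_taylor[OF x(1)]
      by (intro mult_mono) (auto simp: prob_space)
    then show "cmod (complex_of_real (exp (- x) - (1 - x)) * (CLINT \<omega>|M. h \<omega>)) \<le> \<theta> ^ 4 * s k ^ 4"
      using x(2) by simp
  qed
  finally show ?thesis unfolding x_def .
qed

text \<open>One increment is removed at a time; everything earlier, including the weight
  \<open>H\<close>, becomes the weight \<open>h\<close> of the next step. The Gaussian factors have
  modulus at most 1, so the errors of the steps simply add up.\<close>

lemma char_block:
  assumes H: "H \<in> borel_measurable (F a)" and HB: "\<And>\<omega>. \<omega> \<in> space M \<Longrightarrow> \<bar>H \<omega>\<bar> \<le> 1"
    and "a \<le> b"
  shows "cmod ((CLINT \<omega>|M. complex_of_real (H \<omega>) * iexp (\<theta> * (S b \<omega> - S a \<omega>))) -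
            complex_of_real (exp (- (\<theta>\<^sup>2 * \<sigma>2 * (Q b - Q a) / 2))) * complex_of_real (expectation H))
       \<le> (\<Sum>k=a..<b. \<theta>\<^sup>2 * (s k)\<^sup>2 * dev k + \<bar>\<theta>\<bar> ^ 3 * s k ^ 3 + \<theta> ^ 4 * s k ^ 4)"
  using assms(3)
proof (induction b rule: dec_induct)
  case base
  then show ?case by simp
next
  case (step b)
  define h where "h \<omega> = complex_of_real (H \<omega>) * iexp (\<theta> * (S b \<omega> - S a \<omega>))" for \<omega>
  define E where "E = complex_of_real (exp (- (\<theta>\<^sup>2 * (s b)\<^sup>2 * \<sigma>2 / 2)))"
  define A where "A = complex_of_real (exp (- (\<theta>\<^sup>2 * \<sigma>2 * (Q b - Q a) / 2))) * complex_of_real (expectation H)"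
  have hm: "h \<in> borel_measurable (F b)"
  proof -
    note [measurable] = F_meas_mono[OF step(1) H] S_meas[OF step(1)] S_meas[OF order_refl, of b]
    show ?thesis unfolding h_def by measurable
  qed
  have hb: "cmod (h \<omega>) \<le> 1" if "\<omega> \<in> space M" for \<omega>
    using HB[OF that] by (simp add: h_def norm_mult)
  have 1: "(CLINT \<omega>|M. complex_of_real (H \<omega>) * iexp (\<theta> * (S (Suc b) \<omega> - S a \<omega>)))
      = (CLINT \<omega>|M. h \<omega> * iexp (\<theta> * \<zeta> b \<omega>))"
    by (intro Bochner_Integration.integral_cong)
      (auto simp: h_def S_Suc algebra_simps exp_add[symmetric])
  have 2: "complex_of_real (exp (- (\<theta>\<^sup>2 * \<sigma>2 * (Q (Suc b) - Q a) / 2))) * complex_of_real (expectation H) = E * A"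
    unfolding E_def A_def by (simp add: Q_def exp_add[symmetric] of_real_mult[symmetric] del: of_real_mult)
      (simp add: algebra_simps add_divide_distrib diff_divide_distrib)
  have "cmod ((CLINT \<omega>|M. h \<omega> * iexp (\<theta> * \<zeta> b \<omega>)) - E * A) \<le>
      cmod ((CLINT \<omega>|M. h \<omega> * iexp (\<theta> * \<zeta> b \<omega>)) - E * (CLINT \<omega>|M. h \<omega>)) + cmod (E * ((CLINT \<omega>|M. h \<omega>) - A))"
    by (rule order_trans[OF _ norm_triangle_ineq]) (simp add: algebra_simps)
  also have "\<dots> \<le> (\<theta>\<^sup>2 * (s b)\<^sup>2 * dev b + \<bar>\<theta>\<bar> ^ 3 * s b ^ 3 + \<theta> ^ 4 * s b ^ 4) + cmod ((CLINT \<omega>|M. h \<omega>) - A)"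
  proof (rule add_mono)
    show "cmod ((CLINT \<omega>|M. h \<omega> * iexp (\<theta> * \<zeta> b \<omega>)) - E * (CLINT \<omega>|M. h \<omega>))
        \<le> \<theta>\<^sup>2 * (s b)\<^sup>2 * dev b + \<bar>\<theta>\<bar> ^ 3 * s b ^ 3 + \<theta> ^ 4 * s b ^ 4"
      unfolding E_def by (rule char_step[OF hm hb])
    have "cmod E \<le> 1" unfolding E_def norm_of_real using \<sigma>2 by simp
    then show "cmod (E * ((CLINT \<omega>|M. h \<omega>) - A)) \<le> cmod ((CLINT \<omega>|M. h \<omega>) - A)"
      unfolding norm_mult by (intro mult_left_le_one_le) auto
  qed
  also have "cmod ((CLINT \<omega>|M. h \<omega>) - A)
      \<le> (\<Sum>k=a..<b. \<theta>\<^sup>2 * (s k)\<^sup>2 * dev k + \<bar>\<theta>\<bar> ^ 3 * s k ^ 3 + \<theta> ^ 4 * s k ^ 4)"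
    using step.IH unfolding h_def A_def .
  finally show ?case unfolding 1 2 using step(1) by simp
qed

end

section \<open>Gaussian smoothing\<close>

text \<open>Lebesgue measure on a bounded interval. As it is finite, boundedness suffices for Fubini
  and for dominated convergence.\<close>

definition lborel_on :: "real \<Rightarrow> real measure" where
  "lborel_on A = density lborel (indicator {-A..A})"

lemma sets_lborel_on [measurable_cong, simp]: "sets (lborel_on A) = sets borel"
  by (simp add: lborel_on_def)

lemma space_lborel_on [simp]: "space (lborel_on A) = UNIV"
  by (simp add: lborel_on_def)

lemma finite_measure_lborel_on: "finite_measure (lborel_on A)"
  by (rule finite_measureI) (cases "-A \<le> A", auto simp: lborel_on_def emeasure_density)

lemma integral_lborel_on:
  fixes f :: "real \<Rightarrow> real"
  assumes [measurable]: "f \<in> borel_measurable borel" and "\<And>w. \<bar>w\<bar> > A \<Longrightarrow> f w = 0"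
  shows "(\<integral>w. f w \<partial>lborel_on A) = (\<integral>w. f w \<partial>lborel)"
proof -
  have "(\<integral>w. f w \<partial>lborel_on A) = (\<integral>w. indicator {-A..A} w *\<^sub>R f w \<partial>lborel)"
    unfolding lborel_on_def by (subst integral_density[symmetric]) (auto simp: ennreal_indicator)
  also have "\<dots> = (\<integral>w. f w \<partial>lborel)"
    proof (intro Bochner_Integration.integral_cong refl)
    fix w show "indicator {-A..A} w *\<^sub>R f w = f w"
      using assms(2)[of w] by (cases "\<bar>w\<bar> > A") (auto simp: indicator_def)
  qed
  finally show ?thesis .
qed

text \<open>The Gaussian is its own Fourier transform, here read as the characteristic function of
  the standard normal law at \<open>(w - \<mu>) / \<eta>\<close>.\<close>

lemma normal_density_fourier:
  assumes "\<eta> > 0"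
  shows "complex_of_real (normal_density \<mu> \<eta> w) = complex_of_real (1 / (sqrt (2 * pi) * \<eta>)) *
    (CLINT \<theta>|std_normal_distribution. iexp ((w - \<mu>) / \<eta> * \<theta>))"
proof -
  have "(CLINT \<theta>|std_normal_distribution. iexp ((w - \<mu>) / \<eta> * \<theta>)) = complex_of_real (exp (- (((w - \<mu>) / \<eta>)\<^sup>2) / 2))"
    using fun_cong[OF char_std_normal_distribution, of "(w - \<mu>) / \<eta>"] by (simp add: char_def)
  moreover have "normal_density \<mu> \<eta> w = 1 / (sqrt (2 * pi) * \<eta>) * exp (- (((w - \<mu>) / \<eta>)\<^sup>2) / 2)"
    using assms by (simp add: normal_density_def real_sqrt_mult power_divide)
  ultimately show ?thesis by simp
qed

text \<open>After insertion of the Fourier representation, Fubini is applied first to \<omega> and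
  \<open>w\<close>, then to \<omega> and \<theta>. This moves the expectation innermost, so
  \<open>X\<close> survives only inside weighted characteristic functions.\<close>

lemma (in prob_space) fourier_smoothing:
  fixes g :: "'a \<Rightarrow> real \<Rightarrow> real" and X :: "'a \<Rightarrow> real"
  assumes gm: "(\<lambda>(\<omega>, w). g \<omega> w) \<in> borel_measurable (M \<Otimes>\<^sub>M borel)"
    and gB: "\<And>\<omega> w. \<omega> \<in> space M \<Longrightarrow> \<bar>g \<omega> w\<bar> \<le> B"
    and gA: "\<And>\<omega> w. \<omega> \<in> space M \<Longrightarrow> \<bar>w\<bar> > A \<Longrightarrow> g \<omega> w = 0"
    and [measurable]: "X \<in> borel_measurable M" and \<eta>: "\<eta> > 0"
  shows "complex_of_real (\<integral>\<omega>. (\<integral>w. g \<omega> w * normal_density (X \<omega>) \<eta> w \<partial>lborel) \<partial>M) =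
    complex_of_real (1 / (sqrt (2 * pi) * \<eta>)) * (CLINT w|lborel_on A. CLINT \<theta>|std_normal_distribution.
       iexp (w / \<eta> * \<theta>) * (CLINT \<omega>|M. complex_of_real (g \<omega> w) * iexp (- (\<theta> / \<eta>) * X \<omega>)))"
proof -
  let ?N = "std_normal_distribution" and ?U = "lborel_on A"
  let ?c = "complex_of_real (1 / (sqrt (2 * pi) * \<eta>))"
  interpret N: real_distribution ?N by (rule real_dist_normal_dist)
  interpret U: finite_measure ?U by (rule finite_measure_lborel_on)
  interpret MU: pair_sigma_finite M ?U ..
  interpret MN: pair_sigma_finite M ?N ..
  interpret MUf: finite_measure "M \<Otimes>\<^sub>M ?U"
    by (rule finite_measure_pair_measure) unfold_locales
  interpret MNf: finite_measure "M \<Otimes>\<^sub>M ?N"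
    by (rule finite_measure_pair_measure) unfold_locales
  note gm' [measurable] = gm
  have gmw [measurable]: "(\<lambda>\<omega>. g \<omega> w) \<in> borel_measurable M" for w
  proof -
    have "(\<lambda>\<omega>. (\<omega>, w)) \<in> M \<rightarrow>\<^sub>M M \<Otimes>\<^sub>M borel" by measurable
    from measurable_compose[OF this gm] show ?thesis by simp
  qed
  have gmo [measurable]: "(\<lambda>w. g \<omega> w) \<in> borel_measurable borel" if "\<omega> \<in> space M" for \<omega>
    using measurable_compose[OF measurable_Pair1'[OF that] gm] by simp
  have nd [measurable]: "(\<lambda>(\<omega>, w). normal_density (X \<omega>) \<eta> w) \<in> borel_measurable (M \<Otimes>\<^sub>M borel)"
    unfolding normal_density_def by measurable
  have nd_le: "normal_density \<mu> \<eta> w \<le> 1 / sqrt (2 * pi * \<eta>\<^sup>2)" for \<mu> w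
  proof -
    have "1 / sqrt (2 * pi * \<eta>\<^sup>2) * exp (- (w - \<mu>)\<^sup>2 / (2 * \<eta>\<^sup>2)) \<le> 1 / sqrt (2 * pi * \<eta>\<^sup>2) * 1"
      by (intro mult_left_mono) (auto simp: divide_nonpos_nonneg)
    then show ?thesis by (simp add: normal_density_def)
  qed
  have B0: "0 \<le> B" using not_empty gB by (meson abs_ge_zero all_not_in_conv order_trans)
  have "(\<integral>\<omega>. (\<integral>w. g \<omega> w * normal_density (X \<omega>) \<eta> w \<partial>lborel) \<partial>M)
      = (\<integral>\<omega>. (\<integral>w. g \<omega> w * normal_density (X \<omega>) \<eta> w \<partial>?U) \<partial>M)"
    by (intro Bochner_Integration.integral_cong refl integral_lborel_on[symmetric]) (auto simp: gA)
  also have "\<dots> = (\<integral>w. (\<integral>\<omega>. g \<omega> w * normal_density (X \<omega>) \<eta> w \<partial>M) \<partial>?U)"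
  proof (rule MU.Fubini_integral[symmetric])
    show "integrable (M \<Otimes>\<^sub>M ?U) (\<lambda>(\<omega>, w). g \<omega> w * normal_density (X \<omega>) \<eta> w)"
    proof (rule MUf.integrable_const_bound[where B="B * (1 / sqrt (2 * pi * \<eta>\<^sup>2))"])
      show "AE x in M \<Otimes>\<^sub>M ?U. norm (case x of (\<omega>, w) \<Rightarrow> g \<omega> w * normal_density (X \<omega>) \<eta> w)
          \<le> B * (1 / sqrt (2 * pi * \<eta>\<^sup>2))"
      proof (rule AE_I2)
        fix x assume "x \<in> space (M \<Otimes>\<^sub>M ?U)"
        then obtain \<omega> w where x: "x = (\<omega>, w)" "\<omega> \<in> space M" by (auto simp: space_pair_measure)
        have "\<bar>g \<omega> w\<bar> * normal_density (X \<omega>) \<eta> w \<le> B * (1 / sqrt (2 * pi * \<eta>\<^sup>2))"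
          using x B0 by (intro mult_mono gB nd_le) auto
        then show "norm (case x of (\<omega>, w) \<Rightarrow> g \<omega> w * normal_density (X \<omega>) \<eta> w)
          \<le> B * (1 / sqrt (2 * pi * \<eta>\<^sup>2))" using x by (simp add: abs_mult)
      qed
      have "(\<lambda>x. (case x of (\<omega>, w) \<Rightarrow> g \<omega> w) * (case x of (\<omega>, w) \<Rightarrow> normal_density (X \<omega>) \<eta> w))
          \<in> borel_measurable (M \<Otimes>\<^sub>M ?U)"
        using gm nd by (intro borel_measurable_times) (simp_all cong: measurable_cong_sets)
      then show "(\<lambda>(\<omega>, w). g \<omega> w * normal_density (X \<omega>) \<eta> w) \<in> borel_measurable (M \<Otimes>\<^sub>M ?U)"
        by (simp add: case_prod_beta')
    qed
  qed
  finally have 1: "complex_of_real (\<integral>\<omega>. (\<integral>w. g \<omega> w * normal_density (X \<omega>) \<eta> w \<partial>lborel) \<partial>M)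
      = (CLINT w|?U. CLINT \<omega>|M. complex_of_real (g \<omega> w * normal_density (X \<omega>) \<eta> w))"
    by (simp only: integral_complex_of_real)
  have 2: "(CLINT \<omega>|M. complex_of_real (g \<omega> w * normal_density (X \<omega>) \<eta> w))
     = ?c * (CLINT \<theta>|?N. iexp (w / \<eta> * \<theta>) * (CLINT \<omega>|M. complex_of_real (g \<omega> w) * iexp (- (\<theta> / \<eta>) * X \<omega>)))" for w
  proof -
    have "(CLINT \<omega>|M. complex_of_real (g \<omega> w * normal_density (X \<omega>) \<eta> w)) =
       (CLINT \<omega>|M. ?c * (CLINT \<theta>|?N. complex_of_real (g \<omega> w) * iexp ((w - X \<omega>) / \<eta> * \<theta>)))"
      by (intro Bochner_Integration.integral_cong refl)
        (simp add: normal_density_fourier[OF \<eta>] del: of_real_divide)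
    also have "\<dots> = ?c * (CLINT \<omega>|M. CLINT \<theta>|?N. complex_of_real (g \<omega> w) * iexp ((w - X \<omega>) / \<eta> * \<theta>))"
      by simp
    also have "(CLINT \<omega>|M. CLINT \<theta>|?N. complex_of_real (g \<omega> w) * iexp ((w - X \<omega>) / \<eta> * \<theta>))
        = (CLINT \<theta>|?N. CLINT \<omega>|M. complex_of_real (g \<omega> w) * iexp ((w - X \<omega>) / \<eta> * \<theta>))"
    proof (rule MN.Fubini_integral[symmetric], rule MNf.integrable_const_bound[where B=B])
      show "AE x in M \<Otimes>\<^sub>M ?N. norm (case x of (\<omega>, \<theta>) \<Rightarrow> complex_of_real (g \<omega> w) * iexp ((w - X \<omega>) / \<eta> * \<theta>)) \<le> B"
        by (rule AE_I2) (auto simp: space_pair_measure norm_mult gB simp del: of_real_mult of_real_divide of_real_diff)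
    qed measurable
    also have "\<dots> = (CLINT \<theta>|?N. iexp (w / \<eta> * \<theta>) * (CLINT \<omega>|M. complex_of_real (g \<omega> w) * iexp (- (\<theta> / \<eta>) * X \<omega>)))"
    proof (intro Bochner_Integration.integral_cong refl)
      fix \<theta>
      have "iexp ((w - X \<omega>) / \<eta> * \<theta>) = iexp (w / \<eta> * \<theta>) * iexp (- (\<theta> / \<eta>) * X \<omega>)" for \<omega>
        unfolding exp_add[symmetric] by (simp add: algebra_simps diff_divide_distrib)
      then have "(CLINT \<omega>|M. complex_of_real (g \<omega> w) * iexp ((w - X \<omega>) / \<eta> * \<theta>))
          = (CLINT \<omega>|M. iexp (w / \<eta> * \<theta>) * (complex_of_real (g \<omega> w) * iexp (- (\<theta> / \<eta>) * X \<omega>)))"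
        by (simp only: mult.left_commute)
      then show "(CLINT \<omega>|M. complex_of_real (g \<omega> w) * iexp ((w - X \<omega>) / \<eta> * \<theta>))
          = iexp (w / \<eta> * \<theta>) * (CLINT \<omega>|M. complex_of_real (g \<omega> w) * iexp (- (\<theta> / \<eta>) * X \<omega>))"
        by simp
    qed
    finally show ?thesis .
  qed
  show ?thesis unfolding 1 2 by (rule integral_mult_right_zero)
qed

text \<open>The kernel displaces the argument by a centred normal variable of deviation \<eta>,
  whose mean modulus is \<open>\<eta> * sqrt (2 / pi)\<close>, at most \<eta>.\<close>

lemma normal_smoothing_error:
  fixes g :: "real \<Rightarrow> real"
  assumes [measurable]: "g \<in> borel_measurable borel" and B: "\<And>w. \<bar>g w\<bar> \<le> B"
    and L: "\<And>w z. \<bar>g w - g z\<bar> \<le> L * \<bar>w - z\<bar>" and \<eta>: "\<eta> > 0"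
  shows "\<bar>g x - (\<integral>w. g w * normal_density x \<eta> w \<partial>lborel)\<bar> \<le> L * \<eta>"
proof -
  have L0: "0 \<le> L" using L[of 1 0] by auto
  have i1: "integrable lborel (\<lambda>w. g w * normal_density x \<eta> w)"
  proof (rule Bochner_Integration.integrable_bound)
    show "integrable lborel (\<lambda>w. B * normal_density x \<eta> w)" using \<eta> by simp
    show "AE w in lborel. norm (g w * normal_density x \<eta> w) \<le> norm (B * normal_density x \<eta> w)"
    proof (rule AE_I2)
      fix w
      have "\<bar>g w\<bar> * normal_density x \<eta> w \<le> \<bar>B\<bar> * normal_density x \<eta> w"
        using B[of w] by (intro mult_right_mono) auto
      then show "norm (g w * normal_density x \<eta> w) \<le> norm (B * normal_density x \<eta> w)"
        by (simp add: abs_mult)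
    qed
  qed measurable
  have i2: "integrable lborel (\<lambda>w. normal_density x \<eta> w * \<bar>w - x\<bar>)"
    using integrable_normal_moment_abs[OF \<eta>, of x 1] by simp
  have "g x - (\<integral>w. g w * normal_density x \<eta> w \<partial>lborel)
      = (\<integral>w. g x * normal_density x \<eta> w \<partial>lborel) - (\<integral>w. g w * normal_density x \<eta> w \<partial>lborel)"
    using \<eta> by simp
  also have "\<dots> = (\<integral>w. (g x - g w) * normal_density x \<eta> w \<partial>lborel)"
    using i1 \<eta> by (subst Bochner_Integration.integral_diff[symmetric]) (auto simp: algebra_simps)
  also have "\<bar>\<dots>\<bar> \<le> (\<integral>w. L * (normal_density x \<eta> w * \<bar>w - x\<bar>) \<partial>lborel)"
  proof (rule norm_integral_le[where 'b=real, unfolded real_norm_def])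
    show "integrable lborel (\<lambda>w. (g x - g w) * normal_density x \<eta> w)"
      using i1 \<eta> by (simp add: left_diff_distrib)
    fix w
    have "\<bar>g x - g w\<bar> * normal_density x \<eta> w \<le> (L * \<bar>x - w\<bar>) * normal_density x \<eta> w"
      by (intro mult_right_mono L) auto
    then show "\<bar>(g x - g w) * normal_density x \<eta> w\<bar> \<le> L * (normal_density x \<eta> w * \<bar>w - x\<bar>)"
      by (simp add: abs_mult abs_minus_commute mult_ac)
  qed (use i2 in simp)
  also have "\<dots> = L * (\<eta> * sqrt (2 / pi))"
    using integral_normal_moment_abs_odd[OF \<eta>, of x 0] i2 by simp
  also have "\<dots> \<le> L * (\<eta> * 1)"
  proof (intro mult_left_mono L0)
    show "sqrt (2 / pi) \<le> 1" using pi_ge_two by (simp add: real_sqrt_le_1_iff)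
  qed (use \<eta> in auto)
  finally show ?thesis by simp
qed

lemma joint_measurable_section:
  assumes "(\<lambda>(\<omega>, w). g \<omega> w) \<in> borel_measurable (M \<Otimes>\<^sub>M borel)"
  shows "(\<lambda>\<omega>. g \<omega> w) \<in> borel_measurable M"
proof -
  have "(\<lambda>\<omega>. (\<omega>, w)) \<in> M \<rightarrow>\<^sub>M M \<Otimes>\<^sub>M borel" by measurable
  from measurable_compose[OF this assms] show ?thesis by simp
qed

lemma (in prob_space) smoothing_error:
  fixes g :: "'a \<Rightarrow> real \<Rightarrow> real"
  assumes gm: "(\<lambda>(\<omega>, w). g \<omega> w) \<in> borel_measurable (M \<Otimes>\<^sub>M borel)"
    and gB: "\<And>\<omega> w. \<omega> \<in> space M \<Longrightarrow> \<bar>g \<omega> w\<bar> \<le> B"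
    and gL: "\<And>\<omega> w z. \<omega> \<in> space M \<Longrightarrow> \<bar>g \<omega> w - g \<omega> z\<bar> \<le> L * \<bar>w - z\<bar>"
    and [measurable]: "X \<in> borel_measurable M" and \<eta>: "\<eta> > 0"
  shows "\<bar>(\<integral>\<omega>. g \<omega> (X \<omega>) \<partial>M) - (\<integral>\<omega>. (\<integral>w. g \<omega> w * normal_density (X \<omega>) \<eta> w \<partial>lborel) \<partial>M)\<bar> \<le> L * \<eta>"
proof -
  have gmo: "(\<lambda>w. g \<omega> w) \<in> borel_measurable borel" if "\<omega> \<in> space M" for \<omega>
    using measurable_compose[OF measurable_Pair1'[OF that] gm] by simp
  have e: "\<bar>g \<omega> (X \<omega>) - (\<integral>w. g \<omega> w * normal_density (X \<omega>) \<eta> w \<partial>lborel)\<bar> \<le> L * \<eta>"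
    if "\<omega> \<in> space M" for \<omega>
    by (rule normal_smoothing_error[OF gmo[OF that] gB[OF that] gL[OF that] \<eta>])
  have "(\<lambda>\<omega>. (\<omega>, X \<omega>)) \<in> M \<rightarrow>\<^sub>M M \<Otimes>\<^sub>M borel" by measurable
  from measurable_compose[OF this gm]
  have m1 [measurable]: "(\<lambda>\<omega>. g \<omega> (X \<omega>)) \<in> borel_measurable M" by simp
  have "(\<lambda>x. (case x of (\<omega>, w) \<Rightarrow> g \<omega> w) * (case x of (\<omega>, w) \<Rightarrow> normal_density (X \<omega>) \<eta> w))
        \<in> borel_measurable (M \<Otimes>\<^sub>M lborel)"
  proof (rule borel_measurable_times)
    show "(\<lambda>x. case x of (\<omega>, w) \<Rightarrow> g \<omega> w) \<in> borel_measurable (M \<Otimes>\<^sub>M lborel)"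
      using gm by (simp cong: measurable_cong_sets)
    show "(\<lambda>x. case x of (\<omega>, w) \<Rightarrow> normal_density (X \<omega>) \<eta> w) \<in> borel_measurable (M \<Otimes>\<^sub>M lborel)"
      unfolding normal_density_def by measurable
  qed
  then have "(\<lambda>(\<omega>, w). g \<omega> w * normal_density (X \<omega>) \<eta> w) \<in> borel_measurable (M \<Otimes>\<^sub>M lborel)"
    by (simp add: case_prod_beta')
  then have m2 [measurable]: "(\<lambda>\<omega>. \<integral>w. g \<omega> w * normal_density (X \<omega>) \<eta> w \<partial>lborel) \<in> borel_measurable M"
    by (rule lborel.borel_measurable_lebesgue_integral)
  have i1: "integrable M (\<lambda>\<omega>. g \<omega> (X \<omega>))"
    by (rule integrable_const_bound[where B=B]) (auto simp: gB intro!: AE_I2)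
  have i2: "integrable M (\<lambda>\<omega>. \<integral>w. g \<omega> w * normal_density (X \<omega>) \<eta> w \<partial>lborel)"
  proof (rule integrable_const_bound[where B="B + L * \<eta>"])
    show "AE \<omega> in M. norm (\<integral>w. g \<omega> w * normal_density (X \<omega>) \<eta> w \<partial>lborel) \<le> B + L * \<eta>"
    proof (rule AE_I2)
      fix \<omega> assume \<omega>: "\<omega> \<in> space M"
      show "norm (\<integral>w. g \<omega> w * normal_density (X \<omega>) \<eta> w \<partial>lborel) \<le> B + L * \<eta>"
        using e[OF \<omega>] gB[OF \<omega>, of "X \<omega>"] unfolding real_norm_def by linarith
    qed
  qed measurable
  have "\<bar>(\<integral>\<omega>. g \<omega> (X \<omega>) \<partial>M) - (\<integral>\<omega>. (\<integral>w. g \<omega> w * normal_density (X \<omega>) \<eta> w \<partial>lborel) \<partial>M)\<bar>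
      = norm (\<integral>\<omega>. g \<omega> (X \<omega>) - (\<integral>w. g \<omega> w * normal_density (X \<omega>) \<eta> w \<partial>lborel) \<partial>M)"
    using i1 i2 by simp
  also have "\<dots> \<le> (\<integral>\<omega>. L * \<eta> \<partial>M)"
    by (rule norm_integral_le) (use i1 i2 e in auto)
  finally show ?thesis by (simp add: prob_space)
qed

lemma (in prob_space) weighted_char_measurable:
  fixes g :: "'a \<Rightarrow> real \<Rightarrow> real"
  assumes gm: "(\<lambda>(\<omega>, w). g \<omega> w) \<in> borel_measurable (M \<Otimes>\<^sub>M borel)"
    and [measurable]: "X \<in> borel_measurable M"
  shows "(\<lambda>(w, \<theta>). CLINT \<omega>|M. complex_of_real (g \<omega> w) * iexp (- (\<theta> / \<eta>) * X \<omega>)) \<in> borel_measurable (borel \<Otimes>\<^sub>M borel)"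
proof -
  have "(\<lambda>x. (snd x, fst (fst x))) \<in> (borel \<Otimes>\<^sub>M (borel :: real measure)) \<Otimes>\<^sub>M M \<rightarrow>\<^sub>M M \<Otimes>\<^sub>M (borel :: real measure)"
    by measurable
  from measurable_compose[OF this gm]
  have [measurable]: "(\<lambda>x. g (snd x) (fst (fst x))) \<in> borel_measurable ((borel \<Otimes>\<^sub>M (borel :: real measure)) \<Otimes>\<^sub>M M)"
    by simp
  have "(\<lambda>x. complex_of_real (g (snd x) (fst (fst x))) * iexp (- (snd (fst x) / \<eta>) * X (snd x)))
      \<in> borel_measurable ((borel \<Otimes>\<^sub>M (borel :: real measure)) \<Otimes>\<^sub>M M)"
    by measurable
  then have "(\<lambda>(x, \<omega>). complex_of_real (g \<omega> (fst x)) * iexp (- (snd x / \<eta>) * X \<omega>))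
      \<in> borel_measurable ((borel \<Otimes>\<^sub>M (borel :: real measure)) \<Otimes>\<^sub>M M)"
    by (simp add: case_prod_beta')
  from borel_measurable_lebesgue_integral[OF this] show ?thesis by (simp add: case_prod_beta')
qed

lemma (in prob_space) weighted_char_bound:
  fixes g :: "'a \<Rightarrow> real"
  assumes [measurable]: "g \<in> borel_measurable M" "X \<in> borel_measurable M"
    and gB: "\<And>\<omega>. \<omega> \<in> space M \<Longrightarrow> \<bar>g \<omega>\<bar> \<le> B"
  shows "cmod (CLINT \<omega>|M. complex_of_real (g \<omega>) * iexp (\<theta> * X \<omega>)) \<le> B"
proof -
  have "cmod (CLINT \<omega>|M. complex_of_real (g \<omega>) * iexp (\<theta> * X \<omega>)) \<le> (\<integral>\<omega>. B \<partial>M)"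
  proof (rule norm_integral_le)
    show *: "cmod (complex_of_real (g \<omega>) * iexp (\<theta> * X \<omega>)) \<le> B" if "\<omega> \<in> space M" for \<omega>
      using gB[OF that] by (simp add: norm_mult del: of_real_mult)
    show "complex_integrable M (\<lambda>\<omega>. complex_of_real (g \<omega>) * iexp (\<theta> * X \<omega>))"
      by (rule integrable_const_bound[where B=B]) (auto intro!: AE_I2 * simp del: of_real_mult)
  qed simp
  then show ?thesis by (simp add: prob_space)
qed

text \<open>Convergence of the \<open>g\<close>-weighted characteristic functions suffices: smoothing \<open>g\<close> with a narrow
  Gaussian kernel costs little by the Lipschitz property, and the Gaussian kernel is an average of exponentials.\<close>

lemma (in prob_space) weighted_char_imp_expectation_compact:
  fixes g :: "nat \<Rightarrow> 'a \<Rightarrow> real \<Rightarrow> real"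
  assumes gm: "\<And>n. (\<lambda>(\<omega>, w). g n \<omega> w) \<in> borel_measurable (M \<Otimes>\<^sub>M borel)"
    and XYm: "\<And>n. X n \<in> borel_measurable M" "\<And>n. Y n \<in> borel_measurable M"
    and gB: "\<And>n \<omega> w. \<omega> \<in> space M \<Longrightarrow> \<bar>g n \<omega> w\<bar> \<le> B"
    and gA: "\<And>n \<omega> w. \<omega> \<in> space M \<Longrightarrow> \<bar>w\<bar> > A \<Longrightarrow> g n \<omega> w = 0"
    and gL: "\<And>n \<omega> w z. \<omega> \<in> space M \<Longrightarrow> \<bar>g n \<omega> w - g n \<omega> z\<bar> \<le> L * \<bar>w - z\<bar>"
    and char: "\<And>w \<theta>. (\<lambda>n. (CLINT \<omega>|M. complex_of_real (g n \<omega> w) * iexp (\<theta> * X n \<omega>))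
        - (CLINT \<omega>|M. complex_of_real (g n \<omega> w) * iexp (\<theta> * Y n \<omega>))) \<longlonglongrightarrow> 0"
  shows "(\<lambda>n. expectation (\<lambda>\<omega>. g n \<omega> (X n \<omega>)) - expectation (\<lambda>\<omega>. g n \<omega> (Y n \<omega>))) \<longlonglongrightarrow> 0"
proof (rule LIMSEQ_I)
  have XM: "\<forall>n. X n \<in> borel_measurable M" and YM: "\<forall>n. Y n \<in> borel_measurable M" using XYm by auto
  let ?N = "std_normal_distribution" and ?U = "lborel_on A"
  interpret N: real_distribution ?N by (rule real_dist_normal_dist)
  interpret U: finite_measure ?U by (rule finite_measure_lborel_on)
  have L0: "0 \<le> L"
  proof -
    obtain \<omega> where "\<omega> \<in> space M" using not_empty by blast
    from gL[OF this, of 0 1 0] show ?thesis by simp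
  qed
  fix e :: real assume e: "e > 0"
  \<comment> \<open>Each of the two smoothing errors is then at most \<open>e / 4\<close>, leaving
    \<open>e / 2\<close> for the smoothed expectations. The summand 1 covers
    \<open>L = 0\<close>.\<close>
  define \<eta> where "\<eta> = e / (4 * (L + 1))"
  have \<eta>: "\<eta> > 0" "L * \<eta> \<le> e / 4" using e L0 by (auto simp: \<eta>_def field_simps)
  let ?c = "complex_of_real (1 / (sqrt (2 * pi) * \<eta>))"
  define \<Gamma> where "\<Gamma> V n w \<theta> = (CLINT \<omega>|M. complex_of_real (g n \<omega> w) * iexp (- (\<theta> / \<eta>) * V n \<omega>))"
    for V :: "nat \<Rightarrow> 'a \<Rightarrow> real" and n w \<theta>
  define J where "J V n = expectation (\<lambda>\<omega>. \<integral>w. g n \<omega> w * normal_density (V n \<omega>) \<eta> w \<partial>lborel)"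
    for V :: "nat \<Rightarrow> 'a \<Rightarrow> real" and n
  define K where "K V n w = (CLINT \<theta>|?N. iexp (w / \<eta> * \<theta>) * \<Gamma> V n w \<theta>)"
    for V :: "nat \<Rightarrow> 'a \<Rightarrow> real" and n w
  have \<Gamma>b: "cmod (\<Gamma> V n w \<theta>) \<le> B" if "\<forall>n. V n \<in> borel_measurable M" for V n w \<theta>
    unfolding \<Gamma>_def by (rule weighted_char_bound[OF joint_measurable_section[OF gm] that[THEN spec] gB])
  have \<Gamma>m: "(\<lambda>(w, \<theta>). \<Gamma> V n w \<theta>) \<in> borel_measurable (borel \<Otimes>\<^sub>M borel)"
    if "\<forall>n. V n \<in> borel_measurable M" for V n
    unfolding \<Gamma>_def by (rule weighted_char_measurable[OF gm that[THEN spec]])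
  have sec: "\<Gamma> V n w \<in> borel_measurable borel" if "\<forall>n. V n \<in> borel_measurable M" for V n w
    using measurable_compose[OF measurable_Pair1'[of w borel borel] \<Gamma>m[OF that, of n]] by simp
  have bd: "cmod (iexp (w / \<eta> * \<theta>) * \<Gamma> V n w \<theta>) \<le> B" if "\<forall>n. V n \<in> borel_measurable M" for V n w \<theta>
    using \<Gamma>b[OF that, of n w \<theta>] by (simp add: norm_mult del: of_real_mult of_real_divide)
  have i\<Gamma>: "complex_integrable ?N (\<lambda>\<theta>. iexp (w / \<eta> * \<theta>) * \<Gamma> V n w \<theta>)"
    if "\<forall>n. V n \<in> borel_measurable M" for V n w
    by (rule N.integrable_const_bound[where B=B])
      (use bd[OF that] sec[OF that] in \<open>auto intro!: AE_I2 simp del: of_real_mult of_real_divide\<close>)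
  have Km: "K V n \<in> borel_measurable borel" if "\<forall>n. V n \<in> borel_measurable M" for V n
  proof -
    have "(\<lambda>x. iexp (fst x / \<eta> * snd x) * \<Gamma> V n (fst x) (snd x)) \<in> borel_measurable (borel \<Otimes>\<^sub>M borel)"
      using \<Gamma>m[OF that, of n] by (intro borel_measurable_times) (simp_all add: case_prod_beta')
    then have "(\<lambda>(w, \<theta>). iexp (w / \<eta> * \<theta>) * \<Gamma> V n w \<theta>) \<in> borel_measurable (borel \<Otimes>\<^sub>M ?N)"
      by (simp add: case_prod_beta' cong: measurable_cong_sets)
    then show ?thesis unfolding K_def by (rule N.borel_measurable_lebesgue_integral)
  qed
  have Kb: "cmod (K V n w) \<le> B" if "\<forall>n. V n \<in> borel_measurable M" for V n w
  proof -
    have "cmod (K V n w) \<le> (\<integral>\<theta>. B \<partial>?N)" unfolding K_def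
      by (rule norm_integral_le[OF i\<Gamma>[OF that] _ bd[OF that]]) simp
    then show ?thesis using N.prob_space by simp
  qed
  have iK: "complex_integrable ?U (K V n)" if "\<forall>n. V n \<in> borel_measurable M" for V n
    by (rule U.integrable_const_bound[where B=B]) (use Kb[OF that] Km[OF that] in \<open>auto intro!: AE_I2\<close>)
  \<comment> \<open>Pointwise convergence of the weighted characteristic functions is integrated by
    dominated convergence, here over \<theta> and afterwards over \<open>w\<close>, both times with
    the constant bound \<open>2 * B\<close>.\<close>
  have Kdiff: "(\<lambda>n. K X n w - K Y n w) \<longlonglongrightarrow> 0" for w
  proof -
    have "K X n w - K Y n w = (CLINT \<theta>|?N. iexp (w / \<eta> * \<theta>) * (\<Gamma> X n w \<theta> - \<Gamma> Y n w \<theta>))" for n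
      unfolding K_def using i\<Gamma>[OF XM] i\<Gamma>[OF YM] by (simp add: right_diff_distrib)
    moreover have "(\<lambda>n. CLINT \<theta>|?N. iexp (w / \<eta> * \<theta>) * (\<Gamma> X n w \<theta> - \<Gamma> Y n w \<theta>)) \<longlonglongrightarrow> (CLINT \<theta>|?N. 0)"
    proof (rule integral_dominated_convergence[where w="\<lambda>_. 2 * B"])
      show "AE \<theta> in ?N. (\<lambda>n. iexp (w / \<eta> * \<theta>) * (\<Gamma> X n w \<theta> - \<Gamma> Y n w \<theta>)) \<longlonglongrightarrow> 0"
      proof (rule AE_I2)
        fix \<theta>
        have "(\<lambda>n. \<Gamma> X n w \<theta> - \<Gamma> Y n w \<theta>) \<longlonglongrightarrow> 0"
          using char[of w "- (\<theta> / \<eta>)"] unfolding \<Gamma>_def .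
        then show "(\<lambda>n. iexp (w / \<eta> * \<theta>) * (\<Gamma> X n w \<theta> - \<Gamma> Y n w \<theta>)) \<longlonglongrightarrow> 0"
          by (rule tendsto_mult_right_zero)
      qed
      show "AE \<theta> in ?N. cmod (iexp (w / \<eta> * \<theta>) * (\<Gamma> X n w \<theta> - \<Gamma> Y n w \<theta>)) \<le> 2 * B" for n
      proof (rule AE_I2)
        fix \<theta>
        have "cmod (\<Gamma> X n w \<theta> - \<Gamma> Y n w \<theta>) \<le> 2 * B"
          using norm_triangle_ineq4[of "\<Gamma> X n w \<theta>" "\<Gamma> Y n w \<theta>"] \<Gamma>b[OF XM, of n w \<theta>] \<Gamma>b[OF YM, of n w \<theta>]
          by linarith
        then show "cmod (iexp (w / \<eta> * \<theta>) * (\<Gamma> X n w \<theta> - \<Gamma> Y n w \<theta>)) \<le> 2 * B"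
          by (simp add: norm_mult del: of_real_mult of_real_divide)
      qed
      note [measurable] = sec[OF XM] sec[OF YM]
      show "(\<lambda>\<theta>. iexp (w / \<eta> * \<theta>) * (\<Gamma> X n w \<theta> - \<Gamma> Y n w \<theta>)) \<in> borel_measurable ?N" for n
        by measurable
    qed simp_all
    ultimately show ?thesis by simp
  qed
  have "(\<lambda>n. CLINT w|?U. K X n w - K Y n w) \<longlonglongrightarrow> (CLINT w|?U. 0)"
  proof (rule integral_dominated_convergence[where w="\<lambda>_. 2 * B"])
    show "AE w in ?U. cmod (K X n w - K Y n w) \<le> 2 * B" for n
    proof (rule AE_I2)
      fix w show "cmod (K X n w - K Y n w) \<le> 2 * B"
        using norm_triangle_ineq4[of "K X n w" "K Y n w"] Kb[OF XM, of n w] Kb[OF YM, of n w] by linarith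
    qed
  qed (use Kdiff Km[OF XM] Km[OF YM] in auto)
  then have "(\<lambda>n. ?c * (CLINT w|?U. K X n w - K Y n w)) \<longlonglongrightarrow> 0"
    by (intro tendsto_mult_right_zero) simp
  moreover have "?c * (CLINT w|?U. K X n w - K Y n w) = complex_of_real (J X n - J Y n)" for n
  proof -
    have "complex_of_real (J V n) = ?c * (CLINT w|?U. K V n w)" if "\<forall>n. V n \<in> borel_measurable M" for V
      unfolding J_def K_def \<Gamma>_def by (rule fourier_smoothing[OF gm gB gA that[THEN spec] \<eta>(1)])
    from this[OF XM] this[OF YM] show ?thesis
      using iK[OF XM] iK[OF YM] by (simp add: right_diff_distrib del: of_real_divide)
  qed
  ultimately have "(\<lambda>n. complex_of_real (J X n - J Y n)) \<longlonglongrightarrow> complex_of_real 0" by simp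
  then have "(\<lambda>n. J X n - J Y n) \<longlonglongrightarrow> 0" by (simp only: tendsto_of_real_iff)
  then obtain no where no: "\<And>n. n \<ge> no \<Longrightarrow> \<bar>J X n - J Y n\<bar> < e / 2"
    using LIMSEQ_D[of "\<lambda>n. J X n - J Y n" 0 "e / 2"] e by auto
  have err: "\<bar>expectation (\<lambda>\<omega>. g n \<omega> (V n \<omega>)) - J V n\<bar> \<le> L * \<eta>"
    if "\<forall>n. V n \<in> borel_measurable M" for V n
    unfolding J_def by (rule smoothing_error[OF gm gB gL that[THEN spec] \<eta>(1)])
  have "norm (expectation (\<lambda>\<omega>. g n \<omega> (X n \<omega>)) - expectation (\<lambda>\<omega>. g n \<omega> (Y n \<omega>)) - 0) < e" if "n \<ge> no" for n
    using no[OF that] \<eta>(2) err[OF XM, of n] err[OF YM, of n] unfolding real_norm_def by linarith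
  then show "\<exists>no. \<forall>n\<ge>no. norm (expectation (\<lambda>\<omega>. g n \<omega> (X n \<omega>)) - expectation (\<lambda>\<omega>. g n \<omega> (Y n \<omega>)) - 0) < e"
    by blast
qed

text \<open>The support condition is removed by a Lipschitz cutoff; uniformly bounded second moments
  make the discarded tails small by a Chebyshev estimate.\<close>

lemma (in prob_space) weighted_char_imp_expectation:
  fixes g :: "nat \<Rightarrow> 'a \<Rightarrow> real \<Rightarrow> real"
  assumes gm: "\<And>n. (\<lambda>(\<omega>, w). g n \<omega> w) \<in> borel_measurable (M \<Otimes>\<^sub>M borel)"
    and XYm: "\<And>n. X n \<in> borel_measurable M" "\<And>n. Y n \<in> borel_measurable M"
    and gB: "\<And>n \<omega> w. \<omega> \<in> space M \<Longrightarrow> \<bar>g n \<omega> w\<bar> \<le> B"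
    and gL: "\<And>n \<omega> w z. \<omega> \<in> space M \<Longrightarrow> \<bar>g n \<omega> w - g n \<omega> z\<bar> \<le> L * \<bar>w - z\<bar>"
    and sqX: "\<And>n. integrable M (\<lambda>\<omega>. (X n \<omega>)\<^sup>2)" "\<And>n. expectation (\<lambda>\<omega>. (X n \<omega>)\<^sup>2) \<le> C"
    and sqY: "\<And>n. integrable M (\<lambda>\<omega>. (Y n \<omega>)\<^sup>2)" "\<And>n. expectation (\<lambda>\<omega>. (Y n \<omega>)\<^sup>2) \<le> C"
    and char: "\<And>w \<theta>. (\<lambda>n. (CLINT \<omega>|M. complex_of_real (g n \<omega> w) * iexp (\<theta> * X n \<omega>))
        - (CLINT \<omega>|M. complex_of_real (g n \<omega> w) * iexp (\<theta> * Y n \<omega>))) \<longlonglongrightarrow> 0"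
  shows "(\<lambda>n. expectation (\<lambda>\<omega>. g n \<omega> (X n \<omega>)) - expectation (\<lambda>\<omega>. g n \<omega> (Y n \<omega>))) \<longlonglongrightarrow> 0"
proof (rule LIMSEQ_I)
  have B0: "0 \<le> B" using not_empty gB by (meson abs_ge_zero all_not_in_conv order_trans)
  have C0: "0 \<le> C" by (rule order_trans[OF _ sqX(2)[of 0]]) simp
  fix e :: real assume e: "e > 0"
  \<comment> \<open>Chosen so that the tail estimate \<open>B * C / A^2\<close> is at most
    \<open>e / 4\<close>; the summand 1 keeps \<open>A\<close> positive when \<open>B * C\<close> is
    0.\<close>
  define A where "A = sqrt (4 * B * C / e) + 1"
  have A: "A > 0" "B * C / A\<^sup>2 \<le> e / 4"
  proof -
    show "A > 0" unfolding A_def using B0 C0 e by (intro add_nonneg_pos) auto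
    have "4 * B * C / e = (sqrt (4 * B * C / e))\<^sup>2" using B0 C0 e by simp
    also have "\<dots> \<le> A\<^sup>2" unfolding A_def using B0 C0 e by (intro power_mono) auto
    finally show "B * C / A\<^sup>2 \<le> e / 4" using e \<open>A > 0\<close> by (simp add: field_simps)
  qed
  \<comment> \<open>A trapezoid: 1 on \<open>[-A, A]\<close>, 0 outside
    \<open>[-A - 1, A + 1]\<close>, with slope at most 1. Its product with \<open>g\<close> has
    Lipschitz constant \<open>B + L\<close>.\<close>
  define \<tau> where "\<tau> w = max 0 (min 1 (A + 1 - \<bar>w\<bar>))" for w :: real
  have \<tau>01: "0 \<le> \<tau> w" "\<tau> w \<le> 1" for w by (auto simp: \<tau>_def)
  have \<tau>0: "\<tau> w = 0" if "\<bar>w\<bar> > A + 1" for w using that by (simp add: \<tau>_def)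
  have \<tau>L: "\<bar>\<tau> w - \<tau> z\<bar> \<le> \<bar>w - z\<bar>" for w z unfolding \<tau>_def by linarith
  have \<tau>m [measurable]: "\<tau> \<in> borel_measurable borel" unfolding \<tau>_def by measurable
  have \<tau>A: "1 - \<tau> w \<le> w\<^sup>2 / A\<^sup>2" for w
  proof (cases "\<bar>w\<bar> \<le> A")
    case True
    then have "\<tau> w = 1" by (simp add: \<tau>_def)
    then show ?thesis by simp
  next
    case False
    then have "A\<^sup>2 \<le> w\<^sup>2" using A(1) by (simp add: abs_le_square_iff[symmetric])
    then have "1 \<le> w\<^sup>2 / A\<^sup>2" using A(1) by simp
    then show ?thesis using \<tau>01[of w] by linarith
  qed
  have L\<tau>: "\<bar>\<tau> w * a - \<tau> z * b\<bar> \<le> (B + L) * \<bar>w - z\<bar>"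
    if "\<bar>a\<bar> \<le> B" "\<bar>a - b\<bar> \<le> L * \<bar>w - z\<bar>" for w z a b
  proof -
    have "\<tau> w * a - \<tau> z * b = (\<tau> w - \<tau> z) * a + \<tau> z * (a - b)" by (simp add: algebra_simps)
    also have "\<bar>\<dots>\<bar> \<le> \<bar>\<tau> w - \<tau> z\<bar> * \<bar>a\<bar> + \<tau> z * \<bar>a - b\<bar>"
      using \<tau>01[of z] by (intro order_trans[OF abs_triangle_ineq]) (simp add: abs_mult)
    also have "\<dots> \<le> \<bar>w - z\<bar> * B + 1 * (L * \<bar>w - z\<bar>)"
      using that \<tau>L \<tau>01 by (intro add_mono mult_mono) auto
    finally show ?thesis by (simp add: algebra_simps)
  qed
  have Bd: "\<bar>\<tau> w * a\<bar> \<le> B" if "\<bar>a\<bar> \<le> B" for w a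
    using mult_mono[of "\<tau> w" 1 "\<bar>a\<bar>" B] that \<tau>01[of w] by (simp add: abs_mult)
  have "(\<lambda>n. expectation (\<lambda>\<omega>. \<tau> (X n \<omega>) * g n \<omega> (X n \<omega>)) - expectation (\<lambda>\<omega>. \<tau> (Y n \<omega>) * g n \<omega> (Y n \<omega>))) \<longlonglongrightarrow> 0"
  proof (rule weighted_char_imp_expectation_compact[where A="A + 1" and B=B and L="B + L"
        and X=X and Y=Y and g="\<lambda>n \<omega> w. \<tau> w * g n \<omega> w"])
    show "(\<lambda>(\<omega>, w). \<tau> w * g n \<omega> w) \<in> borel_measurable (M \<Otimes>\<^sub>M borel)" for n
    proof -
      have "(\<lambda>x. \<tau> (snd x) * (case x of (\<omega>, w) \<Rightarrow> g n \<omega> w)) \<in> borel_measurable (M \<Otimes>\<^sub>M borel)"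
        using gm[of n] by measurable
      then show ?thesis by (simp add: case_prod_beta')
    qed
    fix w \<theta>
    have "(\<lambda>n. complex_of_real (\<tau> w) * ((CLINT \<omega>|M. complex_of_real (g n \<omega> w) * iexp (\<theta> * X n \<omega>))
        - (CLINT \<omega>|M. complex_of_real (g n \<omega> w) * iexp (\<theta> * Y n \<omega>)))) \<longlonglongrightarrow> 0"
      by (rule tendsto_mult_right_zero[OF char])
    then show "(\<lambda>n. (CLINT \<omega>|M. complex_of_real (\<tau> w * g n \<omega> w) * iexp (\<theta> * X n \<omega>))
        - (CLINT \<omega>|M. complex_of_real (\<tau> w * g n \<omega> w) * iexp (\<theta> * Y n \<omega>))) \<longlonglongrightarrow> 0"
      by (simp add: right_diff_distrib mult.assoc)
  qed (auto intro!: L\<tau> Bd gB gL XYm simp: \<tau>0)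
  from LIMSEQ_D[OF this, of "e / 2"] e
  obtain no where no: "\<And>n. n \<ge> no \<Longrightarrow> \<bar>expectation (\<lambda>\<omega>. \<tau> (X n \<omega>) * g n \<omega> (X n \<omega>)) -
      expectation (\<lambda>\<omega>. \<tau> (Y n \<omega>) * g n \<omega> (Y n \<omega>))\<bar> < e / 2"
    by auto
  have tail: "\<bar>(1 - \<tau> x) * a\<bar> \<le> B / A\<^sup>2 * x\<^sup>2" if "\<bar>a\<bar> \<le> B" for x a
  proof -
    have "(1 - \<tau> x) * \<bar>a\<bar> \<le> (x\<^sup>2 / A\<^sup>2) * B"
      using that \<tau>A[of x] \<tau>01[of x] by (intro mult_mono) auto
    then show ?thesis using \<tau>01[of x] by (simp add: abs_mult mult.commute)
  qed
  have trunc: "\<bar>expectation (\<lambda>\<omega>. g n \<omega> (V \<omega>)) - expectation (\<lambda>\<omega>. \<tau> (V \<omega>) * g n \<omega> (V \<omega>))\<bar> \<le> e / 4"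
    if [measurable]: "V \<in> borel_measurable M" and sq: "integrable M (\<lambda>\<omega>. (V \<omega>)\<^sup>2)" "expectation (\<lambda>\<omega>. (V \<omega>)\<^sup>2) \<le> C"
    for n V
  proof -
    have [measurable]: "(\<lambda>\<omega>. g n \<omega> (V \<omega>)) \<in> borel_measurable M"
    proof -
      have "(\<lambda>\<omega>. (\<omega>, V \<omega>)) \<in> M \<rightarrow>\<^sub>M M \<Otimes>\<^sub>M borel" by measurable
      from measurable_compose[OF this gm[of n]] show ?thesis by simp
    qed
    have i: "integrable M (\<lambda>\<omega>. g n \<omega> (V \<omega>))" "integrable M (\<lambda>\<omega>. \<tau> (V \<omega>) * g n \<omega> (V \<omega>))"
      by (rule integrable_const_bound[where B=B]; auto intro!: AE_I2 gB Bd)+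
    have "\<bar>expectation (\<lambda>\<omega>. g n \<omega> (V \<omega>)) - expectation (\<lambda>\<omega>. \<tau> (V \<omega>) * g n \<omega> (V \<omega>))\<bar>
        = \<bar>expectation (\<lambda>\<omega>. (1 - \<tau> (V \<omega>)) * g n \<omega> (V \<omega>))\<bar>"
      using i by (simp add: left_diff_distrib)
    also have "\<dots> \<le> expectation (\<lambda>\<omega>. B / A\<^sup>2 * (V \<omega>)\<^sup>2)"
    proof (rule norm_integral_le[where 'b=real, unfolded real_norm_def])
      show "integrable M (\<lambda>\<omega>. (1 - \<tau> (V \<omega>)) * g n \<omega> (V \<omega>))"
        using i by (simp add: left_diff_distrib)
    qed (use sq(1) in simp, rule tail[OF gB])
    also have "\<dots> = B / A\<^sup>2 * expectation (\<lambda>\<omega>. (V \<omega>)\<^sup>2)" by simp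
    also have "\<dots> \<le> B / A\<^sup>2 * C" using sq(2) B0 by (intro mult_left_mono) auto
    also have "\<dots> \<le> e / 4" using A(2) by simp
    finally show ?thesis .
  qed
  have "norm (expectation (\<lambda>\<omega>. g n \<omega> (X n \<omega>)) - expectation (\<lambda>\<omega>. g n \<omega> (Y n \<omega>)) - 0) < e" if "n \<ge> no" for n
    using no[OF that] trunc[OF XYm(1) sqX, of n n] trunc[OF XYm(2) sqY, of n n] unfolding real_norm_def by linarith
  then show "\<exists>no. \<forall>n\<ge>no. norm (expectation (\<lambda>\<omega>. g n \<omega> (X n \<omega>)) - expectation (\<lambda>\<omega>. g n \<omega> (Y n \<omega>)) - 0) < e"
    by blast
qed

text \<open>The parameter is the variance. Taking the image of the standard normal law rather than a
  density includes \<open>v = 0\<close>, the point mass at 0.\<close>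

definition gauss :: "real \<Rightarrow> real measure" where
  "gauss v = distr std_normal_distribution borel (\<lambda>x. sqrt v * x)"

lemma sets_gauss [measurable_cong, simp]: "sets (gauss v) = sets borel"
  by (simp add: gauss_def)

lemma space_gauss [simp]: "space (gauss v) = UNIV"
  by (simp add: gauss_def)

lemma prob_space_gauss: "prob_space (gauss v)"
proof -
  interpret N: real_distribution std_normal_distribution by (rule real_dist_normal_dist)
  show ?thesis unfolding gauss_def by (rule N.prob_space_distr) simp
qed

lemma char_gauss:
  assumes "v \<ge> 0"
  shows "(CLINT z|gauss v. iexp (\<theta> * z)) = complex_of_real (exp (- (\<theta>\<^sup>2 * v / 2)))"
proof -
  have "(CLINT z|gauss v. iexp (\<theta> * z)) = (CLINT x|std_normal_distribution. iexp (\<theta> * (sqrt v * x)))"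
    unfolding gauss_def by (subst integral_distr) auto
  also have "\<dots> = char std_normal_distribution (\<theta> * sqrt v)"
    unfolding char_def by (simp add: mult.assoc)
  also have "\<dots> = complex_of_real (exp (- (\<theta>\<^sup>2 * v / 2)))"
    using assms by (simp add: char_std_normal_distribution power_mult_distrib)
  finally show ?thesis .
qed

lemma gauss_second_moment:
  assumes "v \<ge> 0"
  shows "integrable (gauss v) (\<lambda>z. z\<^sup>2)" "(\<integral>z. z\<^sup>2 \<partial>gauss v) = v"
proof -
  have i: "integrable std_normal_distribution (\<lambda>x. x\<^sup>2)"
    using std_normal_distribution_even_moments(2)[of 1] by simp
  then show "integrable (gauss v) (\<lambda>z. z\<^sup>2)"
    unfolding gauss_def by (subst integrable_distr_eq) (auto simp: power_mult_distrib)
  have "(\<integral>z. z\<^sup>2 \<partial>gauss v) = v * (\<integral>x. x\<^sup>2 \<partial>std_normal_distribution)"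
    unfolding gauss_def using assms by (subst integral_distr) (auto simp: power_mult_distrib)
  then show "(\<integral>z. z\<^sup>2 \<partial>gauss v) = v"
    using std_normal_distribution_even_moments(1)[of 1] by simp
qed

lemma (in pair_prob_space) integral_pair_fst:
  fixes f :: "'a \<Rightarrow> 'c::{banach, second_countable_topology}"
  assumes "f \<in> borel_measurable M1"
  shows "(\<integral>x. f (fst x) \<partial>(M1 \<Otimes>\<^sub>M M2)) = (\<integral>\<omega>. f \<omega> \<partial>M1)"
  using integral_distr[OF measurable_fst assms, of M2] unfolding M2.distr_pair_fst by simp

text \<open>On the product of \<open>M\<close> with \<open>gauss v\<close>, the second coordinate is
  a Gaussian variable independent of the weights and lives on the same space as the
  \<open>X n\<close>. Its weighted characteristic function factorises into the expression subtracted
  in \<open>char\<close>.\<close>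

lemma (in prob_space) weighted_char_imp_gauss:
  fixes g :: "nat \<Rightarrow> 'a \<Rightarrow> real \<Rightarrow> real"
  assumes v: "v \<ge> 0"
    and gm: "\<And>n. (\<lambda>(\<omega>, w). g n \<omega> w) \<in> borel_measurable (M \<Otimes>\<^sub>M borel)"
    and X [measurable]: "\<And>n. X n \<in> borel_measurable M"
    and gB: "\<And>n \<omega> w. \<omega> \<in> space M \<Longrightarrow> \<bar>g n \<omega> w\<bar> \<le> B"
    and gL: "\<And>n \<omega> w z. \<omega> \<in> space M \<Longrightarrow> \<bar>g n \<omega> w - g n \<omega> z\<bar> \<le> L * \<bar>w - z\<bar>"
    and sq: "\<And>n. integrable M (\<lambda>\<omega>. (X n \<omega>)\<^sup>2)" "\<And>n. (\<integral>\<omega>. (X n \<omega>)\<^sup>2 \<partial>M) \<le> C"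
    and char: "\<And>w \<theta>. (\<lambda>n. (CLINT \<omega>|M. complex_of_real (g n \<omega> w) * iexp (\<theta> * X n \<omega>))
        - complex_of_real (exp (- (\<theta>\<^sup>2 * v / 2))) * complex_of_real (\<integral>\<omega>. g n \<omega> w \<partial>M)) \<longlonglongrightarrow> 0"
  shows "(\<lambda>n. (\<integral>\<omega>. g n \<omega> (X n \<omega>) \<partial>M) - (\<integral>\<omega>. (\<integral>z. g n \<omega> z \<partial>gauss v) \<partial>M)) \<longlonglongrightarrow> 0"
proof -
  interpret G: prob_space "gauss v" by (rule prob_space_gauss)
  interpret P: pair_prob_space M "gauss v" ..
  let ?P = "M \<Otimes>\<^sub>M gauss v"
  have gw [measurable]: "(\<lambda>\<omega>. g n \<omega> w) \<in> borel_measurable M" for n w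
    by (rule joint_measurable_section[OF gm])
  have ig: "integrable ?P (\<lambda>x. g n (fst x) (snd x))" for n
  proof (rule P.integrable_const_bound[where B=B])
    show "(\<lambda>x. g n (fst x) (snd x)) \<in> borel_measurable ?P"
      using gm[of n] by (simp add: case_prod_beta' cong: measurable_cong_sets)
  qed (auto intro!: AE_I2 gB simp: space_pair_measure)
  have d1: "distr ?P M fst = M" by (rule G.distr_pair_fst)
  have d2: "distr ?P (gauss v) snd = gauss v"
  proof (rule measure_eqI)
    fix A assume "A \<in> sets (distr ?P (gauss v) snd)"
    then have A [measurable]: "A \<in> sets (gauss v)" by simp
    have "snd -` A \<inter> space ?P = space M \<times> A" by (auto simp: space_pair_measure)
    then have "emeasure (distr ?P (gauss v) snd) A = emeasure ?P (space M \<times> A)"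
      by (subst emeasure_distr[OF measurable_snd A]) simp
    also have "\<dots> = emeasure (gauss v) A"
      by (subst G.emeasure_pair_measure_Times) (use A emeasure_space_1 in auto)
    finally show "emeasure (distr ?P (gauss v) snd) A = emeasure (gauss v) A" .
  qed simp
  have gX [measurable]: "(\<lambda>\<omega>. g n \<omega> (X n \<omega>)) \<in> borel_measurable M" for n
  proof -
    have "(\<lambda>\<omega>. (\<omega>, X n \<omega>)) \<in> M \<rightarrow>\<^sub>M M \<Otimes>\<^sub>M borel" by measurable
    from measurable_compose[OF this gm[of n]] show ?thesis by simp
  qed
  have "(\<lambda>n. (\<integral>x. g n (fst x) (X n (fst x)) \<partial>?P) - (\<integral>x. g n (fst x) (snd x) \<partial>?P)) \<longlonglongrightarrow> 0"
  proof (rule P.weighted_char_imp_expectation[where C="max C v" and B=B and L=L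
        and X="\<lambda>n x. X n (fst x)" and Y="\<lambda>_. snd" and g="\<lambda>n x w. g n (fst x) w"])
    show "(\<lambda>(x, w). g n (fst x) w) \<in> borel_measurable (?P \<Otimes>\<^sub>M borel)" for n
    proof -
      have "(\<lambda>x. (fst (fst x), snd x)) \<in> ?P \<Otimes>\<^sub>M (borel :: real measure) \<rightarrow>\<^sub>M M \<Otimes>\<^sub>M (borel :: real measure)"
        by measurable
      from measurable_compose[OF this gm[of n]] show ?thesis by (simp add: case_prod_beta')
    qed
    have "integrable (distr ?P (gauss v) snd) (\<lambda>z. z\<^sup>2)" "(\<integral>z. z\<^sup>2 \<partial>distr ?P (gauss v) snd) = v"
      unfolding d2 by (rule gauss_second_moment[OF v])+
    then show "integrable ?P (\<lambda>x. (snd x)\<^sup>2)" "(\<integral>x. (snd x)\<^sup>2 \<partial>?P) \<le> max C v"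
      by (simp_all add: integrable_distr_eq integral_distr)
    have "integrable (distr ?P M fst) (\<lambda>\<omega>. (X n \<omega>)\<^sup>2)" for n unfolding d1 by (rule sq(1))
    then show "integrable ?P (\<lambda>x. (X n (fst x))\<^sup>2)" for n
      by (subst (asm) integrable_distr_eq) auto
    show "(\<integral>x. (X n (fst x))\<^sup>2 \<partial>?P) \<le> max C v" for n
      using sq(2)[of n] by (subst P.integral_pair_fst) auto
    fix w \<theta> :: real
    have "(CLINT x|?P. complex_of_real (g n (fst x) w) * iexp (\<theta> * snd x))
       = complex_of_real (exp (- (\<theta>\<^sup>2 * v / 2))) * complex_of_real (\<integral>\<omega>. g n \<omega> w \<partial>M)" for n
    proof -
      have "(CLINT x|?P. complex_of_real (g n (fst x) w) * iexp (\<theta> * snd x))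
         = (CLINT \<omega>|M. CLINT z|gauss v. complex_of_real (g n \<omega> w) * iexp (\<theta> * z))"
      proof (subst P.integral_fst'[symmetric])
        show "complex_integrable ?P (\<lambda>x. complex_of_real (g n (fst x) w) * iexp (\<theta> * snd x))"
          by (rule P.integrable_const_bound[where B=B])
            (auto intro!: AE_I2 simp: norm_mult gB space_pair_measure simp del: of_real_mult)
      qed simp
      also have "\<dots> = complex_of_real (exp (- (\<theta>\<^sup>2 * v / 2))) * complex_of_real (\<integral>\<omega>. g n \<omega> w \<partial>M)"
        using char_gauss[OF v, of \<theta>] integral_complex_of_real[of M "\<lambda>\<omega>. g n \<omega> w"] by simp
      finally show ?thesis .
    qed
    moreover have "(CLINT x|?P. complex_of_real (g n (fst x) w) * iexp (\<theta> * X n (fst x)))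
       = (CLINT \<omega>|M. complex_of_real (g n \<omega> w) * iexp (\<theta> * X n \<omega>))" for n
      by (rule P.integral_pair_fst) measurable
    ultimately show "(\<lambda>n. (CLINT x|?P. complex_of_real (g n (fst x) w) * iexp (\<theta> * X n (fst x)))
        - (CLINT x|?P. complex_of_real (g n (fst x) w) * iexp (\<theta> * snd x))) \<longlonglongrightarrow> 0"
      using char[of w \<theta>] by simp
  qed (use gB gL in \<open>auto simp: space_pair_measure\<close>)
  moreover have "(\<integral>x. g n (fst x) (snd x) \<partial>?P) = (\<integral>\<omega>. (\<integral>z. g n \<omega> z \<partial>gauss v) \<partial>M)" for n
    using P.integral_fst'[OF ig[of n]] by simp
  moreover have "(\<integral>x. g n (fst x) (X n (fst x)) \<partial>?P) = (\<integral>\<omega>. g n \<omega> (X n \<omega>) \<partial>M)" for n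
    by (rule P.integral_pair_fst[OF gX])
  ultimately show ?thesis by simp
qed

section \<open>Finite-dimensional convergence\<close>

text \<open>Functions of the first \<open>d\<close> coordinates, kept as functions on whole
  sequences. No restricted function spaces are then needed when \<open>d\<close> changes in an
  induction.\<close>

definition depends_lipschitz :: "nat \<Rightarrow> real \<Rightarrow> ((nat \<Rightarrow> real) \<Rightarrow> real) \<Rightarrow> bool" where
  "depends_lipschitz d L G \<longleftrightarrow> (\<forall>x y. \<bar>G x - G y\<bar> \<le> L * (\<Sum>j<d. \<bar>x j - y j\<bar>))"

lemma depends_lipschitzD: "depends_lipschitz d L G \<Longrightarrow> \<bar>G x - G y\<bar> \<le> L * (\<Sum>j<d. \<bar>x j - y j\<bar>)"
  by (simp add: depends_lipschitz_def)

lemma depends_lipschitz_eq: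
  assumes "depends_lipschitz d L G" "\<And>j. j < d \<Longrightarrow> x j = y j"
  shows "G x = G y"
  using depends_lipschitzD[OF assms(1), of x y] assms(2) by simp

lemma depends_lipschitz_measurable:
  assumes "depends_lipschitz d L G"
  shows "G \<in> borel_measurable borel"
proof (rule borel_measurable_continuous_onI)
  show "continuous_on UNIV G"
    unfolding continuous_on_def
  proof
    fix x
    have "((\<lambda>y. L * (\<Sum>j<d. \<bar>y j - x j\<bar>)) \<longlongrightarrow> L * (\<Sum>j<d. \<bar>x j - x j\<bar>)) (at x within UNIV)"
      by (intro tendsto_intros continuous_on_product_coordinates[unfolded continuous_on_def, rule_format]) auto
    then have "((\<lambda>y. L * (\<Sum>j<d. \<bar>y j - x j\<bar>)) \<longlongrightarrow> 0) (at x within UNIV)" by simp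
    then have "((\<lambda>y. G y - G x) \<longlongrightarrow> 0) (at x within UNIV)"
      by (rule Lim_null_comparison[rotated]) (use assms in \<open>auto simp: depends_lipschitz_def\<close>)
    then show "(G \<longlongrightarrow> G x) (at x within UNIV)" by (simp add: LIM_zero_iff)
  qed
qed

text \<open>Coordinates from \<open>d\<close> on may be replaced by 0 without changing
  \<open>G\<close>, so nothing is required of them. This lets \<open>G\<close> be used on a finite
  product of measures.\<close>

lemma depends_lipschitz_measurable_compose:
  assumes G: "depends_lipschitz d L G" and f: "\<And>j. j < d \<Longrightarrow> (\<lambda>x. f x j) \<in> borel_measurable M"
  shows "(\<lambda>x. G (f x)) \<in> borel_measurable M"
proof -
  have "(\<lambda>x. (\<lambda>j. if j < d then f x j else 0)) \<in> borel_measurable M"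
  proof (rule measurable_coordinatewise_then_product)
    fix j show "(\<lambda>x. if j < d then f x j else 0) \<in> borel_measurable M"
      using f[of j] by (cases "j < d") auto
  qed
  from measurable_compose[OF this depends_lipschitz_measurable[OF G]]
  have "(\<lambda>x. G (\<lambda>j. if j < d then f x j else 0)) \<in> borel_measurable M" .
  moreover have "G (\<lambda>j. if j < d then f x j else 0) = G (f x)" for x
    by (rule depends_lipschitz_eq[OF G]) simp
  ultimately show ?thesis by simp
qed

context bounded_martingale
begin

section \<open>Vanishing error sums and the limit of block characteristic functions\<close>

lemma dev_nonneg: "0 \<le> dev k"
  unfolding dev_def by simp

lemma dev_le: "dev k \<le> 2"
proof -
  have "\<bar>\<kappa> k \<omega> - \<sigma>2\<bar> \<le> 2" if "\<omega> \<in> space M" for \<omega>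
    using \<kappa>_bound[OF that, of k] \<sigma>2 by linarith
  then have "dev k \<le> expectation (\<lambda>_. 2)"
    unfolding dev_def by (intro integral_mono integrable_bounded[where B=2]) auto
  then show ?thesis by (simp add: prob_space)
qed

text \<open>In the \<open>dev\<close> sum, the first \<open>K\<close> terms vanish because
  \<open>c n\<close> tends to 0, and the later ones carry a small \<open>dev\<close> while the total
  weight stays bounded. The higher powers are a bounded sum of squares times a power of the largest
  entry.\<close>

lemma array_negligible:
  fixes c :: "nat \<Rightarrow> real" and m :: "nat \<Rightarrow> nat"
  assumes c: "\<And>n. 0 \<le> c n" "c \<longlonglongrightarrow> 0" and Q: "(\<lambda>n. (c n)\<^sup>2 * Q (m n)) \<longlonglongrightarrow> l"
    and small: "\<And>\<delta>. \<delta> > 0 \<Longrightarrow> eventually (\<lambda>n. \<forall>k<m n. c n * s k \<le> \<delta>) sequentially"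
  shows "(\<lambda>n. \<Sum>k<m n. (c n * s k)\<^sup>2 * dev k) \<longlonglongrightarrow> 0"
    and "(\<lambda>n. \<Sum>k<m n. (c n * s k) ^ 3) \<longlonglongrightarrow> 0"
    and "(\<lambda>n. \<Sum>k<m n. (c n * s k) ^ 4) \<longlonglongrightarrow> 0"
proof -
  obtain C where C: "C > 0" "\<And>n. (c n)\<^sup>2 * Q (m n) \<le> C"
  proof -
    have "Bseq (\<lambda>n. (c n)\<^sup>2 * Q (m n))" using Q by (intro convergent_imp_Bseq) (auto simp: convergent_def)
    then obtain C where "C > 0" "\<And>n. norm ((c n)\<^sup>2 * Q (m n)) \<le> C" by (auto simp: Bseq_def)
    then show thesis using that[of C] by (metis abs_le_D1 real_norm_def)
  qed
  have sumQ: "(\<Sum>k<m n. (c n * s k)\<^sup>2) = (c n)\<^sup>2 * Q (m n)" for n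
    by (simp add: Q_def power_mult_distrib sum_distrib_left)
  have cs: "0 \<le> c n * s k" for n k using c s_nonneg by simp
  show "(\<lambda>n. \<Sum>k<m n. (c n * s k)\<^sup>2 * dev k) \<longlonglongrightarrow> 0"
  proof (rule LIMSEQ_I)
    fix e :: real assume e: "e > 0"
    have "eventually (\<lambda>k. dev k < e / (2 * C)) sequentially"
      using \<kappa>_conv e C unfolding dev_def by (intro order_tendstoD(2)) auto
    then obtain K where K: "\<And>k. k \<ge> K \<Longrightarrow> dev k < e / (2 * C)"
      by (auto simp: eventually_sequentially)
    have "(\<lambda>n. (c n)\<^sup>2 * (2 * Q K)) \<longlonglongrightarrow> 0\<^sup>2 * (2 * Q K)" by (intro tendsto_intros c)
    then have "eventually (\<lambda>n. (c n)\<^sup>2 * (2 * Q K) < e / 2) sequentially"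
      using e by (intro order_tendstoD(2)) auto
    then obtain n0 where n0: "\<And>n. n \<ge> n0 \<Longrightarrow> (c n)\<^sup>2 * (2 * Q K) < e / 2"
      by (auto simp: eventually_sequentially)
    have "norm ((\<Sum>k<m n. (c n * s k)\<^sup>2 * dev k) - 0) < e" if n: "n \<ge> n0" for n
    proof -
      have "(\<Sum>k<m n. (c n * s k)\<^sup>2 * dev k) \<le>
          (\<Sum>k<m n. (if k < K then 2 * (c n * s k)\<^sup>2 else 0) + (c n * s k)\<^sup>2 * (e / (2 * C)))"
      proof (rule sum_mono)
        fix k
        have "0 \<le> (c n * s k)\<^sup>2 * (e / (2 * C))" using e C by simp
        moreover have "(c n * s k)\<^sup>2 * dev k \<le> (c n * s k)\<^sup>2 * 2"
          by (intro mult_left_mono dev_le) auto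
        moreover have "(c n * s k)\<^sup>2 * dev k \<le> (c n * s k)\<^sup>2 * (e / (2 * C))" if "\<not> k < K"
          using K[of k] that by (intro mult_left_mono) auto
        ultimately show "(c n * s k)\<^sup>2 * dev k \<le> (if k < K then 2 * (c n * s k)\<^sup>2 else 0) + (c n * s k)\<^sup>2 * (e / (2 * C))"
          by auto
      qed
      also have "\<dots> = (\<Sum>k<m n. if k < K then 2 * (c n * s k)\<^sup>2 else 0) + (c n)\<^sup>2 * Q (m n) * (e / (2 * C))"
        by (simp add: sum.distrib sum_distrib_right[symmetric] sumQ del: times_divide_eq_right)
      also have "(\<Sum>k<m n. if k < K then 2 * (c n * s k)\<^sup>2 else 0) \<le> (\<Sum>k<K. 2 * (c n * s k)\<^sup>2)"
        by (subst sum.If_cases) (auto intro!: sum_mono2)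
      also have "(\<Sum>k<K. 2 * (c n * s k)\<^sup>2) = (c n)\<^sup>2 * (2 * Q K)"
        by (simp add: Q_def power_mult_distrib sum_distrib_left mult_ac)
      also have "(c n)\<^sup>2 * Q (m n) * (e / (2 * C)) \<le> C * (e / (2 * C))"
        using C e by (intro mult_right_mono) auto
      also have "C * (e / (2 * C)) = e / 2" using C by simp
      finally have "(\<Sum>k<m n. (c n * s k)\<^sup>2 * dev k) < e" using n0[OF n] by linarith
      moreover have "0 \<le> (\<Sum>k<m n. (c n * s k)\<^sup>2 * dev k)" by (intro sum_nonneg mult_nonneg_nonneg dev_nonneg) auto
      ultimately show ?thesis by simp
    qed
    then show "\<exists>no. \<forall>n\<ge>no. norm ((\<Sum>k<m n. (c n * s k)\<^sup>2 * dev k) - 0) < e" by blast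
  qed
  have pow: "(\<lambda>n. \<Sum>k<m n. (c n * s k) ^ (2 + Suc i)) \<longlonglongrightarrow> 0" for i
  proof (rule LIMSEQ_I)
    fix e :: real assume e: "e > 0"
    \<comment> \<open>The bound by 1 ensures that every positive power of \<delta> is at most
      \<delta>; the other bound makes the sum smaller than \<open>e\<close>.\<close>
    define \<delta> where "\<delta> = min 1 (e / (2 * C))"
    have \<delta>: "0 < \<delta>" "\<delta> \<le> 1" "C * \<delta> < e"
    proof -
      have "C * \<delta> \<le> C * (e / (2 * C))" unfolding \<delta>_def using C by (intro mult_left_mono) auto
      then show "C * \<delta> < e" using C e by simp
    qed (use C e in \<open>auto simp: \<delta>_def\<close>)
    obtain n0 where n0: "\<And>n k. n \<ge> n0 \<Longrightarrow> k < m n \<Longrightarrow> c n * s k \<le> \<delta>"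
      using small[OF \<delta>(1)] by (auto simp: eventually_sequentially)
    have "norm ((\<Sum>k<m n. (c n * s k) ^ (2 + Suc i)) - 0) < e" if n: "n \<ge> n0" for n
    proof -
      have "(\<Sum>k<m n. (c n * s k) ^ (2 + Suc i)) \<le> (\<Sum>k<m n. (c n * s k)\<^sup>2 * \<delta>)"
      proof (rule sum_mono)
        fix k assume "k \<in> {..<m n}"
        then have a: "c n * s k \<le> \<delta>" using n0[OF n, of k] by simp
        have "(c n * s k) ^ Suc i \<le> \<delta> ^ Suc i" using cs a by (intro power_mono) auto
        also have "\<dots> \<le> \<delta>" using \<delta> power_le_one[of \<delta> i] by (simp add: mult_left_le)
        finally show "(c n * s k) ^ (2 + Suc i) \<le> (c n * s k)\<^sup>2 * \<delta>"
          unfolding power_add by (intro mult_left_mono) auto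
      qed
      also have "\<dots> = (c n)\<^sup>2 * Q (m n) * \<delta>" by (simp add: sum_distrib_right[symmetric] sumQ)
      also have "\<dots> \<le> C * \<delta>" using C \<delta> by (intro mult_right_mono) auto
      finally have "(\<Sum>k<m n. (c n * s k) ^ (2 + Suc i)) < e" using \<delta>(3) by linarith
      moreover have "0 \<le> (\<Sum>k<m n. (c n * s k) ^ (2 + Suc i))" by (intro sum_nonneg zero_le_power cs)
      ultimately show ?thesis by simp
    qed
    then show "\<exists>no. \<forall>n\<ge>no. norm ((\<Sum>k<m n. (c n * s k) ^ (2 + Suc i)) - 0) < e" by blast
  qed
  show "(\<lambda>n. \<Sum>k<m n. (c n * s k) ^ 3) \<longlonglongrightarrow> 0" using pow[of 0] by (simp add: eval_nat_numeral)
  show "(\<lambda>n. \<Sum>k<m n. (c n * s k) ^ 4) \<longlonglongrightarrow> 0" using pow[of 1] by (simp add: eval_nat_numeral)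
qed

text \<open>The weights \<open>H n\<close> vary with \<open>n\<close>, since they will be functions
  of the earlier blocks. Hence the estimate is uniform in them: the error sum of the block, enlarged
  to start at 0, plus the distance between the prelimit and limit Gaussian factors.\<close>

lemma char_block_tendsto:
  fixes c :: "nat \<Rightarrow> real" and a b :: "nat \<Rightarrow> nat" and H :: "nat \<Rightarrow> 'a \<Rightarrow> real"
  assumes c: "\<And>n. 0 \<le> c n" "c \<longlonglongrightarrow> 0" and ab: "\<And>n. a n \<le> b n"
    and Qa: "(\<lambda>n. (c n)\<^sup>2 * Q (a n)) \<longlonglongrightarrow> la" and Qb: "(\<lambda>n. (c n)\<^sup>2 * Q (b n)) \<longlonglongrightarrow> lb"
    and small: "\<And>\<delta>. \<delta> > 0 \<Longrightarrow> eventually (\<lambda>n. \<forall>k<b n. c n * s k \<le> \<delta>) sequentially"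
    and H: "\<And>n. H n \<in> borel_measurable (F (a n))" and HB: "\<And>n \<omega>. \<omega> \<in> space M \<Longrightarrow> \<bar>H n \<omega>\<bar> \<le> 1"
  shows "(\<lambda>n. (CLINT \<omega>|M. complex_of_real (H n \<omega>) * iexp (\<theta> * (c n * (S (b n) \<omega> - S (a n) \<omega>))))
      - complex_of_real (exp (- (\<theta>\<^sup>2 * (\<sigma>2 * (lb - la)) / 2))) * complex_of_real (expectation (H n))) \<longlonglongrightarrow> 0"
proof -
  define x where "x n = exp (- (\<theta>\<^sup>2 * (\<sigma>2 * ((c n)\<^sup>2 * Q (b n) - (c n)\<^sup>2 * Q (a n))) / 2))" for n
  define y where "y = exp (- (\<theta>\<^sup>2 * (\<sigma>2 * (lb - la)) / 2))"
  have xy: "x \<longlonglongrightarrow> y" unfolding x_def y_def by (intro tendsto_intros Qa Qb) simp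
  define I where "I n = (CLINT \<omega>|M. complex_of_real (H n \<omega>) * iexp (\<theta> * (c n * (S (b n) \<omega> - S (a n) \<omega>))))" for n
  define err where "err n = \<theta>\<^sup>2 * (\<Sum>k<b n. (c n * s k)\<^sup>2 * dev k) + \<bar>\<theta>\<bar> ^ 3 * (\<Sum>k<b n. (c n * s k) ^ 3)
      + \<theta> ^ 4 * (\<Sum>k<b n. (c n * s k) ^ 4)" for n
  have err: "err \<longlonglongrightarrow> 0"
  proof -
    have "err \<longlonglongrightarrow> \<theta>\<^sup>2 * 0 + \<bar>\<theta>\<bar> ^ 3 * 0 + \<theta> ^ 4 * 0"
      unfolding err_def by (intro tendsto_intros array_negligible[OF c Qb small])
    then show ?thesis by simp
  qed
  have EH: "\<bar>expectation (H n)\<bar> \<le> 1" for n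
  proof -
    have "\<bar>expectation (H n)\<bar> \<le> expectation (\<lambda>_. 1)"
      by (rule norm_integral_le[where 'b=real, unfolded real_norm_def])
        (auto intro!: integrable_bounded[where B=1] F_measD[OF H] HB)
    then show ?thesis by (simp add: prob_space)
  qed
  have bound: "cmod (I n - complex_of_real y * complex_of_real (expectation (H n))) \<le> err n + \<bar>x n - y\<bar>" for n
  proof -
    have "cmod (I n - complex_of_real (x n) * complex_of_real (expectation (H n))) \<le>
      (\<Sum>k=a n..<b n. (\<theta> * c n)\<^sup>2 * (s k)\<^sup>2 * dev k + \<bar>\<theta> * c n\<bar> ^ 3 * s k ^ 3 + (\<theta> * c n) ^ 4 * s k ^ 4)"
      using char_block[OF H[of n] HB[of _ n] ab[of n], where \<theta>="\<theta> * c n"] unfolding I_def x_def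
      by (simp add: mult.assoc power_mult_distrib right_diff_distrib mult_ac)
    also have "\<dots> \<le> (\<Sum>k<b n. (\<theta> * c n)\<^sup>2 * (s k)\<^sup>2 * dev k + \<bar>\<theta> * c n\<bar> ^ 3 * s k ^ 3 + (\<theta> * c n) ^ 4 * s k ^ 4)"
      by (intro sum_mono2 add_nonneg_nonneg mult_nonneg_nonneg dev_nonneg) (auto simp: s_nonneg)
    also have "\<dots> = err n"
      unfolding err_def using c(1)[of n]
      by (simp add: sum.distrib sum_distrib_left power_mult_distrib abs_mult mult_ac)
    finally have 1: "cmod (I n - complex_of_real (x n) * complex_of_real (expectation (H n))) \<le> err n" .
    have 2: "cmod (complex_of_real (x n - y) * complex_of_real (expectation (H n))) \<le> \<bar>x n - y\<bar>"
      unfolding norm_mult norm_of_real using EH[of n] by (intro mult_right_le_one_le) auto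
    have "I n - complex_of_real y * complex_of_real (expectation (H n)) =
       (I n - complex_of_real (x n) * complex_of_real (expectation (H n)))
       + complex_of_real (x n - y) * complex_of_real (expectation (H n))"
      by (simp add: algebra_simps)
    then show ?thesis using norm_triangle_le[OF add_mono[OF 1 2]] by (simp only:)
  qed
  have "(\<lambda>n. err n + \<bar>x n - y\<bar>) \<longlonglongrightarrow> 0 + \<bar>y - y\<bar>" by (intro tendsto_intros err xy)
  then have "(\<lambda>n. err n + \<bar>x n - y\<bar>) \<longlonglongrightarrow> 0" by simp
  then have "(\<lambda>n. I n - complex_of_real y * complex_of_real (expectation (H n))) \<longlonglongrightarrow> 0"
    by (rule Lim_null_comparison[rotated]) (simp add: bound)
  then show ?thesis unfolding I_def y_def .
qed

text \<open>Replacing the last block by a Gaussian variable and integrating it out yields a function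
  \<open>g\<close> of the earlier blocks with the same bound and Lipschitz constant, so the
  induction on \<open>d\<close> continues with \<open>g\<close>.\<close>

theorem finite_dimensional_clt:
  fixes c :: "nat \<Rightarrow> real" and p :: "nat \<Rightarrow> nat \<Rightarrow> nat" and l :: "nat \<Rightarrow> real"
  assumes c: "\<And>n. 0 \<le> c n" "c \<longlonglongrightarrow> 0" and p: "\<And>n. mono (p n)"
    and Ql: "\<And>j. (\<lambda>n. (c n)\<^sup>2 * Q (p n j)) \<longlonglongrightarrow> l j"
    and small: "\<And>j \<delta>. \<delta> > 0 \<Longrightarrow> eventually (\<lambda>n. \<forall>k<p n j. c n * s k \<le> \<delta>) sequentially"
    and G: "depends_lipschitz d L G" and B: "\<And>x. \<bar>G x\<bar> \<le> B"
  shows "(\<lambda>n. expectation (\<lambda>\<omega>. G (\<lambda>j. c n * (S (p n (Suc j)) \<omega> - S (p n j) \<omega>))))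
     \<longlonglongrightarrow> (\<integral>x. G x \<partial>(\<Pi>\<^sub>M j\<in>{..<d}. gauss (\<sigma>2 * (l (Suc j) - l j))))"
  using G B
proof (induction d arbitrary: G)
  case 0
  have const: "G x = G (\<lambda>_. 0)" for x by (rule depends_lipschitz_eq[OF 0(1)]) simp
  interpret P: prob_space "\<Pi>\<^sub>M j\<in>{..<0::nat}. gauss (\<sigma>2 * (l (Suc j) - l j))"
    by (rule prob_space_PiM) (rule prob_space_gauss)
  show ?case by (subst (1 2) const) (simp add: prob_space P.prob_space del: lessThan_0)
next
  case (Suc d)
  define blk where "blk n \<omega> = (\<lambda>j. c n * (S (p n (Suc j)) \<omega> - S (p n j) \<omega>))" for n \<omega>
  define v where "v = \<sigma>2 * (l (Suc d) - l d)"
  define g where "g x = (\<integral>z. G (x(d := z)) \<partial>gauss v)" for x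
  interpret Ga: prob_space "gauss v" by (rule prob_space_gauss)
  have B0: "0 \<le> B" using Suc.prems(2)[of "\<lambda>_. 0"] by linarith
  have lmono: "l d \<le> l (Suc d)"
  proof (rule LIMSEQ_le[OF Ql Ql])
    show "\<exists>N. \<forall>n\<ge>N. (c n)\<^sup>2 * Q (p n d) \<le> (c n)\<^sup>2 * Q (p n (Suc d))"
      using p by (auto intro!: exI[of _ 0] mult_left_mono Q_mono monoD[OF p])
  qed
  have v0: "v \<ge> 0" unfolding v_def using lmono \<sigma>2 by simp
  have Gupd: "(\<lambda>z. G (x(d := z))) \<in> borel_measurable borel" for x
    by (rule depends_lipschitz_measurable_compose[OF Suc.prems(1)]) (auto simp: fun_upd_def)
  have Gint: "integrable (gauss v) (\<lambda>z. G (x(d := z)))" for x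
    by (rule Ga.integrable_const_bound[where B=B]) (use Suc.prems(2) Gupd in \<open>auto cong: measurable_cong_sets\<close>)
  have g: "depends_lipschitz d L g"
    unfolding depends_lipschitz_def
  proof (intro allI)
    fix x y
    have "\<bar>g x - g y\<bar> = \<bar>\<integral>z. G (x(d := z)) - G (y(d := z)) \<partial>gauss v\<bar>"
      unfolding g_def using Gint by simp
    also have "\<dots> \<le> (\<integral>z. L * (\<Sum>j<d. \<bar>x j - y j\<bar>) \<partial>gauss v)"
    proof (rule norm_integral_le[where 'b=real, unfolded real_norm_def])
      fix z
      have "(\<Sum>j<Suc d. \<bar>(x(d := z)) j - (y(d := z)) j\<bar>) = (\<Sum>j<d. \<bar>x j - y j\<bar>)" by simp
      then show "\<bar>G (x(d := z)) - G (y(d := z))\<bar> \<le> L * (\<Sum>j<d. \<bar>x j - y j\<bar>)"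
        using depends_lipschitzD[OF Suc.prems(1), of "x(d := z)" "y(d := z)"] by (simp only:)
    qed (use Gint in auto)
    also have "\<dots> = L * (\<Sum>j<d. \<bar>x j - y j\<bar>)" using Ga.prob_space by simp
    finally show "\<bar>g x - g y\<bar> \<le> L * (\<Sum>j<d. \<bar>x j - y j\<bar>)" .
  qed
  have gB: "\<bar>g x\<bar> \<le> B" for x
  proof -
    have "\<bar>g x\<bar> \<le> (\<integral>z. B \<partial>gauss v)"
      unfolding g_def by (rule norm_integral_le[where 'b=real, unfolded real_norm_def])
        (use Gint Suc.prems(2) in auto)
    then show ?thesis using Ga.prob_space by simp
  qed
  have blkm [measurable]: "(\<lambda>\<omega>. blk n \<omega> j) \<in> borel_measurable M" for n j
    unfolding blk_def by measurable
  have "(\<lambda>n. expectation (\<lambda>\<omega>. G ((blk n \<omega>)(d := blk n \<omega> d))) -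
      expectation (\<lambda>\<omega>. \<integral>z. G ((blk n \<omega>)(d := z)) \<partial>gauss v)) \<longlonglongrightarrow> 0"
  proof -
    obtain C where C: "\<And>n. (c n)\<^sup>2 * Q (p n (Suc d)) \<le> C"
    proof -
      have "Bseq (\<lambda>n. (c n)\<^sup>2 * Q (p n (Suc d)))"
        using Ql by (intro convergent_imp_Bseq) (auto simp: convergent_def)
      then obtain C where "C > 0" "\<And>n. norm ((c n)\<^sup>2 * Q (p n (Suc d))) \<le> C" by (auto simp: Bseq_def)
      then show thesis using that[of C] by (metis abs_le_D1 real_norm_def)
    qed
    have Q0: "0 \<le> Q k" for k by (simp add: Q_def sum_nonneg)
    show ?thesis
    proof (rule weighted_char_imp_gauss[where C=C and B=B and L=L and X="\<lambda>n \<omega>. blk n \<omega> d"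
          and g="\<lambda>n \<omega> w. G ((blk n \<omega>)(d := w))", OF v0])
      show "(\<lambda>(\<omega>, w). G ((blk n \<omega>)(d := w))) \<in> borel_measurable (M \<Otimes>\<^sub>M borel)" for n
      proof -
        have "(\<lambda>x. G ((blk n (fst x))(d := snd x))) \<in> borel_measurable (M \<Otimes>\<^sub>M borel)"
        proof (rule depends_lipschitz_measurable_compose[OF Suc.prems(1)])
          fix j
          show "(\<lambda>x. ((blk n (fst x))(d := snd x)) j) \<in> borel_measurable (M \<Otimes>\<^sub>M borel)"
            by (cases "j = d") (auto intro!: measurable_compose[OF measurable_fst blkm])
        qed
        then show ?thesis by (simp add: case_prod_beta')
      qed
      show "\<bar>G ((blk n \<omega>)(d := w)) - G ((blk n \<omega>)(d := z))\<bar> \<le> L * \<bar>w - z\<bar>" for n \<omega> w z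
      proof -
        have "(\<Sum>j<Suc d. \<bar>((blk n \<omega>)(d := w)) j - ((blk n \<omega>)(d := z)) j\<bar>) = \<bar>w - z\<bar>" by simp
        then show ?thesis
          using depends_lipschitzD[OF Suc.prems(1), of "(blk n \<omega>)(d := w)" "(blk n \<omega>)(d := z)"] by (simp only:)
      qed
      have isq: "integrable M (\<lambda>\<omega>. (blk n \<omega> d)\<^sup>2)" for n
        unfolding blk_def power_mult_distrib using integrable_power[of "p n (Suc d)" "p n d" 2] by simp
      then show "integrable M (\<lambda>\<omega>. (blk n \<omega> d)\<^sup>2)" for n .
      show "expectation (\<lambda>\<omega>. (blk n \<omega> d)\<^sup>2) \<le> C" for n
      proof -
        have "expectation (\<lambda>\<omega>. (blk n \<omega> d)\<^sup>2) = (c n)\<^sup>2 * expectation (\<lambda>\<omega>. (S (p n (Suc d)) \<omega> - S (p n d) \<omega>)\<^sup>2)"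
          unfolding blk_def power_mult_distrib by simp
        also have "\<dots> \<le> (c n)\<^sup>2 * (Q (p n (Suc d)) - Q (p n d))"
          using second_moment[OF monoD[OF p, of d "Suc d" n]] by (intro mult_left_mono) auto
        also have "\<dots> \<le> (c n)\<^sup>2 * Q (p n (Suc d))" using Q0 by (intro mult_left_mono) auto
        finally show ?thesis using C[of n] by linarith
      qed
      fix w \<theta> :: real
      \<comment> \<open>The block estimate wants weights of modulus at most 1; dividing by
        \<open>B + 1\<close> instead of \<open>B\<close> is safe for \<open>B = 0\<close>.\<close>
      define H where "H n \<omega> = G ((blk n \<omega>)(d := w)) / (B + 1)" for n \<omega>
      have Hm: "H n \<in> borel_measurable (F (p n d))" for n
      proof -
        have "(\<lambda>\<omega>. G ((blk n \<omega>)(d := w))) \<in> borel_measurable (F (p n d))"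
        proof (rule depends_lipschitz_measurable_compose[OF Suc.prems(1)])
          fix j assume "j < Suc d"
          then have "j \<noteq> d \<Longrightarrow> (\<lambda>\<omega>. blk n \<omega> j) \<in> borel_measurable (F (p n d))"
            unfolding blk_def
            by (intro borel_measurable_times borel_measurable_diff S_meas monoD[OF p]) auto
          then show "(\<lambda>\<omega>. ((blk n \<omega>)(d := w)) j) \<in> borel_measurable (F (p n d))"
            by (cases "j = d") auto
        qed
        then show ?thesis unfolding H_def by measurable
      qed
      have HB: "\<bar>H n \<omega>\<bar> \<le> 1" for n \<omega>
      proof -
        have "\<bar>G ((blk n \<omega>)(d := w))\<bar> \<le> B" by (rule Suc.prems(2))
        then show ?thesis using B0 by (simp add: H_def)
      qed
      have "(\<lambda>n. (CLINT \<omega>|M. complex_of_real (H n \<omega>) * iexp (\<theta> * (c n * (S (p n (Suc d)) \<omega> - S (p n d) \<omega>))))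
        - complex_of_real (exp (- (\<theta>\<^sup>2 * (\<sigma>2 * (l (Suc d) - l d)) / 2))) * complex_of_real (expectation (H n))) \<longlonglongrightarrow> 0"
        by (rule char_block_tendsto[OF c _ Ql Ql small Hm HB]) (auto intro: monoD[OF p])
      then have "(\<lambda>n. complex_of_real (B + 1) * ((CLINT \<omega>|M. complex_of_real (H n \<omega>) * iexp (\<theta> * blk n \<omega> d))
        - complex_of_real (exp (- (\<theta>\<^sup>2 * v / 2))) * complex_of_real (expectation (H n)))) \<longlonglongrightarrow> 0"
        unfolding blk_def v_def by (rule tendsto_mult_right_zero)
      moreover have "complex_of_real (B + 1) * ((CLINT \<omega>|M. complex_of_real (H n \<omega>) * iexp (\<theta> * blk n \<omega> d))
          - complex_of_real (exp (- (\<theta>\<^sup>2 * v / 2))) * complex_of_real (expectation (H n)))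
        = (CLINT \<omega>|M. complex_of_real (G ((blk n \<omega>)(d := w))) * iexp (\<theta> * blk n \<omega> d))
          - complex_of_real (exp (- (\<theta>\<^sup>2 * v / 2))) * complex_of_real (expectation (\<lambda>\<omega>. G ((blk n \<omega>)(d := w))))" for n
      proof -
        have G': "G ((blk n \<omega>)(d := w)) = (B + 1) * H n \<omega>" for \<omega> using B0 by (simp add: H_def)
        show ?thesis unfolding G' by (simp add: right_diff_distrib mult.assoc mult.left_commute del: of_real_add)
      qed
      ultimately show "(\<lambda>n. (CLINT \<omega>|M. complex_of_real (G ((blk n \<omega>)(d := w))) * iexp (\<theta> * blk n \<omega> d))
          - complex_of_real (exp (- (\<theta>\<^sup>2 * v / 2))) * complex_of_real (expectation (\<lambda>\<omega>. G ((blk n \<omega>)(d := w))))) \<longlonglongrightarrow> 0"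
        by simp
    qed (use Suc.prems(2) blkm in auto)
  qed
  then have 1: "(\<lambda>n. expectation (\<lambda>\<omega>. G (blk n \<omega>)) - expectation (\<lambda>\<omega>. g (blk n \<omega>))) \<longlonglongrightarrow> 0"
    by (simp add: g_def)
  have 2: "(\<lambda>n. expectation (\<lambda>\<omega>. g (blk n \<omega>)))
     \<longlonglongrightarrow> (\<integral>x. g x \<partial>(\<Pi>\<^sub>M j\<in>{..<d}. gauss (\<sigma>2 * (l (Suc j) - l j))))"
    unfolding blk_def by (rule Suc.IH[OF g gB])
  interpret PS: product_sigma_finite "\<lambda>j. gauss (\<sigma>2 * (l (Suc j) - l j))"
    unfolding product_sigma_finite_def using prob_space_gauss prob_space_imp_sigma_finite by blast
  interpret P: prob_space "\<Pi>\<^sub>M j\<in>{..<Suc d}. gauss (\<sigma>2 * (l (Suc j) - l j))"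
    by (rule prob_space_PiM) (rule prob_space_gauss)
  have "integrable (\<Pi>\<^sub>M j\<in>{..<Suc d}. gauss (\<sigma>2 * (l (Suc j) - l j))) G"
  proof (rule P.integrable_const_bound[where B=B])
    show "G \<in> borel_measurable (\<Pi>\<^sub>M j\<in>{..<Suc d}. gauss (\<sigma>2 * (l (Suc j) - l j)))"
    proof (rule depends_lipschitz_measurable_compose[OF Suc.prems(1), where f="\<lambda>x. x"])
      fix j assume "j < Suc d"
      then have "(\<lambda>x. x j) \<in> (\<Pi>\<^sub>M j\<in>{..<Suc d}. gauss (\<sigma>2 * (l (Suc j) - l j))) \<rightarrow>\<^sub>M gauss (\<sigma>2 * (l (Suc j) - l j))"
        by (intro measurable_component_singleton) auto
      then show "(\<lambda>x. x j) \<in> borel_measurable (\<Pi>\<^sub>M j\<in>{..<Suc d}. gauss (\<sigma>2 * (l (Suc j) - l j)))"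
        by (simp cong: measurable_cong_sets)
    qed
  qed (use Suc.prems(2) in auto)
  then have "(\<integral>x. G x \<partial>(\<Pi>\<^sub>M j\<in>{..<Suc d}. gauss (\<sigma>2 * (l (Suc j) - l j))))
      = (\<integral>x. g x \<partial>(\<Pi>\<^sub>M j\<in>{..<d}. gauss (\<sigma>2 * (l (Suc j) - l j))))"
    unfolding g_def v_def lessThan_Suc by (intro PS.product_integral_insert) auto
  then show ?case using tendsto_add[OF 1 2] by (simp add: blk_def)
qed

end

section \<open>Discretised paths and Brownian increments\<close>

lemma density_normal_eq_gauss:
  assumes "v > 0"
  shows "density lborel (normal_density 0 (sqrt v)) = gauss v"
proof -
  interpret N: prob_space std_normal_distribution
    using real_dist_normal_dist real_distribution_def by blast
  have "distributed std_normal_distribution lborel (\<lambda>x. x) std_normal_density"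
    unfolding distributed_def by (auto simp: distr_id2)
  then have "distributed std_normal_distribution lborel (\<lambda>x. 0 + sqrt v * x) (normal_density (0 + sqrt v * 0) (\<bar>sqrt v\<bar> * 1))"
    using assms by (intro N.normal_density_affine) auto
  then have "distr std_normal_distribution lborel (\<lambda>x. sqrt v * x) = density lborel (normal_density 0 (sqrt v))"
    using assms by (simp add: distributed_def)
  then show ?thesis unfolding gauss_def by (simp cong: distr_cong)
qed

text \<open>The entries \<open>x j\<close> are increments, with \<open>x 0\<close> the initial
  value. The path has mesh \<open>1 / r\<close>, and the cap \<open>r * r\<close> on the index
  leaves a function of finitely many increments that still follows them up to time
  \<open>r\<close>.\<close>

definition disc_path :: "nat \<Rightarrow> (nat \<Rightarrow> real) \<Rightarrow> real \<Rightarrow> real" where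
  "disc_path r x = step_path (\<lambda>_. 1) 0 (real r) (\<lambda>i. \<Sum>j\<le>min i (r * r). x j)"

lemma disc_path_cadlag: "disc_path r x \<in> cadlag_paths"
  unfolding disc_path_def by (rule step_path_cadlag) auto

lemma disc_path_dist: "path_dist (disc_path r x) (disc_path r y) \<le> (\<Sum>j<Suc (r * r). \<bar>x j - y j\<bar>)"
proof (rule path_dist_le_uniform)
  fix t :: real
  define i where "i = min (nat \<lfloor>0 + real r * t\<rfloor>) (r * r)"
  have "\<bar>disc_path r x t - disc_path r y t\<bar> = \<bar>\<Sum>j\<le>i. x j - y j\<bar>"
    by (simp add: disc_path_def step_path_def i_def sum_subtractf)
  also have "\<dots> \<le> (\<Sum>j\<le>i. \<bar>x j - y j\<bar>)" by (rule sum_abs)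
  also have "\<dots> \<le> (\<Sum>j<Suc (r * r). \<bar>x j - y j\<bar>)"
    by (intro sum_mono2) (auto simp: i_def)
  finally show "\<bar>disc_path r x t - disc_path r y t\<bar> \<le> (\<Sum>j<Suc (r * r). \<bar>x j - y j\<bar>)" .
qed

lemma disc_path_depends_lipschitz:
  assumes "lipschitz_functional L \<Psi>" "L \<ge> 0"
  shows "depends_lipschitz (Suc (r * r)) L (\<lambda>x. \<Psi> (disc_path r x))"
  unfolding depends_lipschitz_def
proof (intro allI)
  fix x y
  have "\<bar>\<Psi> (disc_path r x) - \<Psi> (disc_path r y)\<bar> \<le> L * path_dist (disc_path r x) (disc_path r y)"
    using assms(1) disc_path_cadlag unfolding lipschitz_functional_def by blast
  also have "\<dots> \<le> L * (\<Sum>j<Suc (r * r). \<bar>x j - y j\<bar>)"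
    by (intro mult_left_mono disc_path_dist assms)
  finally show "\<bar>\<Psi> (disc_path r x) - \<Psi> (disc_path r y)\<bar> \<le> L * (\<Sum>j<Suc (r * r). \<bar>x j - y j\<bar>)" .
qed

lemma sum_telescope_le:
  fixes f :: "nat \<Rightarrow> real"
  shows "(\<Sum>j\<le>i. f (Suc j) - f j) = f (Suc i) - f 0"
  using sum_lessThan_telescope[of f "Suc i"] by (simp add: lessThan_Suc_atMost)

text \<open>The increments telescope to the value of \<open>y\<close> at the grid point to the left
  of \<open>t\<close>, since no previous value is subtracted for \<open>j = 0\<close>. Uniform
  continuity on a compact interval does the rest.\<close>

lemma disc_path_grid_tendsto:
  fixes y :: "real \<Rightarrow> real"
  assumes y: "continuous_on {0..} y"
  shows "(\<lambda>r. path_dist (disc_path (Suc r) (\<lambda>j. y (real j / real (Suc r)) - (if j = 0 then 0 else y (real (j - 1) / real (Suc r))))) y)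
    \<longlonglongrightarrow> 0"
proof (rule path_dist_tendsto_0I)
  fix T e :: real assume T: "T > 0" and e: "e > 0"
  have "uniformly_continuous_on {0..T} y"
    by (intro compact_uniformly_continuous continuous_on_subset[OF y]) auto
  then obtain \<delta> where \<delta>: "\<delta> > 0" "\<And>u t. u \<in> {0..T} \<Longrightarrow> t \<in> {0..T} \<Longrightarrow> dist u t < \<delta> \<Longrightarrow> dist (y u) (y t) < e"
    using e unfolding uniformly_continuous_on_def by metis
  \<comment> \<open>The bound by \<open>T\<close> lets the discretised path reach the time horizon,
    the bound by \<open>1 / \<delta>\<close> makes the mesh small enough.\<close>
  obtain r0 :: nat where r0: "real r0 > max T (1 / \<delta>)" using reals_Archimedean2 by blast
  show "eventually (\<lambda>r. \<forall>t. 0 \<le> t \<longrightarrow> t < T \<longrightarrow>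
      \<bar>disc_path (Suc r) (\<lambda>j. y (real j / real (Suc r)) - (if j = 0 then 0 else y (real (j - 1) / real (Suc r)))) t - y t\<bar> \<le> e) sequentially"
    unfolding eventually_sequentially
  proof (intro exI[of _ r0] allI impI)
    fix r t assume r: "r0 \<le> r" and t: "0 \<le> t" "t < T"
    define i where "i = nat \<lfloor>real (Suc r) * t\<rfloor>"
    have i: "real i \<le> real (Suc r) * t" "real (Suc r) * t < real i + 1"
    proof -
      have "0 \<le> real (Suc r) * t" using t by simp
      then have "real i = of_int \<lfloor>real (Suc r) * t\<rfloor>" unfolding i_def by (intro of_nat_nat) simp
      then show "real i \<le> real (Suc r) * t" "real (Suc r) * t < real i + 1" by linarith+
    qed
    have "real (Suc r) * t \<le> real (Suc r) * real (Suc r)"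
      using r r0 t by (intro mult_left_mono) auto
    then have "i \<le> Suc r * Suc r" using i(1) by (metis of_nat_le_iff of_nat_mult order_trans)
    then have min: "min i (Suc r * Suc r) = i" by simp
    have tel: "(\<Sum>j\<le>k. y (real j / real (Suc r)) - (if j = 0 then 0 else y (real (j - 1) / real (Suc r)))) = y (real k / real (Suc r))" for k
      by (induction k) auto
    have u: "real i / real (Suc r) \<le> t" "t < real i / real (Suc r) + 1 / real (Suc r)"
      using i by (simp_all add: field_simps del: of_nat_Suc)
    have "1 / real (Suc r) < \<delta>"
    proof -
      have "1 / \<delta> < real (Suc r)" using r0 r by auto
      then show ?thesis using \<delta>(1) by (simp add: field_simps del: of_nat_Suc)
    qed
    then have "dist (real i / real (Suc r)) t < \<delta>" using u by (simp add: dist_real_def)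
    then have "dist (y (real i / real (Suc r))) (y t) < e"
      using u t by (intro \<delta>(2)) auto
    moreover have "disc_path (Suc r) (\<lambda>j. y (real j / real (Suc r)) - (if j = 0 then 0 else y (real (j - 1) / real (Suc r)))) t
        = y (real i / real (Suc r))"
      unfolding disc_path_def step_path_def add_0 i_def[symmetric] min tel by simp
    ultimately show "\<bar>disc_path (Suc r) (\<lambda>j. y (real j / real (Suc r)) - (if j = 0 then 0 else y (real (j - 1) / real (Suc r)))) t - y t\<bar> \<le> e"
      by (simp add: dist_real_def)
  qed
qed

text \<open>A continuous path is the limit of its discretisations, and on each of these the
  functional is a measurable function of finitely many values.\<close>

lemma measurable_continuous_path_functional:
  assumes \<Psi>: "loc_unif_continuous \<Psi>"
    and Y: "\<And>\<omega>. \<omega> \<in> space M \<Longrightarrow> continuous_on {0..} (Y \<omega>)"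
    and Ym [measurable]: "\<And>t. t \<ge> 0 \<Longrightarrow> (\<lambda>\<omega>. Y \<omega> t) \<in> borel_measurable M"
  shows "(\<lambda>\<omega>. \<Psi> (Y \<omega>)) \<in> borel_measurable M"
proof -
  define x where "x r \<omega> j = Y \<omega> (real j / real (Suc r)) - (if j = 0 then 0 else Y \<omega> (real (j - 1) / real (Suc r)))"
    for r \<omega> and j :: nat
  show ?thesis
  proof (rule borel_measurable_LIMSEQ_metric)
    show "(\<lambda>\<omega>. \<Psi> (disc_path (Suc r) (x r \<omega>))) \<in> borel_measurable M" for r
      unfolding disc_path_def
    proof (rule measurable_step_path_functional[OF \<Psi>])
      fix i
      have "(\<lambda>\<omega>. x r \<omega> j) \<in> borel_measurable M" for j
        unfolding x_def by (cases "j = 0") auto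
      then show "(\<lambda>\<omega>. \<Sum>j\<le>min i (Suc r * Suc r). x r \<omega> j) \<in> borel_measurable M" by measurable
    qed auto
    show "(\<lambda>r. \<Psi> (disc_path (Suc r) (x r \<omega>))) \<longlonglongrightarrow> \<Psi> (Y \<omega>)" if "\<omega> \<in> space M" for \<omega>
      unfolding x_def
      by (intro loc_unif_continuousD[OF \<Psi>] disc_path_grid_tendsto continuous_imp_cadlag disc_path_cadlag Y that)
  qed
qed

text \<open>Independence makes the joint law of the increments a product. Strict monotonicity of
  \<open>u\<close> is required because \<open>brownian_motion\<close> prescribes the law of
  increments over nondegenerate intervals only.\<close>

lemma brownian_increments_distr:
  fixes u :: "nat \<Rightarrow> real"
  assumes BM: "brownian_motion M' W" and u: "strict_mono u" "u 0 = 0"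
    and G: "depends_lipschitz (Suc d) L G"
  shows "(\<integral>\<omega>. G (\<lambda>j. W (u (Suc j)) \<omega> - W (u j) \<omega>) \<partial>M') = (\<integral>x. G x \<partial>(\<Pi>\<^sub>M j\<in>{..<Suc d}. gauss (u (Suc j) - u j)))"
proof -
  interpret prob_space M' using BM by (simp add: brownian_motion_def)
  have u0: "0 \<le> u j" for j using u strict_mono_less_eq[OF u(1), of 0 j] by simp
  have Wm [measurable]: "W (u j) \<in> borel_measurable M'" for j
    using BM u0 by (simp add: brownian_motion_def)
  define \<Delta> where "\<Delta> j \<omega> = W (u (Suc j)) \<omega> - W (u j) \<omega>" for j \<omega>
  have \<Delta>m [measurable]: "\<Delta> j \<in> borel_measurable M'" for j
    unfolding \<Delta>_def[abs_def] by measurable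
  define ts where "ts = map u [0..<Suc (Suc d)]"
  have nth: "ts ! k = u k" if "k < Suc (Suc d)" for k using that unfolding ts_def by (simp del: upt_Suc)
  have len: "length ts = Suc (Suc d)" by (simp add: ts_def)
  have ts: "sorted_wrt (<) ts" "\<forall>t\<in>set ts. 0 \<le> t" "length ts - 1 = Suc d"
    using u0 strict_monoD[OF u(1)] len nth by (auto simp: sorted_wrt_iff_nth_less in_set_conv_nth)
  have "indep_vars (\<lambda>_. borel) (\<lambda>k \<omega>. W (ts ! Suc k) \<omega> - W (ts ! k) \<omega>) {..<length ts - 1}"
    using BM ts(1,2) unfolding brownian_motion_def by blast
  also have "?this \<longleftrightarrow> indep_vars (\<lambda>_. borel) \<Delta> {..<Suc d}"
    unfolding ts(3) by (rule indep_vars_cong) (auto simp: nth \<Delta>_def)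
  finally have "distr M' (\<Pi>\<^sub>M i\<in>{..<Suc d}. borel) (\<lambda>\<omega>. \<lambda>i\<in>{..<Suc d}. \<Delta> i \<omega>)
      = (\<Pi>\<^sub>M i\<in>{..<Suc d}. distr M' borel (\<Delta> i))"
    by (subst (asm) indep_vars_iff_distr_eq_PiM) auto
  also have "\<dots> = (\<Pi>\<^sub>M j\<in>{..<Suc d}. gauss (u (Suc j) - u j))"
  proof (intro PiM_cong refl)
    fix j
    have lt: "u j < u (Suc j)" using u(1) by (simp add: strict_mono_Suc_iff)
    have "distributed M' lborel (\<Delta> j) (normal_density 0 (sqrt (u (Suc j) - u j)))"
      using BM u0[of j] lt unfolding brownian_motion_def \<Delta>_def by blast
    then have "distr M' lborel (\<Delta> j) = density lborel (normal_density 0 (sqrt (u (Suc j) - u j)))"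
      by (simp add: distributed_def)
    then have "distr M' lborel (\<Delta> j) = gauss (u (Suc j) - u j)"
      using density_normal_eq_gauss lt by simp
    then show "distr M' borel (\<Delta> j) = gauss (u (Suc j) - u j)" by (simp cong: distr_cong)
  qed
  finally have D: "(\<Pi>\<^sub>M j\<in>{..<Suc d}. gauss (u (Suc j) - u j)) =
      distr M' (\<Pi>\<^sub>M i\<in>{..<Suc d}. borel) (\<lambda>\<omega>. \<lambda>i\<in>{..<Suc d}. \<Delta> i \<omega>)" ..
  have "(\<integral>x. G x \<partial>(\<Pi>\<^sub>M j\<in>{..<Suc d}. gauss (u (Suc j) - u j))) = (\<integral>\<omega>. G (\<lambda>i\<in>{..<Suc d}. \<Delta> i \<omega>) \<partial>M')"
    unfolding D
  proof (rule integral_distr)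
    show "(\<lambda>\<omega>. \<lambda>i\<in>{..<Suc d}. \<Delta> i \<omega>) \<in> M' \<rightarrow>\<^sub>M (\<Pi>\<^sub>M i\<in>{..<Suc d}. borel)"
      by measurable
    show "G \<in> borel_measurable (\<Pi>\<^sub>M i\<in>{..<Suc d}. borel)"
      by (rule depends_lipschitz_measurable_compose[OF G, where f="\<lambda>x. x"])
        (auto intro!: measurable_component_singleton)
  qed
  also have "\<dots> = (\<integral>\<omega>. G (\<lambda>j. \<Delta> j \<omega>) \<partial>M')"
    by (intro Bochner_Integration.integral_cong refl depends_lipschitz_eq[OF G]) auto
  finally show ?thesis by (simp add: \<Delta>_def)
qed

section \<open>The functional limit theorem for scaled martingales\<close>

context bounded_martingale
begin

text \<open>For \<open>c > 0\<close> the event is an exceedance of the level \<open>e / c\<close>,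
  and the bound is homogeneous. For \<open>c = 0\<close> it is empty.\<close>

lemma scaled_maximal_inequality:
  assumes "a \<le> b" "e > 0" "c \<ge> 0"
  shows "{\<omega>\<in>space M. \<exists>k\<in>{a..b}. e \<le> c * \<bar>S k \<omega> - S a \<omega>\<bar>} \<in> sets M" (is "?E \<in> _")
    and "prob {\<omega>\<in>space M. \<exists>k\<in>{a..b}. e \<le> c * \<bar>S k \<omega> - S a \<omega>\<bar>} \<le> 4 / e ^ 4 * (c\<^sup>2 * Q b - c\<^sup>2 * Q a)\<^sup>2"
proof -
  show "?E \<in> sets M" by (intro sets.sets_Collect_finite_Ex) measurable
  show "prob ?E \<le> 4 / e ^ 4 * (c\<^sup>2 * Q b - c\<^sup>2 * Q a)\<^sup>2"
  proof (cases "c = 0")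
    case True
    then have "?E = {}" using assms by auto
    then show ?thesis by (simp only: measure_empty) simp
  next
    case False
    then have c: "c > 0" using assms by simp
    have "?E = exceeds (e / c) a b" using c by (auto simp: exceeds_def field_simps)
    moreover have "(e / c) ^ 4 * prob (exceeds (e / c) a b) \<le> 4 * (Q b - Q a)\<^sup>2"
      using assms c by (intro maximal_inequality) auto
    ultimately have "e ^ 4 * prob ?E \<le> 4 * (c ^ 4 * (Q b - Q a)\<^sup>2)"
      using c by (simp add: power_divide field_simps)
    also have "c ^ 4 * (Q b - Q a)\<^sup>2 = (c\<^sup>2 * Q b - c\<^sup>2 * Q a)\<^sup>2"
      by (simp add: power2_eq_square power4_eq_xxxx algebra_simps)
    finally show ?thesis using assms(2) by (simp add: field_simps)
  qed
qed

end

text \<open>At rescaled time \<open>t\<close> the martingale has made \<open>m n t\<close> steps. As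
  \<open>m n 0\<close> may be positive, \<open>l 0\<close> may be too. The error in
  \<open>X_close\<close> is relative, because \<open>X\<close> arises from an unbounded martingale
  by a factor close to 1.\<close>

locale scaled_martingale = bounded_martingale M F \<zeta> s \<kappa> \<sigma>2
  for M :: "'a measure" and F \<zeta> s \<kappa> \<sigma>2 +
  fixes c :: "nat \<Rightarrow> real" and m :: "nat \<Rightarrow> real \<Rightarrow> nat" and l :: "real \<Rightarrow> real"
    and X :: "nat \<Rightarrow> 'a \<Rightarrow> real \<Rightarrow> real"
  assumes c: "\<And>n. 0 \<le> c n" "c \<longlonglongrightarrow> 0"
    and m_mono: "\<And>n u t. 0 \<le> u \<Longrightarrow> u \<le> t \<Longrightarrow> m n u \<le> m n t"
    and Q_lim: "\<And>t. t \<ge> 0 \<Longrightarrow> (\<lambda>n. (c n)\<^sup>2 * Q (m n t)) \<longlonglongrightarrow> l t"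
    and small: "\<And>t \<delta>. t \<ge> 0 \<Longrightarrow> \<delta> > 0 \<Longrightarrow> eventually (\<lambda>n. \<forall>k<m n t. c n * s k \<le> \<delta>) sequentially"
    and X_cadlag: "\<And>n \<omega>. \<omega> \<in> space M \<Longrightarrow> X n \<omega> \<in> cadlag_paths"
    and X_meas: "\<And>n \<Psi>. loc_unif_continuous \<Psi> \<Longrightarrow> (\<lambda>\<omega>. \<Psi> (X n \<omega>)) \<in> borel_measurable M"
    and X_close: "\<And>T e. T > 0 \<Longrightarrow> e > 0 \<Longrightarrow> eventually (\<lambda>n. \<forall>\<omega>\<in>space M. \<forall>t\<in>{0..T}.
          \<bar>X n \<omega> t - c n * S (m n t) \<omega>\<bar> \<le> e * (1 + \<bar>c n * S (m n t) \<omega>\<bar>)) sequentially"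
begin

text \<open>The shift by one makes block 0 the whole history up to \<open>m n 0\<close>; block
  \<open>j \<ge> 1\<close> is the cell from \<open>(j - 1) / r\<close> to
  \<open>j / r\<close>.\<close>

definition grid :: "nat \<Rightarrow> nat \<Rightarrow> nat \<Rightarrow> nat" where
  "grid r n j = (if j = 0 then 0 else m n (real (j - 1) / real r))"

definition grid_path :: "nat \<Rightarrow> nat \<Rightarrow> 'a \<Rightarrow> real \<Rightarrow> real" where
  "grid_path r n \<omega> = disc_path r (\<lambda>j. c n * (S (grid r n (Suc j)) \<omega> - S (grid r n j) \<omega>))"

lemma grid_mono: "mono (grid r n)"
  unfolding grid_def by (rule monoI) (auto intro!: m_mono divide_right_mono)

lemma grid_path_eq:
  assumes "r > 0" "0 \<le> t" "t < real r"
  shows "grid_path r n \<omega> t = c n * S (m n (real (nat \<lfloor>real r * t\<rfloor>) / real r)) \<omega>"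
proof -
  define i where "i = nat \<lfloor>real r * t\<rfloor>"
  have "real i = of_int \<lfloor>real r * t\<rfloor>" unfolding i_def using assms by (intro of_nat_nat) simp
  then have "real i \<le> real r * t" by linarith
  also have "\<dots> \<le> real r * real r" using assms by (intro mult_left_mono) auto
  finally have "i \<le> r * r" by (metis of_nat_le_iff of_nat_mult)
  then have min: "min i (r * r) = i" by simp
  have "(\<Sum>j\<le>i. c n * (S (grid r n (Suc j)) \<omega> - S (grid r n j) \<omega>)) = c n * (S (grid r n (Suc i)) \<omega> - S (grid r n 0) \<omega>)"
    using sum_telescope_le[of "\<lambda>j. S (grid r n j) \<omega>" i] by (simp add: sum_distrib_left[symmetric])
  then show ?thesis
    unfolding grid_path_def disc_path_def step_path_def add_0 i_def[symmetric] min
    by (simp add: grid_def S_def)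
qed

text \<open>Off the event \<open>bad\<close> the scaled martingale moves by less than \<epsilon> in
  every cell and stays below \<open>A\<close> up to time \<open>T\<close>. Fourth moments matter
  here: each cell contributes the square of a clock increment, so the sum over the cells can be made
  small by refining the grid.\<close>

lemma grid_approximation:
  assumes \<Psi>: "lipschitz_functional L \<Psi>" "L \<ge> 0" "\<forall>f\<in>cadlag_paths. \<bar>\<Psi> f\<bar> \<le> B"
    and T: "T > 0" "T \<le> r" and \<epsilon>: "\<epsilon> > 0" and A: "A > 0"
  shows "eventually (\<lambda>n. \<bar>expectation (\<lambda>\<omega>. \<Psi> (X n \<omega>)) - expectation (\<lambda>\<omega>. \<Psi> (grid_path r n \<omega>))\<bar> \<le>
      L * (2 * \<epsilon> + 1 / (1 + real T)) + 2 * B * (4 / A ^ 4 * (l (real T))\<^sup>2 +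
        (\<Sum>j<r * T. 4 / \<epsilon> ^ 4 * (l (real (Suc j) / real r) - l (real j / real r))\<^sup>2) + \<epsilon>)) sequentially"
proof -
  have r: "r > 0" using T by simp
  have B0: "0 \<le> B" using \<Psi>(3) zero_cadlag by force
  define E0 where "E0 n = {\<omega>\<in>space M. \<exists>k\<in>{0..m n (real T)}. A \<le> c n * \<bar>S k \<omega> - S 0 \<omega>\<bar>}" for n
  define E where "E n j = {\<omega>\<in>space M. \<exists>k\<in>{m n (real j / real r)..m n (real (Suc j) / real r)}.
      \<epsilon> \<le> c n * \<bar>S k \<omega> - S (m n (real j / real r)) \<omega>\<bar>}" for n j
  define bad where "bad n = E0 n \<union> (\<Union>j<r * T. E n j)" for n
  define p where "p n = 4 / A ^ 4 * ((c n)\<^sup>2 * Q (m n (real T)))\<^sup>2 + (\<Sum>j<r * T. 4 / \<epsilon> ^ 4 *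
      ((c n)\<^sup>2 * Q (m n (real (Suc j) / real r)) - (c n)\<^sup>2 * Q (m n (real j / real r)))\<^sup>2)" for n
  define P where "P = 4 / A ^ 4 * (l (real T))\<^sup>2 +
        (\<Sum>j<r * T. 4 / \<epsilon> ^ 4 * (l (real (Suc j) / real r) - l (real j / real r))\<^sup>2)"
  have mj: "m n (real j / real r) \<le> m n (real (Suc j) / real r)" for n j
    by (intro m_mono divide_right_mono) auto
  have E0m [measurable]: "E0 n \<in> sets M" for n
    unfolding E0_def by (rule scaled_maximal_inequality) (use A c in auto)
  have Em [measurable]: "E n j \<in> sets M" for n j
    unfolding E_def by (rule scaled_maximal_inequality) (use \<epsilon> c mj in auto)
  have badm [measurable]: "bad n \<in> sets M" for n unfolding bad_def by measurable
  have bad_le: "prob (bad n) \<le> p n" for n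
  proof -
    have "prob (bad n) \<le> prob (E0 n) + prob (\<Union>j<r * T. E n j)"
      unfolding bad_def by (rule measure_Un_le) auto
    also have "prob (\<Union>j<r * T. E n j) \<le> (\<Sum>j<r * T. prob (E n j))"
      by (rule measure_UNION_le) auto
    also have "prob (E0 n) \<le> 4 / A ^ 4 * ((c n)\<^sup>2 * Q (m n (real T)))\<^sup>2"
      using scaled_maximal_inequality(2)[of 0 "m n (real T)" A "c n"] A c
      unfolding E0_def by (simp add: Q_def)
    also have "(\<Sum>j<r * T. prob (E n j)) \<le> (\<Sum>j<r * T. 4 / \<epsilon> ^ 4 *
      ((c n)\<^sup>2 * Q (m n (real (Suc j) / real r)) - (c n)\<^sup>2 * Q (m n (real j / real r)))\<^sup>2)"
      unfolding E_def by (intro sum_mono scaled_maximal_inequality(2) mj \<epsilon> c)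
    finally show ?thesis by (simp add: p_def)
  qed
  have "p \<longlonglongrightarrow> P" unfolding p_def P_def by (intro tendsto_intros Q_lim) auto
  then have "eventually (\<lambda>n. p n < P + \<epsilon>) sequentially" using \<epsilon> by (intro order_tendstoD(2)) auto
  \<comment> \<open>As the martingale stays below \<open>A\<close> off the event \<open>bad\<close>,
    a relative error of \<open>\<epsilon> / (1 + A)\<close> becomes an absolute error of at most
    \<epsilon>.\<close>
  moreover have "eventually (\<lambda>n. \<forall>\<omega>\<in>space M. \<forall>t\<in>{0..real T}.
          \<bar>X n \<omega> t - c n * S (m n t) \<omega>\<bar> \<le> \<epsilon> / (1 + A) * (1 + \<bar>c n * S (m n t) \<omega>\<bar>)) sequentially"
    using T \<epsilon> A by (intro X_close) auto
  ultimately show ?thesis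
  proof eventually_elim
    case (elim n)
    have gp: "grid_path r n \<omega> \<in> cadlag_paths" for \<omega> unfolding grid_path_def by (rule disc_path_cadlag)
    have good: "\<bar>\<Psi> (X n \<omega>) - \<Psi> (grid_path r n \<omega>)\<bar> \<le> L * (2 * \<epsilon> + 1 / (1 + real T))"
      if \<omega>: "\<omega> \<in> space M" "\<omega> \<notin> bad n" for \<omega>
    proof -
      have "path_dist (X n \<omega>) (grid_path r n \<omega>) \<le> 2 * \<epsilon> + 1 / (1 + real T)"
      proof (rule path_dist_le_compact)
        fix t assume t: "0 \<le> t" "t < real T"
        define j where "j = nat \<lfloor>real r * t\<rfloor>"
        have "real j = of_int \<lfloor>real r * t\<rfloor>" unfolding j_def using t by (intro of_nat_nat) simp
        then have j: "real j \<le> real r * t" "real r * t < real (Suc j)" by linarith+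
        have "real r * t < real r * real T" using t r by simp
        then have jT: "j < r * T" using j(1) by (metis le_less_trans of_nat_less_iff of_nat_mult)
        have tj: "real j / real r \<le> t" "t \<le> real (Suc j) / real r"
          using j r by (simp_all add: field_simps del: of_nat_Suc)
        have "m n t \<in> {m n (real j / real r)..m n (real (Suc j) / real r)}"
          using tj t by (auto intro!: m_mono)
        then have "c n * \<bar>S (m n t) \<omega> - S (m n (real j / real r)) \<omega>\<bar> < \<epsilon>"
          using \<omega> jT unfolding bad_def E_def by force
        then have 1: "\<bar>c n * S (m n t) \<omega> - c n * S (m n (real j / real r)) \<omega>\<bar> < \<epsilon>"
          using c(1)[of n] by (simp add: right_diff_distrib[symmetric] abs_mult)
        have "m n t \<in> {0..m n (real T)}" using t by (auto intro!: m_mono)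
        then have "c n * \<bar>S (m n t) \<omega> - S 0 \<omega>\<bar> < A"
          using \<omega> unfolding bad_def E0_def by force
        then have "\<bar>c n * S (m n t) \<omega>\<bar> \<le> A" using c(1)[of n] by (simp add: S_def abs_mult)
        then have "\<epsilon> / (1 + A) * (1 + \<bar>c n * S (m n t) \<omega>\<bar>) \<le> \<epsilon> / (1 + A) * (1 + A)"
          using \<epsilon> A by (intro mult_left_mono) auto
        also have "\<dots> = \<epsilon>" using A by simp
        finally have 2: "\<bar>X n \<omega> t - c n * S (m n t) \<omega>\<bar> \<le> \<epsilon>"
          using elim(2) \<omega>(1) t by (meson atLeastAtMost_iff less_imp_le order_trans)
        have "grid_path r n \<omega> t = c n * S (m n (real j / real r)) \<omega>"
          unfolding j_def using r t T by (intro grid_path_eq) auto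
        then show "\<bar>X n \<omega> t - grid_path r n \<omega> t\<bar> \<le> 2 * \<epsilon>" using 1 2 by linarith
      qed (use \<epsilon> T in auto)
      then have "L * path_dist (X n \<omega>) (grid_path r n \<omega>) \<le> L * (2 * \<epsilon> + 1 / (1 + real T))"
        using \<Psi>(2) by (intro mult_left_mono)
      moreover have "\<bar>\<Psi> (X n \<omega>) - \<Psi> (grid_path r n \<omega>)\<bar> \<le> L * path_dist (X n \<omega>) (grid_path r n \<omega>)"
        using \<Psi>(1) X_cadlag[OF \<omega>(1)] gp unfolding lipschitz_functional_def by blast
      ultimately show ?thesis by linarith
    qed
    have all: "\<bar>\<Psi> (X n \<omega>) - \<Psi> (grid_path r n \<omega>)\<bar> \<le> L * (2 * \<epsilon> + 1 / (1 + real T)) + 2 * B * indicator (bad n) \<omega>"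
      if \<omega>: "\<omega> \<in> space M" for \<omega>
    proof (cases "\<omega> \<in> bad n")
      case True
      have "\<bar>\<Psi> (X n \<omega>)\<bar> \<le> B" "\<bar>\<Psi> (grid_path r n \<omega>)\<bar> \<le> B"
        using \<Psi>(3) X_cadlag[OF \<omega>] gp by blast+
      moreover have "0 \<le> L * (2 * \<epsilon> + 1 / (1 + real T))" using \<Psi>(2) \<epsilon> by (intro mult_nonneg_nonneg) auto
      ultimately show ?thesis using True by (simp add: indicator_def)
    qed (use good[OF \<omega>] in simp)
    have lc: "loc_unif_continuous \<Psi>" by (rule lipschitz_functional_imp_continuous[OF \<Psi>(1)])
    have i1: "integrable M (\<lambda>\<omega>. \<Psi> (X n \<omega>))"
      by (rule integrable_bounded[OF X_meas[OF lc], where B=B]) (use \<Psi>(3) X_cadlag in auto)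
    have gm: "(\<lambda>\<omega>. \<Psi> (grid_path r n \<omega>)) \<in> borel_measurable M"
      unfolding grid_path_def by (rule depends_lipschitz_measurable_compose[OF disc_path_depends_lipschitz[OF \<Psi>(1,2)]]) measurable
    have i2: "integrable M (\<lambda>\<omega>. \<Psi> (grid_path r n \<omega>))"
      by (rule integrable_bounded[OF gm, where B=B]) (use \<Psi>(3) gp in auto)
    have "\<bar>expectation (\<lambda>\<omega>. \<Psi> (X n \<omega>)) - expectation (\<lambda>\<omega>. \<Psi> (grid_path r n \<omega>))\<bar>
        = \<bar>expectation (\<lambda>\<omega>. \<Psi> (X n \<omega>) - \<Psi> (grid_path r n \<omega>))\<bar>" using i1 i2 by simp
    also have "\<dots> \<le> expectation (\<lambda>\<omega>. L * (2 * \<epsilon> + 1 / (1 + real T)) + 2 * B * indicator (bad n) \<omega>)"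
      by (rule norm_integral_le[where 'b=real, unfolded real_norm_def])
        (use i1 i2 all in \<open>auto simp: emeasure_eq_measure\<close>)
    also have "\<dots> = L * (2 * \<epsilon> + 1 / (1 + real T)) + 2 * B * prob (bad n)"
      by (simp add: emeasure_eq_measure prob_space)
    also have "\<dots> \<le> L * (2 * \<epsilon> + 1 / (1 + real T)) + 2 * B * (P + \<epsilon>)"
      using bad_le[of n] elim(1) B0 by (intro add_left_mono mult_left_mono) auto
    finally show ?case unfolding P_def .
  qed
qed

text \<open>Three errors are compared: process to grid path, grid path to Brownian grid path, and
  Brownian grid path to time-changed Brownian motion. The horizon \<open>T\<close>, the bound
  \<open>A\<close> and the mesh are fixed in this order before \<open>n\<close> grows.\<close>

theorem functional_clt_lipschitz:
  assumes BM: "brownian_motion M' W" and \<sigma>2_pos: "\<sigma>2 > 0"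
    and l_cont: "continuous_on {0..} l" and l_mono: "strict_mono_on {0..} l" and l0: "l 0 > 0"
    and \<Psi>: "lipschitz_functional L \<Psi>" "L \<ge> 0" "\<forall>f\<in>cadlag_paths. \<bar>\<Psi> f\<bar> \<le> B"
  shows "(\<lambda>n. expectation (\<lambda>\<omega>. \<Psi> (X n \<omega>))) \<longlonglongrightarrow> (\<integral>\<omega>. \<Psi> (\<lambda>t. W (\<sigma>2 * l t) \<omega>) \<partial>M')"
proof -
  interpret M': prob_space M' using BM by (simp add: brownian_motion_def)
  have l_mono': "l u \<le> l t" if "0 \<le> u" "u \<le> t" for u t
    using that l_mono by (cases "u = t") (auto simp: strict_mono_on_def less_imp_le)
  have l_pos: "l t > 0" if "t \<ge> 0" for t using l_mono'[of 0 t] l0 that by linarith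
  define Y where "Y \<omega> t = W (\<sigma>2 * l t) \<omega>" for \<omega> t
  have Yc: "continuous_on {0..} (Y \<omega>)" if "\<omega> \<in> space M'" for \<omega>
    unfolding Y_def
  proof (rule continuous_on_compose2[of "{0..}" "\<lambda>t. W t \<omega>" "{0..}" "\<lambda>t. \<sigma>2 * l t"])
    show "continuous_on {0..} (\<lambda>t. W t \<omega>)" using BM that by (simp add: brownian_motion_def)
    show "continuous_on {0..} (\<lambda>t. \<sigma>2 * l t)" by (intro continuous_intros l_cont)
    show "(\<lambda>t. \<sigma>2 * l t) ` {0..} \<subseteq> {0..}" using l_pos \<sigma>2_pos by (auto intro!: mult_nonneg_nonneg simp: less_imp_le)
  qed
  have Wm: "W t \<in> borel_measurable M'" if "t \<ge> 0" for t using BM that by (simp add: brownian_motion_def)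
  have Ym: "(\<lambda>\<omega>. Y \<omega> t) \<in> borel_measurable M'" if "t \<ge> 0" for t
    unfolding Y_def using l_pos[OF that] \<sigma>2_pos by (intro Wm) auto
  have lc: "loc_unif_continuous \<Psi>" by (rule lipschitz_functional_imp_continuous[OF \<Psi>(1)])
  have W0: "W 0 \<omega> = 0" if "\<omega> \<in> space M'" for \<omega> using BM that by (simp add: brownian_motion_def)
  define y where "y r \<omega> j = Y \<omega> (real j / real (Suc r)) - (if j = 0 then 0 else Y \<omega> (real (j - 1) / real (Suc r)))"
    for r \<omega> and j :: nat
  have grid_lim: "(\<lambda>n. expectation (\<lambda>\<omega>. \<Psi> (grid_path (Suc r) n \<omega>))) \<longlonglongrightarrow> (\<integral>\<omega>. \<Psi> (disc_path (Suc r) (y r \<omega>)) \<partial>M')" for r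
  proof -
    \<comment> \<open>The limit clock at the shifted grid times. Starting at 0, it makes the first
      block a Brownian increment from \<open>W 0 = 0\<close>.\<close>
    define l' where "l' j = (if j = 0 then 0 else l (real (j - 1) / real (Suc r)))" for j :: nat
    have G: "depends_lipschitz (Suc (Suc r * Suc r)) L (\<lambda>x. \<Psi> (disc_path (Suc r) x))"
      by (rule disc_path_depends_lipschitz[OF \<Psi>(1,2)])
    have l'_step: "l' j < l' (Suc j)" for j
    proof (cases j)
      case 0
      then show ?thesis using l0 by (simp add: l'_def)
    next
      case (Suc i)
      have "real i / real (Suc r) < real (Suc i) / real (Suc r)" by (intro divide_strict_right_mono) auto
      then show ?thesis using l_mono Suc by (auto simp: l'_def strict_mono_on_def)
    qed
    have "(\<lambda>n. expectation (\<lambda>\<omega>. \<Psi> (disc_path (Suc r) (\<lambda>j. c n * (S (grid (Suc r) n (Suc j)) \<omega> - S (grid (Suc r) n j) \<omega>)))))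
       \<longlonglongrightarrow> (\<integral>x. \<Psi> (disc_path (Suc r) x) \<partial>(\<Pi>\<^sub>M j\<in>{..<Suc (Suc r * Suc r)}. gauss (\<sigma>2 * (l' (Suc j) - l' j))))"
    proof (rule finite_dimensional_clt[OF c grid_mono _ _ G])
      show "(\<lambda>n. (c n)\<^sup>2 * Q (grid (Suc r) n j)) \<longlonglongrightarrow> l' j" for j
        by (cases j) (auto simp: grid_def l'_def Q_def[of 0] intro!: Q_lim)
      show "eventually (\<lambda>n. \<forall>k<grid (Suc r) n j. c n * s k \<le> \<delta>) sequentially" if "\<delta> > 0" for j \<delta>
        using small[OF _ that, of "real (j - 1) / real (Suc r)"] by (cases j) (auto simp: grid_def)
      show "\<bar>\<Psi> (disc_path (Suc r) x)\<bar> \<le> B" for x using \<Psi>(3) disc_path_cadlag by blast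
    qed
    also have "(\<integral>x. \<Psi> (disc_path (Suc r) x) \<partial>(\<Pi>\<^sub>M j\<in>{..<Suc (Suc r * Suc r)}. gauss (\<sigma>2 * (l' (Suc j) - l' j))))
        = (\<integral>\<omega>. \<Psi> (disc_path (Suc r) (\<lambda>j. W (\<sigma>2 * l' (Suc j)) \<omega> - W (\<sigma>2 * l' j) \<omega>)) \<partial>M')"
    proof -
      have "strict_mono (\<lambda>j. \<sigma>2 * l' j)" using l'_step \<sigma>2_pos by (simp add: strict_mono_Suc_iff)
      moreover have "\<sigma>2 * l' 0 = 0" by (simp add: l'_def)
      ultimately show ?thesis
        using brownian_increments_distr[OF BM _ _ G, of "\<lambda>j. \<sigma>2 * l' j"] by (simp add: right_diff_distrib)
    qed
    also have "\<dots> = (\<integral>\<omega>. \<Psi> (disc_path (Suc r) (y r \<omega>)) \<partial>M')"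
    proof (intro Bochner_Integration.integral_cong refl)
      fix \<omega> assume \<omega>: "\<omega> \<in> space M'"
      have "(\<lambda>j. W (\<sigma>2 * l' (Suc j)) \<omega> - W (\<sigma>2 * l' j) \<omega>) = y r \<omega>"
        using W0[OF \<omega>] by (auto simp: y_def Y_def l'_def)
      then show "\<Psi> (disc_path (Suc r) (\<lambda>j. W (\<sigma>2 * l' (Suc j)) \<omega> - W (\<sigma>2 * l' j) \<omega>)) = \<Psi> (disc_path (Suc r) (y r \<omega>))"
        by simp
    qed
    finally show ?thesis by (simp add: grid_path_def)
  qed
  have Ylim: "(\<lambda>r. \<integral>\<omega>. \<Psi> (disc_path (Suc r) (y r \<omega>)) \<partial>M') \<longlonglongrightarrow> (\<integral>\<omega>. \<Psi> (Y \<omega>) \<partial>M')"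
  proof (rule integral_dominated_convergence[where w="\<lambda>_. B"])
    show "(\<lambda>\<omega>. \<Psi> (Y \<omega>)) \<in> borel_measurable M'"
      by (rule measurable_continuous_path_functional[OF lc Yc Ym])
    show "(\<lambda>\<omega>. \<Psi> (disc_path (Suc r) (y r \<omega>))) \<in> borel_measurable M'" for r
    proof (rule depends_lipschitz_measurable_compose[OF disc_path_depends_lipschitz[OF \<Psi>(1,2)]])
      fix j show "(\<lambda>\<omega>. y r \<omega> j) \<in> borel_measurable M'"
        unfolding y_def by (cases "j = 0") (auto intro!: borel_measurable_diff Ym)
    qed
    show "AE \<omega> in M'. (\<lambda>r. \<Psi> (disc_path (Suc r) (y r \<omega>))) \<longlonglongrightarrow> \<Psi> (Y \<omega>)"
      unfolding y_def
      by (intro AE_I2 loc_unif_continuousD[OF lc] disc_path_grid_tendsto continuous_imp_cadlag disc_path_cadlag Yc)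
    show "AE \<omega> in M'. norm (\<Psi> (disc_path (Suc r) (y r \<omega>))) \<le> B" for r
      using \<Psi>(3) disc_path_cadlag by auto
  qed simp
  have B0: "0 \<le> B" using \<Psi>(3) zero_cadlag by force
  show ?thesis
  proof (rule LIMSEQ_I)
    fix e :: real assume e: "e > 0"
    \<comment> \<open>The error budget, in sixteenths of \<open>e\<close>: at most 3 from path
      distances, 6 from exceptional events, 2 from the grid limit and 4 from discretising the limit,
      hence less than \<open>e\<close> in total.\<close>
    define K where "K = 16 * (L + B + 1)"
    have K: "K > 0" "L \<le> K / 16" "B \<le> K / 16" using \<Psi>(2) B0 by (auto simp: K_def)
    define \<epsilon> where "\<epsilon> = e / K"
    have \<epsilon>: "\<epsilon> > 0" using e K by (simp add: \<epsilon>_def)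
    obtain T :: nat where T: "real T > 1 / \<epsilon>" using reals_Archimedean2 by blast
    have "1 / \<epsilon> > 0" using \<epsilon> by simp
    then have T0: "T > 0" using T by (metis less_trans of_nat_0_less_iff)
    have T\<epsilon>: "1 / (1 + real T) \<le> \<epsilon>"
    proof -
      have "1 < \<epsilon> * real T" using T \<epsilon> by (simp add: field_simps)
      then have "1 \<le> \<epsilon> * (1 + real T)" using \<epsilon> by (simp add: algebra_simps)
      then show ?thesis by (simp add: field_simps)
    qed
    \<comment> \<open>Since \<open>A \<ge> 1\<close>, also \<open>A ^ 4 \<ge> A\<close>, which
      brings the probability bound for leaving \<open>[-A, A]\<close> below \<epsilon>.\<close>
    define A where "A = (4 * (l (real T))\<^sup>2 / \<epsilon>) + 1"
    have A: "A \<ge> 1" "4 / A ^ 4 * (l (real T))\<^sup>2 \<le> \<epsilon>"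
    proof -
      show A1: "A \<ge> 1" unfolding A_def using \<epsilon> by simp
      have "4 * (l (real T))\<^sup>2 / \<epsilon> \<le> A" by (simp add: A_def)
      also have "\<dots> \<le> A ^ 4" using self_le_power[OF A1, of 4] by simp
      finally show "4 / A ^ 4 * (l (real T))\<^sup>2 \<le> \<epsilon>" using A1 \<epsilon> by (simp add: field_simps)
    qed
    \<comment> \<open>One factor of each squared clock increment is bounded by \<delta>, and the
      other telescopes to at most \<open>l (real T)\<close>. This value makes the product
      \<open>4 / \<epsilon> ^ 4 * (\<delta> * l (real T))\<close> equal to \<epsilon>.\<close>
    define \<delta> where "\<delta> = \<epsilon> ^ 5 / (4 * l (real T))"
    have lT: "l (real T) > 0" by (rule l_pos) simp
    have \<delta>: "\<delta> > 0" unfolding \<delta>_def using \<epsilon> lT by simp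
    have "uniformly_continuous_on {0..real T} l"
      by (intro compact_uniformly_continuous continuous_on_subset[OF l_cont]) auto
    then obtain \<eta> where \<eta>: "\<eta> > 0" "\<And>u t. u \<in> {0..real T} \<Longrightarrow> t \<in> {0..real T} \<Longrightarrow> dist u t < \<eta> \<Longrightarrow> dist (l u) (l t) < \<delta>"
      using \<delta> unfolding uniformly_continuous_on_def by metis
    obtain r1 :: nat where r1: "real r1 > 1 / \<eta>" using reals_Archimedean2 by blast
    have "eventually (\<lambda>r. dist (\<integral>\<omega>. \<Psi> (disc_path (Suc r) (y r \<omega>)) \<partial>M') (\<integral>\<omega>. \<Psi> (Y \<omega>) \<partial>M') < e / 4) sequentially"
      using e by (intro tendstoD[OF Ylim]) auto
    then obtain r2 where r2: "\<And>r. r \<ge> r2 \<Longrightarrow> \<bar>(\<integral>\<omega>. \<Psi> (disc_path (Suc r) (y r \<omega>)) \<partial>M') - (\<integral>\<omega>. \<Psi> (Y \<omega>) \<partial>M')\<bar> < e / 4"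
      by (auto simp: eventually_sequentially dist_real_def)
    define r where "r = max (max r1 r2) T"
    have r: "T \<le> Suc r" "1 / real (Suc r) < \<eta>"
    proof -
      show "T \<le> Suc r" by (simp add: r_def)
      have "1 / \<eta> < real (Suc r)" using r1 by (auto simp: r_def)
      then show "1 / real (Suc r) < \<eta>" using \<eta>(1) by (simp add: field_simps del: of_nat_Suc)
    qed
    have mod: "(\<Sum>j<Suc r * T. 4 / \<epsilon> ^ 4 * (l (real (Suc j) / real (Suc r)) - l (real j / real (Suc r)))\<^sup>2) \<le> \<epsilon>"
    proof -
      have "(\<Sum>j<Suc r * T. 4 / \<epsilon> ^ 4 * (l (real (Suc j) / real (Suc r)) - l (real j / real (Suc r)))\<^sup>2)
          \<le> (\<Sum>j<Suc r * T. 4 / \<epsilon> ^ 4 * (\<delta> * (l (real (Suc j) / real (Suc r)) - l (real j / real (Suc r)))))"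
      proof (rule sum_mono)
        fix j assume j: "j \<in> {..<Suc r * T}"
        have le: "real j / real (Suc r) \<le> real (Suc j) / real (Suc r)" by (intro divide_right_mono) auto
        have "real (Suc j) \<le> real (Suc r * T)" using j unfolding of_nat_le_iff by simp
        then have "real (Suc j) / real (Suc r) \<le> real T"
          unfolding of_nat_mult by (simp add: field_simps del: of_nat_Suc)
        moreover have "dist (real (Suc j) / real (Suc r)) (real j / real (Suc r)) < \<eta>"
          using r(2) by (simp add: dist_real_def diff_divide_distrib[symmetric])
        ultimately have "dist (l (real (Suc j) / real (Suc r))) (l (real j / real (Suc r))) < \<delta>"
          using le by (intro \<eta>(2)) auto
        moreover have "l (real j / real (Suc r)) \<le> l (real (Suc j) / real (Suc r))" using le by (intro l_mono') auto
        ultimately show "4 / \<epsilon> ^ 4 * (l (real (Suc j) / real (Suc r)) - l (real j / real (Suc r)))\<^sup>2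
            \<le> 4 / \<epsilon> ^ 4 * (\<delta> * (l (real (Suc j) / real (Suc r)) - l (real j / real (Suc r))))"
          using \<epsilon> unfolding power2_eq_square by (intro mult_left_mono mult_right_mono) (auto simp: dist_real_def)
      qed
      also have "\<dots> = 4 / \<epsilon> ^ 4 * (\<delta> * (\<Sum>j<Suc r * T. l (real (Suc j) / real (Suc r)) - l (real j / real (Suc r))))"
        by (simp only: sum_distrib_left)
      also have "(\<Sum>j<Suc r * T. l (real (Suc j) / real (Suc r)) - l (real j / real (Suc r)))
          = l (real (Suc r * T) / real (Suc r)) - l 0"
        using sum_lessThan_telescope[of "\<lambda>j. l (real j / real (Suc r))" "Suc r * T"] by simp
      also have "real (Suc r * T) / real (Suc r) = real T" unfolding of_nat_mult by (simp del: of_nat_Suc)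
      also have "4 / \<epsilon> ^ 4 * (\<delta> * (l (real T) - l 0)) \<le> 4 / \<epsilon> ^ 4 * (\<delta> * l (real T))"
        using \<delta> \<epsilon> l0 by (intro mult_left_mono) auto
      also have "\<dots> = \<epsilon>" unfolding \<delta>_def using lT \<epsilon> by (simp add: field_simps eval_nat_numeral)
      finally show ?thesis .
    qed
    have "eventually (\<lambda>n. \<bar>expectation (\<lambda>\<omega>. \<Psi> (grid_path (Suc r) n \<omega>)) - (\<integral>\<omega>. \<Psi> (disc_path (Suc r) (y r \<omega>)) \<partial>M')\<bar> < e / 8) sequentially"
      using tendstoD[OF grid_lim[of r], of "e / 8"] e by (simp add: dist_real_def)
    with grid_approximation[OF \<Psi> T0 r(1) \<epsilon>, of A]
    have "eventually (\<lambda>n. norm (expectation (\<lambda>\<omega>. \<Psi> (X n \<omega>)) - (\<integral>\<omega>. \<Psi> (Y \<omega>) \<partial>M')) < e) sequentially"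
    proof (rule eventually_elim2)
      show "A > 0" using A by linarith
    next
      fix n
      assume 1: "\<bar>expectation (\<lambda>\<omega>. \<Psi> (X n \<omega>)) - expectation (\<lambda>\<omega>. \<Psi> (grid_path (Suc r) n \<omega>))\<bar> \<le>
          L * (2 * \<epsilon> + 1 / (1 + real T)) + 2 * B * (4 / A ^ 4 * (l (real T))\<^sup>2 +
          (\<Sum>j<Suc r * T. 4 / \<epsilon> ^ 4 * (l (real (Suc j) / real (Suc r)) - l (real j / real (Suc r)))\<^sup>2) + \<epsilon>)"
        and 2: "\<bar>expectation (\<lambda>\<omega>. \<Psi> (grid_path (Suc r) n \<omega>)) - (\<integral>\<omega>. \<Psi> (disc_path (Suc r) (y r \<omega>)) \<partial>M')\<bar> < e / 8"
      have "L * (2 * \<epsilon> + 1 / (1 + real T)) \<le> K / 16 * (3 * \<epsilon>)"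
        using K \<Psi>(2) T\<epsilon> \<epsilon> by (intro mult_mono) auto
      moreover have "2 * B * (4 / A ^ 4 * (l (real T))\<^sup>2 +
          (\<Sum>j<Suc r * T. 4 / \<epsilon> ^ 4 * (l (real (Suc j) / real (Suc r)) - l (real j / real (Suc r)))\<^sup>2) + \<epsilon>)
          \<le> K / 8 * (3 * \<epsilon>)"
        using K B0 A(2) mod \<epsilon> by (intro mult_mono add_nonneg_nonneg sum_nonneg) auto
      moreover have "K / 16 * (3 * \<epsilon>) = 3 * e / 16" "K / 8 * (3 * \<epsilon>) = 3 * e / 8" using K(1) by (simp_all add: \<epsilon>_def)
      moreover have "\<bar>(\<integral>\<omega>. \<Psi> (disc_path (Suc r) (y r \<omega>)) \<partial>M') - (\<integral>\<omega>. \<Psi> (Y \<omega>) \<partial>M')\<bar> < e / 4"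
        by (rule r2) (simp add: r_def)
      ultimately show "norm (expectation (\<lambda>\<omega>. \<Psi> (X n \<omega>)) - (\<integral>\<omega>. \<Psi> (Y \<omega>) \<partial>M')) < e"
        using 1 2 unfolding real_norm_def by linarith
    qed
    then show "\<exists>no. \<forall>n\<ge>no. norm (expectation (\<lambda>\<omega>. \<Psi> (X n \<omega>)) - (\<integral>\<omega>. \<Psi> (\<lambda>t. W (\<sigma>2 * l t) \<omega>) \<partial>M')) < e"
      by (simp add: eventually_sequentially Y_def[abs_def])
  qed
qed

theorem functional_clt:
  assumes BM: "brownian_motion M' W" and \<sigma>2_pos: "\<sigma>2 > 0"
    and l_cont: "continuous_on {0..} l" and l_mono: "strict_mono_on {0..} l" and l0: "l 0 > 0"
  shows "conv_distr_D M X M' (\<lambda>\<omega> t. W (\<sigma>2 * l t) \<omega>)"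
proof (rule conv_distr_D_lipschitzI)
  show "prob_space M" by (rule prob_space_axioms)
  show "prob_space M'" using BM by (simp add: brownian_motion_def)
  have l_pos: "\<sigma>2 * l t \<ge> 0" if "t \<ge> 0" for t
    using that l_mono l0 \<sigma>2_pos by (cases "t = 0") (auto simp: strict_mono_on_def intro!: mult_nonneg_nonneg, fastforce)
  have Yc: "continuous_on {0..} (\<lambda>t. W (\<sigma>2 * l t) \<omega>)" if "\<omega> \<in> space M'" for \<omega>
  proof (rule continuous_on_compose2[of "{0..}" "\<lambda>t. W t \<omega>" "{0..}" "\<lambda>t. \<sigma>2 * l t"])
    show "continuous_on {0..} (\<lambda>t. W t \<omega>)" using BM that by (simp add: brownian_motion_def)
    show "continuous_on {0..} (\<lambda>t. \<sigma>2 * l t)" by (intro continuous_intros l_cont)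
    show "(\<lambda>t. \<sigma>2 * l t) ` {0..} \<subseteq> {0..}" using l_pos by auto
  qed
  then show "(\<lambda>t. W (\<sigma>2 * l t) \<omega>) \<in> cadlag_paths" if "\<omega> \<in> space M'" for \<omega>
    using continuous_imp_cadlag that by blast
  show "(\<lambda>\<omega>. \<Psi> (\<lambda>t. W (\<sigma>2 * l t) \<omega>)) \<in> borel_measurable M'" if "loc_unif_continuous \<Psi>" for \<Psi>
    using BM l_pos by (intro measurable_continuous_path_functional[OF that Yc]) (auto simp: brownian_motion_def)
  show "(\<lambda>n. expectation (\<lambda>\<omega>. \<Psi> (X n \<omega>))) \<longlonglongrightarrow> (\<integral>\<omega>. \<Psi> (\<lambda>t. W (\<sigma>2 * l t) \<omega>) \<partial>M')"
    if "lipschitz_functional L \<Psi>" "L \<ge> 0" "\<forall>f\<in>cadlag_paths. \<bar>\<Psi> f\<bar> \<le> B" for L \<Psi> B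
    by (rule functional_clt_lipschitz[OF assms that])
qed (use X_cadlag X_meas in auto)

end

section \<open>Asymptotics of the step sizes\<close>

text \<open>From some index \<open>K\<close> on, each increment of \<open>x\<close> differs from
  \<open>L\<close> times that of \<open>y\<close> by at most \<open>e / 2\<close> of the latter.
  Summation preserves this, and the constant left over from \<open>K\<close> is outgrown by
  \<open>y\<close>.\<close>

lemma stolz_cesaro:
  fixes x y :: "nat \<Rightarrow> real"
  assumes inc: "eventually (\<lambda>n. y n < y (Suc n)) sequentially" and y: "filterlim y at_top sequentially"
    and lim: "(\<lambda>n. (x (Suc n) - x n) / (y (Suc n) - y n)) \<longlonglongrightarrow> L"
  shows "(\<lambda>n. x n / y n) \<longlonglongrightarrow> L"
proof (rule LIMSEQ_I)
  fix e :: real assume e: "e > 0"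
  have "eventually (\<lambda>n. \<bar>(x (Suc n) - x n) / (y (Suc n) - y n) - L\<bar> < e / 2) sequentially"
    using tendstoD[OF lim, of "e / 2"] e by (simp add: dist_real_def)
  moreover have "eventually (\<lambda>n. y n > 0) sequentially" using y by (simp add: filterlim_at_top_dense)
  ultimately have "eventually (\<lambda>n. y n < y (Suc n) \<and> y n > 0 \<and>
      \<bar>(x (Suc n) - x n) / (y (Suc n) - y n) - L\<bar> < e / 2) sequentially"
    using inc by eventually_elim simp
  then obtain K where K: "\<And>n. n \<ge> K \<Longrightarrow> y n < y (Suc n)" "\<And>n. n \<ge> K \<Longrightarrow> y n > 0"
    "\<And>n. n \<ge> K \<Longrightarrow> \<bar>(x (Suc n) - x n) / (y (Suc n) - y n) - L\<bar> < e / 2"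
    unfolding eventually_sequentially by blast
  have sum: "\<bar>x n - x K - L * (y n - y K)\<bar> \<le> e / 2 * (y n - y K)" if "n \<ge> K" for n
    using that
  proof (induction n rule: dec_induct)
    case (step n)
    have pos: "y (Suc n) - y n > 0" using K(1)[of n] step by simp
    have "\<bar>x (Suc n) - x n - L * (y (Suc n) - y n)\<bar> = \<bar>(x (Suc n) - x n) / (y (Suc n) - y n) - L\<bar> * (y (Suc n) - y n)"
      using pos by (subst (3) abs_of_pos[OF pos, symmetric]) (simp add: abs_mult[symmetric] field_simps)
    also have "\<dots> \<le> e / 2 * (y (Suc n) - y n)"
      using K(3)[of n] step pos by (intro mult_right_mono) auto
    finally have 1: "\<bar>x (Suc n) - x n - L * (y (Suc n) - y n)\<bar> \<le> e / 2 * (y (Suc n) - y n)" .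
    have "x (Suc n) - x K - L * (y (Suc n) - y K)
        = (x (Suc n) - x n - L * (y (Suc n) - y n)) + (x n - x K - L * (y n - y K))"
      by (simp add: algebra_simps)
    also have "\<bar>\<dots>\<bar> \<le> e / 2 * (y (Suc n) - y n) + e / 2 * (y n - y K)"
      by (rule order_trans[OF abs_triangle_ineq add_mono[OF 1 step.IH]])
    also have "\<dots> = e / 2 * (y (Suc n) - y K)" by (simp add: right_diff_distrib)
    finally show ?case .
  qed simp
  define C where "C = \<bar>x K - L * y K\<bar>"
  have "eventually (\<lambda>n. y n > 2 * (C + 1) / e) sequentially" using y by (simp add: filterlim_at_top_dense)
  then obtain n0 where n0: "\<And>n. n \<ge> n0 \<Longrightarrow> y n > 2 * (C + 1) / e" by (auto simp: eventually_sequentially)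
  have "norm (x n / y n - L) < e" if n: "n \<ge> max K n0" for n
  proof -
    have yn: "y n > 0" using K(2) n by simp
    have eq: "x n - L * y n = (x n - x K - L * (y n - y K)) + (x K - L * y K)" by (simp add: algebra_simps)
    have "\<bar>x n - L * y n\<bar> \<le> e / 2 * (y n - y K) + C"
      unfolding eq C_def by (rule order_trans[OF abs_triangle_ineq add_right_mono[OF sum]]) (use n in simp)
    also have "\<dots> \<le> e / 2 * y n + C" using K(2)[of K] e by simp
    also have "C < e / 2 * y n"
    proof -
      have "2 * (C + 1) < y n * e" using n0[of n] n e by (simp add: field_simps)
      then show ?thesis by (simp add: mult.commute[of e])
    qed
    finally have "\<bar>x n - L * y n\<bar> < e * y n" by simp
    then have "\<bar>x n - L * y n\<bar> / y n < e" using yn by (simp add: field_simps)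
    moreover have "x n / y n - L = (x n - L * y n) / y n" using yn by (simp add: field_simps)
    ultimately show ?thesis using yn by simp
  qed
  then show "\<exists>no. \<forall>n\<ge>no. norm (x n / y n - L) < e" by blast
qed

text \<open>Here \<beta> stands for \<open>1 - \<rho>\<close>, the rate, in units of
  \<open>r n\<close>, at which the mean is pulled towards \<open>q\<close>.\<close>

locale step_sizes =
  fixes r :: "nat \<Rightarrow> real" and \<gamma> c \<beta> :: real
  assumes r: "\<And>n. 0 \<le> r n" "\<And>n. r n < 1" and gamma: "1/2 < \<gamma>" "\<gamma> \<le> 1" and c: "c > 0"
    and \<beta>: "0 < \<beta>" "\<beta> \<le> 1"
    and r_lim: "(\<lambda>n. real n powr \<gamma> * r n) \<longlonglongrightarrow> c"
    and gap: "\<gamma> = 1 \<Longrightarrow> 2 * c * \<beta> > 1"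
begin

definition b :: "nat \<Rightarrow> real" where "b n = (\<Prod>k<n. 1 / (1 - \<beta> * r k))"

text \<open>The clock of the martingale up to the factor \<open>\<rho>^2\<close>.\<close>

definition R :: "nat \<Rightarrow> real" where "R n = (\<Sum>k<n. (r k)\<^sup>2 * (b (Suc k))\<^sup>2)"

text \<open>The square of the scale \<open>n powr (\<gamma> / 2) / b n\<close> by which the
  martingale is multiplied.\<close>

definition w :: "nat \<Rightarrow> real" where "w n = real n powr \<gamma> / (b n)\<^sup>2"

text \<open>The limit of the normalised increments of \<open>1 / w\<close>. The growth of
  \<open>b\<close> contributes \<open>2 * c * \<beta>\<close>; the decay of
  \<open>n powr - \<gamma>\<close> is of the same order only for \<gamma> = 1, where it contributes
  -1.\<close>

definition D :: real where "D = 2 * c * \<beta> - (if \<gamma> = 1 then 1 else 0)"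

lemma D_pos: "D > 0"
  using gap c \<beta> by (auto simp: D_def)

lemma \<beta>r: "0 \<le> \<beta> * r n" "\<beta> * r n < 1"
proof -
  show "0 \<le> \<beta> * r n" using r \<beta> by simp
  have "\<beta> * r n \<le> 1 * r n" using r \<beta> by (intro mult_right_mono) auto
  then show "\<beta> * r n < 1" using r(2)[of n] by simp
qed

lemma b_pos: "b n > 0"
  unfolding b_def using \<beta>r by (intro prod_pos) auto

lemma b_Suc: "b (Suc n) = b n / (1 - \<beta> * r n)"
  by (simp add: b_def)

lemma b_0: "b 0 = 1"
  by (simp add: b_def)

lemma b_rec: "b n = (1 - \<beta> * r n) * b (Suc n)"
  using \<beta>r(2)[of n] by (simp add: b_Suc)

lemma r_tendsto_0: "r \<longlonglongrightarrow> 0"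
proof -
  have "(\<lambda>n. (real n powr \<gamma> * r n) * real n powr (- \<gamma>)) \<longlonglongrightarrow> c * 0"
    using gamma by (intro tendsto_mult r_lim) real_asymp
  moreover have "eventually (\<lambda>n. (real n powr \<gamma> * r n) * real n powr (- \<gamma>) = r n) sequentially"
    using eventually_gt_at_top[of 0] by eventually_elim (simp add: powr_minus field_simps)
  ultimately show ?thesis using Lim_transform_eventually by force
qed

text \<open>The increment of \<open>1 / w\<close> divided by
  \<open>(b (Suc n))^2 * n powr (-2 * \<gamma>)\<close>, as \<open>w_increment\<close> shows. The
  increment of \<open>R\<close> has the same order.\<close>

definition \<Delta> :: "nat \<Rightarrow> real" where
  "\<Delta> n = real n powr (2 * \<gamma>) * (real (Suc n) powr (- \<gamma>) - real n powr (- \<gamma>) * (1 - \<beta> * r n)\<^sup>2)"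

text \<open>The difference of consecutive powers, multiplied by
  \<open>n powr (2 * \<gamma>)\<close>, behaves like
  \<open>- \<gamma> * n powr (\<gamma> - 1)\<close>, hence the case distinction. The rest comes from
  expanding the square of \<open>1 - \<beta> * r n\<close>.\<close>

lemma \<Delta>_tendsto: "\<Delta> \<longlonglongrightarrow> D"
proof -
  have 1: "(\<lambda>n. real n powr (2 * \<gamma>) * (real (Suc n) powr (- \<gamma>) - real n powr (- \<gamma>))) \<longlonglongrightarrow> - (if \<gamma> = 1 then 1 else 0)"
  proof (cases "\<gamma> = 1")
    case True
    have "(\<lambda>n. real n powr 2 * (real (Suc n) powr (- 1) - real n powr (- 1))) \<longlonglongrightarrow> - 1" by real_asymp
    then show ?thesis using True by simp
  next
    case False
    then have g: "\<gamma> < 1" "\<gamma> > 0" using gamma by auto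
    have "(\<lambda>n. real n powr (2 * \<gamma>) * (real (Suc n) powr (- \<gamma>) - real n powr (- \<gamma>))) \<longlonglongrightarrow> 0"
      using g by real_asymp
    then show ?thesis using False by simp
  qed
  have 2: "(\<lambda>n. 2 * \<beta> * (real n powr \<gamma> * r n) - \<beta>\<^sup>2 * (real n powr \<gamma> * r n) * r n) \<longlonglongrightarrow> 2 * \<beta> * c - \<beta>\<^sup>2 * c * 0"
    by (intro tendsto_intros r_lim r_tendsto_0)
  have "(\<lambda>n. real n powr (2 * \<gamma>) * (real (Suc n) powr (- \<gamma>) - real n powr (- \<gamma>)) +
     (2 * \<beta> * (real n powr \<gamma> * r n) - \<beta>\<^sup>2 * (real n powr \<gamma> * r n) * r n)) \<longlonglongrightarrow> D"
    using tendsto_add[OF 1 2] by (simp add: D_def algebra_simps)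
  moreover have "eventually (\<lambda>n. real n powr (2 * \<gamma>) * (real (Suc n) powr (- \<gamma>) - real n powr (- \<gamma>)) +
     (2 * \<beta> * (real n powr \<gamma> * r n) - \<beta>\<^sup>2 * (real n powr \<gamma> * r n) * r n) = \<Delta> n) sequentially"
    using eventually_gt_at_top[of 0]
  proof eventually_elim
    case (elim n)
    define p where "p = real n powr \<gamma>"
    have p: "p > 0" "real n powr (2 * \<gamma>) = p\<^sup>2" "real n powr (- \<gamma>) = 1 / p"
      using elim by (simp_all add: p_def powr_minus inverse_eq_divide power2_eq_square powr_add[symmetric])
    show ?case unfolding \<Delta>_def p(2,3) p_def[symmetric] using p(1) by (simp add: field_simps power2_eq_square)
  qed
  ultimately show ?thesis using Lim_transform_eventually by blast
qed

lemma w_inverse: "n > 0 \<Longrightarrow> 1 / w n = (b n)\<^sup>2 * real n powr (- \<gamma>)"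
  by (simp add: w_def powr_minus field_simps)

lemma w_pos: "n > 0 \<Longrightarrow> w n > 0"
  using b_pos[of n] by (simp add: w_def)

lemma w_increment:
  assumes "n > 0"
  shows "1 / w (Suc n) - 1 / w n = (b (Suc n))\<^sup>2 * real n powr (- 2 * \<gamma>) * \<Delta> n"
proof -
  have *: "real n powr (- 2 * \<gamma>) * (real n powr (2 * \<gamma>) * x) = x" for x
    using assms by (simp add: powr_minus)
  have bn: "(b n)\<^sup>2 = (1 - \<beta> * r n)\<^sup>2 * (b (Suc n))\<^sup>2"
    by (subst b_rec) (simp add: power_mult_distrib)
  show ?thesis
    unfolding w_inverse[OF assms] w_inverse[OF zero_less_Suc] \<Delta>_def
    by (simp only: bn mult.assoc *) (simp add: algebra_simps)
qed

lemma w_eventually_increasing: "eventually (\<lambda>n. 1 / w n < 1 / w (Suc n)) sequentially"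
  using order_tendstoD(1)[OF \<Delta>_tendsto D_pos] eventually_gt_at_top[of 0]
proof eventually_elim
  case (elim n)
  then have "0 < (b (Suc n))\<^sup>2 * real n powr (- 2 * \<gamma>) * \<Delta> n" using b_pos[of "Suc n"] by simp
  then show ?case using w_increment[OF elim(2)] by simp
qed

text \<open>Each increment of \<open>1 / w\<close> is eventually at least \<open>D / 2\<close> times
  \<open>1 / w (Suc n)\<close> times \<open>n powr - \<gamma>\<close>. As \<open>1 / w\<close> is
  eventually increasing and \<gamma> \<le> 1, this exceeds a constant multiple of
  \<open>1 / Suc n\<close>, and the harmonic series diverges.\<close>

lemma w_inverse_at_top: "filterlim (\<lambda>n. 1 / w n) at_top sequentially"
proof -
  have "eventually (\<lambda>n. \<Delta> n > D / 2) sequentially" using \<Delta>_tendsto D_pos by (intro order_tendstoD(1)) auto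
  then have "eventually (\<lambda>n. \<Delta> n > D / 2 \<and> 1 / w n < 1 / w (Suc n)) sequentially"
    using w_eventually_increasing by (rule eventually_conj)
  then obtain K0 where K0: "\<And>n. n \<ge> K0 \<Longrightarrow> \<Delta> n > D / 2 \<and> 1 / w n < 1 / w (Suc n)"
    unfolding eventually_sequentially by blast
  define K where "K = Suc K0"
  have K: "K > 0" "\<And>n. n \<ge> K \<Longrightarrow> \<Delta> n > D / 2" "\<And>n. n \<ge> K \<Longrightarrow> 1 / w n < 1 / w (Suc n)"
    using K0 by (auto simp: K_def)
  define a where "a = D / 2 * (1 / w K)"
  have a: "a > 0" unfolding a_def using D_pos w_pos[OF K(1)] by simp
  have mono: "1 / w K \<le> 1 / w n" if "n \<ge> K" for n
    using that
  proof (induction n rule: dec_induct)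
    case (step n)
    then show ?case using K(3)[of n] by linarith
  qed simp
  have inc: "a * (1 / real (Suc n)) \<le> 1 / w (Suc n) - 1 / w n" if n: "n \<ge> K" for n
  proof -
    have n0: "n > 0" using n K(1) by simp
    have "real (Suc n) powr (- 1) \<le> real (Suc n) powr (- \<gamma>)"
      using gamma by (intro powr_mono) auto
    also have "real (Suc n) powr (- \<gamma>) \<le> real n powr (- \<gamma>)"
      using gamma n0 by (intro powr_mono2') auto
    finally have 1: "1 / real (Suc n) \<le> real n powr (- \<gamma>)" by (simp add: powr_minus field_simps)
    have "a * (1 / real (Suc n)) \<le> (D / 2 * (1 / w (Suc n))) * real n powr (- \<gamma>)"
    proof (rule mult_mono[OF _ 1])
      show "a \<le> D / 2 * (1 / w (Suc n))"
        unfolding a_def using mono[of "Suc n"] n D_pos by (intro mult_left_mono) auto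
      show "0 \<le> D / 2 * (1 / w (Suc n))" using w_pos[of "Suc n"] D_pos by simp
    qed simp
    also have "\<dots> = D / 2 * ((b (Suc n))\<^sup>2 * (real (Suc n) powr (- \<gamma>) * real n powr (- \<gamma>)))"
      by (simp add: w_inverse[OF zero_less_Suc])
    also have "\<dots> \<le> D / 2 * ((b (Suc n))\<^sup>2 * (real n powr (- \<gamma>) * real n powr (- \<gamma>)))"
      using \<open>real (Suc n) powr (- \<gamma>) \<le> real n powr (- \<gamma>)\<close> D_pos by (intro mult_left_mono mult_right_mono) auto
    also have "\<dots> = (b (Suc n))\<^sup>2 * real n powr (- 2 * \<gamma>) * (D / 2)"
      by (simp add: powr_add[symmetric])
    also have "\<dots> \<le> (b (Suc n))\<^sup>2 * real n powr (- 2 * \<gamma>) * \<Delta> n"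
      using K(2)[OF n] by (intro mult_left_mono) auto
    finally show ?thesis using w_increment[OF n0] by simp
  qed
  have sum: "a * (harm n - harm K) \<le> 1 / w n" if "n \<ge> K" for n
    using that
  proof (induction n rule: dec_induct)
    case base
    show ?case using w_pos[OF K(1)] by simp
  next
    case (step n)
    then show ?case using inc[of n] by (simp add: harm_Suc algebra_simps inverse_eq_divide)
  qed
  have "filterlim (\<lambda>n. harm n + (- harm K) :: real) at_top sequentially"
    by (rule filterlim_tendsto_add_at_top[OF tendsto_const harm_at_top, of "- harm K", simplified add.commute])
  then have "filterlim (\<lambda>n. a * (harm n - harm K)) at_top sequentially"
    by (intro filterlim_tendsto_pos_mult_at_top[OF tendsto_const a]) simp
  then show ?thesis
    by (rule filterlim_at_top_mono) (use sum in \<open>auto simp: eventually_sequentially\<close>)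
qed

lemma w_tendsto_0: "w \<longlonglongrightarrow> 0"
proof -
  have "(\<lambda>n. inverse (1 / w n)) \<longlonglongrightarrow> 0"
    by (rule tendsto_inverse_0_at_top[OF w_inverse_at_top])
  then show ?thesis by simp
qed

text \<open>Stolz-Cesaro with denominators \<open>1 / w\<close>: the common powers and the factor
  \<open>b\<close> cancel from the increments, leaving
  \<open>(n powr \<gamma> * r n)^2 / \<Delta> n\<close>.\<close>

lemma R_tendsto: "(\<lambda>n. w n * R n) \<longlonglongrightarrow> c\<^sup>2 / D"
proof -
  have "(\<lambda>n. R n / (1 / w n)) \<longlonglongrightarrow> c\<^sup>2 / D"
  proof (rule stolz_cesaro[OF w_eventually_increasing w_inverse_at_top])
    have "(\<lambda>n. (real n powr \<gamma> * r n)\<^sup>2 / \<Delta> n) \<longlonglongrightarrow> c\<^sup>2 / D"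
      using D_pos by (intro tendsto_intros r_lim \<Delta>_tendsto) auto
    moreover have "eventually (\<lambda>n. (real n powr \<gamma> * r n)\<^sup>2 / \<Delta> n = (R (Suc n) - R n) / (1 / w (Suc n) - 1 / w n)) sequentially"
      using order_tendstoD(1)[OF \<Delta>_tendsto D_pos] eventually_gt_at_top[of 0]
    proof eventually_elim
      case (elim n)
      have "(real n powr \<gamma>)\<^sup>2 * real n powr (- 2 * \<gamma>) = 1"
        using elim by (simp add: power2_eq_square powr_add[symmetric])
      then have "real n powr (- 2 * \<gamma>) = 1 / (real n powr \<gamma>)\<^sup>2" using elim by (simp add: field_simps)
      then show ?case using w_increment[OF elim(2)] elim b_pos[of "Suc n"]
        by (simp add: R_def power_mult_distrib)
    qed
    ultimately show "(\<lambda>n. (R (Suc n) - R n) / (1 / w (Suc n) - 1 / w n)) \<longlonglongrightarrow> c\<^sup>2 / D"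
      by (rule Lim_transform_eventually)
  qed
  then show ?thesis by (simp add: mult.commute)
qed

text \<open>The quantity equals \<open>w n / w (Suc k)\<close> times
  \<open>(r k)^2 * Suc k powr \<gamma>\<close>. For large \<open>k\<close> the first factor is at
  most \<open>w n / w (m n)\<close> by monotonicity, and the second tends to 0. The finitely many
  small \<open>k\<close> are settled by \<open>w n\<close> tending to 0.\<close>

lemma increments_small:
  fixes m :: "nat \<Rightarrow> nat"
  assumes wm: "(\<lambda>n. w n / w (m n)) \<longlonglongrightarrow> a" and \<delta>: "\<delta> > 0"
  shows "eventually (\<lambda>n. \<forall>k<m n. w n * ((r k)\<^sup>2 * (b (Suc k))\<^sup>2) \<le> \<delta>) sequentially"
proof -
  define C where "C = \<bar>a\<bar> + 1"
  have C: "C > 0" by (simp add: C_def)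
  have "(\<lambda>n. (r n * r n) * real (Suc n) powr \<gamma>) \<longlonglongrightarrow> 0"
  proof -
    have "(\<lambda>n. (real n powr \<gamma> * r n) * r n * (real (Suc n) powr \<gamma> / real n powr \<gamma>)) \<longlonglongrightarrow> c * 0 * 1"
      by (intro tendsto_mult r_lim r_tendsto_0) (use gamma in real_asymp)
    then have lim: "(\<lambda>n. (real n powr \<gamma> * r n) * r n * (real (Suc n) powr \<gamma> / real n powr \<gamma>)) \<longlonglongrightarrow> 0" by simp
    show ?thesis
      by (rule Lim_transform_eventually[OF lim])
        (use eventually_gt_at_top[of 0] in eventually_elim, simp)
  qed
  then have "eventually (\<lambda>k. (r k * r k) * real (Suc k) powr \<gamma> < \<delta> / C) sequentially"
    using \<delta> C by (intro order_tendstoD(2)) auto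
  then have "eventually (\<lambda>k. (r k * r k) * real (Suc k) powr \<gamma> < \<delta> / C \<and> 1 / w k < 1 / w (Suc k)) sequentially"
    using w_eventually_increasing by (rule eventually_conj)
  then obtain K where K: "\<And>k. k \<ge> K \<Longrightarrow> (r k * r k) * real (Suc k) powr \<gamma> < \<delta> / C" "\<And>k. k \<ge> K \<Longrightarrow> 1 / w k < 1 / w (Suc k)"
    unfolding eventually_sequentially by blast
  define H where "H = (\<Sum>k<K. (r k)\<^sup>2 * (b (Suc k))\<^sup>2)"
  have "(\<lambda>n. w n * H) \<longlonglongrightarrow> 0 * H" by (intro tendsto_intros w_tendsto_0)
  then have "eventually (\<lambda>n. w n * H < \<delta>) sequentially" using \<delta> by (intro order_tendstoD(2)) auto
  moreover have "eventually (\<lambda>n. w n / w (m n) < C) sequentially"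
    using wm by (intro order_tendstoD(2)) (auto simp: C_def)
  ultimately show ?thesis using eventually_gt_at_top[of 0]
  proof eventually_elim
    case (elim n)
    have wn: "w n > 0" by (rule w_pos[OF elim(3)])
    show ?case
    proof (intro allI impI)
      fix k assume k: "k < m n"
      show "w n * ((r k)\<^sup>2 * (b (Suc k))\<^sup>2) \<le> \<delta>"
      proof (cases "k < K")
        case True
        then have "(r k)\<^sup>2 * (b (Suc k))\<^sup>2 \<le> H"
          unfolding H_def by (intro member_le_sum) auto
        then have "w n * ((r k)\<^sup>2 * (b (Suc k))\<^sup>2) \<le> w n * H" using wn by (intro mult_left_mono) auto
        then show ?thesis using elim(1) by simp
      next
        case False
        have mono: "1 / w (Suc k) \<le> 1 / w j" if "j \<ge> Suc k" for j
          using that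
        proof (induction j rule: dec_induct)
          case (step j)
          then show ?case using K(2)[of j] False by auto
        qed simp
        have wk: "w (Suc k) > 0" by (rule w_pos) simp
        have "(r k)\<^sup>2 * (b (Suc k))\<^sup>2 = (r k * r k * real (Suc k) powr \<gamma>) * (1 / w (Suc k))"
          by (simp add: w_def power2_eq_square)
        also have "w n * \<dots> = (r k * r k * real (Suc k) powr \<gamma>) * (w n * (1 / w (Suc k)))" by simp
        also have "\<dots> \<le> \<delta> / C * C"
        proof (rule mult_mono)
          show "r k * r k * real (Suc k) powr \<gamma> \<le> \<delta> / C" using K(1)[of k] False by simp
          have "w n * (1 / w (Suc k)) \<le> w n * (1 / w (m n))" using wn mono[of "m n"] k by (intro mult_left_mono) auto
          then show "w n * (1 / w (Suc k)) \<le> C" using elim(2) by simp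
        qed (use wn wk \<delta> C in auto)
        finally show ?thesis using C by simp
      qed
    qed
  qed
qed

section \<open>The ratio of \<open>b\<close> at the two ends of a time window\<close>

definition x :: "nat \<Rightarrow> real" where "x k = - ln (1 - \<beta> * r k)"

text \<open>The logarithmic increments of \<open>b\<close> lie between \<open>y\<close> and
  \<open>y / (1 - y)\<close> for \<open>y = \<beta> * r k\<close>, so they share the asymptotics of
  \<open>y\<close>.\<close>

lemma x_lim: "(\<lambda>k. real k powr \<gamma> * x k) \<longlonglongrightarrow> \<beta> * c"
proof (rule tendsto_sandwich)
  show "eventually (\<lambda>k. \<beta> * (real k powr \<gamma> * r k) \<le> real k powr \<gamma> * x k) sequentially"
  proof (rule always_eventually, rule allI)
    fix k
    have "ln (1 - \<beta> * r k) \<le> - (\<beta> * r k)"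
      using ln_le_minus_one[of "1 - \<beta> * r k"] \<beta>r[of k] by simp
    then have "real k powr \<gamma> * (\<beta> * r k) \<le> real k powr \<gamma> * x k"
      unfolding x_def by (intro mult_left_mono) auto
    then show "\<beta> * (real k powr \<gamma> * r k) \<le> real k powr \<gamma> * x k" by (simp add: mult_ac)
  qed
  show "eventually (\<lambda>k. real k powr \<gamma> * x k \<le> \<beta> * (real k powr \<gamma> * r k) / (1 - \<beta> * r k)) sequentially"
  proof (rule always_eventually, rule allI)
    fix k
    have "x k = ln (1 / (1 - \<beta> * r k))" unfolding x_def using \<beta>r[of k] by (simp add: ln_div)
    also have "\<dots> \<le> 1 / (1 - \<beta> * r k) - 1" using \<beta>r[of k] by (intro ln_le_minus_one) auto
    also have "\<dots> = \<beta> * r k / (1 - \<beta> * r k)" using \<beta>r[of k] by (simp add: field_simps)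
    finally have "real k powr \<gamma> * x k \<le> real k powr \<gamma> * (\<beta> * r k / (1 - \<beta> * r k))" by (intro mult_left_mono) auto
    then show "real k powr \<gamma> * x k \<le> \<beta> * (real k powr \<gamma> * r k) / (1 - \<beta> * r k)" by (simp add: mult_ac)
  qed
  show "(\<lambda>k. \<beta> * (real k powr \<gamma> * r k)) \<longlonglongrightarrow> \<beta> * c" by (intro tendsto_intros r_lim)
  have "(\<lambda>k. \<beta> * (real k powr \<gamma> * r k) / (1 - \<beta> * r k)) \<longlonglongrightarrow> \<beta> * c / (1 - \<beta> * 0)"
    by (intro tendsto_intros r_lim r_tendsto_0) simp
  then show "(\<lambda>k. \<beta> * (real k powr \<gamma> * r k) / (1 - \<beta> * r k)) \<longlonglongrightarrow> \<beta> * c" by simp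
qed

lemma ln_b_diff: "n \<le> m \<Longrightarrow> ln (b n) - ln (b m) = - (\<Sum>k=n..<m. x k)"
proof (induction m rule: dec_induct)
  case (step m)
  have "ln (b (Suc m)) = ln (b m) + x m"
    unfolding b_Suc x_def using b_pos[of m] \<beta>r[of m] by (simp add: ln_div)
  then show ?case using step by simp
qed simp

text \<open>In logarithms the ratio of \<open>b\<close> is a sum of the \<open>x k\<close> over the
  window, and these are \<open>\<beta> * c * k powr - \<gamma>\<close> up to a small relative error.
  Thus \<phi>, the limit of the power sums, determines the growth of \<open>b\<close> uniformly in
  \<open>t\<close>.\<close>

lemma window_uniform:
  fixes m :: "nat \<Rightarrow> real \<Rightarrow> nat" and \<phi> :: "real \<Rightarrow> real"
  assumes m: "\<And>n t. 0 \<le> t \<Longrightarrow> n \<le> m n t"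
    and \<phi>: "\<And>t. t \<in> {0..T} \<Longrightarrow> \<bar>\<phi> t\<bar> \<le> C"
    and sums: "\<And>e. e > 0 \<Longrightarrow> eventually (\<lambda>n. \<forall>t\<in>{0..T}. \<bar>(\<Sum>k=n..<m n t. real k powr (- \<gamma>)) - \<phi> t\<bar> \<le> e) sequentially"
    and e: "e > 0"
  shows "eventually (\<lambda>n. \<forall>t\<in>{0..T}. \<bar>exp (c * \<beta> * \<phi> t) * b n / b (m n t) - 1\<bar> \<le> e) sequentially"
proof -
  have "continuous (at (0::real)) exp" by simp
  then obtain \<eta> where "\<eta> > 0" "\<forall>u::real. dist u 0 < \<eta> \<longrightarrow> dist (exp u) (exp 0) < e"
    using e unfolding continuous_at_eps_delta by blast
  then have \<eta>: "\<eta> > 0" "\<And>u::real. \<bar>u\<bar> < \<eta> \<Longrightarrow> \<bar>exp u - 1\<bar> < e"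
    by (auto simp: dist_real_def)
  define C' where "C' = \<bar>C\<bar> + 1"
  have C': "C' > 0" by (simp add: C'_def)
  \<comment> \<open>The two errors in the exponent, from \<phi> and from \<open>x\<close>, are at
    most \<open>\<eta> / 4\<close> each. The bound by 1 keeps the power sums below
    \<open>C'\<close>.\<close>
  define \<epsilon> where "\<epsilon> = min 1 (\<eta> / (4 * (c * \<beta>)))"
  define \<delta> where "\<delta> = \<eta> / (4 * C')"
  have pos: "\<epsilon> > 0" "\<delta> > 0" using \<eta> C' c \<beta> by (auto simp: \<epsilon>_def \<delta>_def)
  have "eventually (\<lambda>k. \<bar>real k powr \<gamma> * x k - \<beta> * c\<bar> < \<delta>) sequentially"
    using tendstoD[OF x_lim pos(2)] by (simp add: dist_real_def)
  then obtain K where K: "\<And>k. k \<ge> K \<Longrightarrow> \<bar>real k powr \<gamma> * x k - \<beta> * c\<bar> < \<delta>" by (auto simp: eventually_sequentially)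
  from sums[OF pos(1)] eventually_ge_at_top[of "max K 1"] show ?thesis
  proof eventually_elim
    case (elim n)
    show ?case
    proof
      fix t assume t: "t \<in> {0..T}"
      define A where "A = (\<Sum>k=n..<m n t. real k powr (- \<gamma>))"
      have A: "\<bar>A - \<phi> t\<bar> \<le> \<epsilon>" using elim(1) t by (simp add: A_def)
      have A0: "0 \<le> A" unfolding A_def by (intro sum_nonneg) auto
      have AC: "A \<le> C'" using A \<phi>[OF t] unfolding \<epsilon>_def C'_def by linarith
      have "\<bar>(\<Sum>k=n..<m n t. x k) - \<beta> * c * A\<bar> = \<bar>\<Sum>k=n..<m n t. x k - \<beta> * c * real k powr (- \<gamma>)\<bar>"
        by (simp add: A_def sum_subtractf sum_distrib_left)
      also have "\<dots> \<le> (\<Sum>k=n..<m n t. \<delta> * real k powr (- \<gamma>))"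
      proof (rule order_trans[OF sum_abs sum_mono])
        fix k assume k: "k \<in> {n..<m n t}"
        then have k0: "k > 0" and kK: "k \<ge> K" using elim(2) by auto
        have "x k - \<beta> * c * real k powr (- \<gamma>) = (real k powr \<gamma> * x k - \<beta> * c) * real k powr (- \<gamma>)"
          using k0 by (simp add: algebra_simps powr_minus)
        also have "\<bar>\<dots>\<bar> \<le> \<delta> * real k powr (- \<gamma>)"
          unfolding abs_mult using K[OF kK] by (intro mult_mono) auto
        finally show "\<bar>x k - \<beta> * c * real k powr (- \<gamma>)\<bar> \<le> \<delta> * real k powr (- \<gamma>)" .
      qed
      also have "\<dots> = \<delta> * A" by (simp add: A_def sum_distrib_left)
      also have "\<dots> \<le> \<delta> * C'" using AC pos by (intro mult_left_mono) auto
      also have "\<dots> = \<eta> / 4" using C' by (simp add: \<delta>_def)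
      finally have 1: "\<bar>(\<Sum>k=n..<m n t. x k) - \<beta> * c * A\<bar> \<le> \<eta> / 4" .
      have "\<bar>\<beta> * c * A - c * \<beta> * \<phi> t\<bar> = c * \<beta> * \<bar>A - \<phi> t\<bar>"
        using c \<beta> by (simp add: abs_mult right_diff_distrib[symmetric] mult.commute[of c])
      also have "\<dots> \<le> c * \<beta> * (\<eta> / (4 * (c * \<beta>)))"
        using A c \<beta> unfolding \<epsilon>_def by (intro mult_left_mono) auto
      also have "\<dots> = \<eta> / 4" using c \<beta> by simp
      finally have 2: "\<bar>\<beta> * c * A - c * \<beta> * \<phi> t\<bar> \<le> \<eta> / 4" .
      have "exp (c * \<beta> * \<phi> t) * b n / b (m n t) = exp (c * \<beta> * \<phi> t + (ln (b n) - ln (b (m n t))))"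
        using b_pos by (simp add: exp_add exp_diff)
      also have "ln (b n) - ln (b (m n t)) = - (\<Sum>k=n..<m n t. x k)"
        using t by (intro ln_b_diff m) auto
      finally have "exp (c * \<beta> * \<phi> t) * b n / b (m n t) = exp (c * \<beta> * \<phi> t - (\<Sum>k=n..<m n t. x k))" by simp
      moreover have "\<bar>exp (c * \<beta> * \<phi> t - (\<Sum>k=n..<m n t. x k)) - 1\<bar> < e"
        using 1 2 \<eta>(1) by (intro \<eta>(2)) linarith
      ultimately show "\<bar>exp (c * \<beta> * \<phi> t) * b n / b (m n t) - 1\<bar> \<le> e" by simp
    qed
  qed
qed

lemma w_ratio_tendsto:
  fixes m :: "nat \<Rightarrow> nat"
  assumes b: "(\<lambda>n. exp y * b n / b (m n)) \<longlonglongrightarrow> 1"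
    and ratio: "(\<lambda>n. real n / real (m n)) \<longlonglongrightarrow> a" "a > 0"
  shows "(\<lambda>n. w n / w (m n)) \<longlonglongrightarrow> a powr \<gamma> * exp (2 * y)"
proof -
  have "(\<lambda>n. (real n / real (m n)) powr \<gamma> * (exp y / (exp y * b n / b (m n)))\<^sup>2) \<longlonglongrightarrow> a powr \<gamma> * (exp y / 1)\<^sup>2"
    using ratio(2) by (intro tendsto_intros ratio(1) b) auto
  moreover have "(real n / real (m n)) powr \<gamma> * (exp y / (exp y * b n / b (m n)))\<^sup>2 = w n / w (m n)" for n
    using b_pos[of n] b_pos[of "m n"] by (simp add: w_def powr_divide power_divide field_simps)
  moreover have "(exp y)\<^sup>2 = exp (2 * y)" by (simp add: exp_double)
  ultimately show ?thesis by simp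
qed

text \<open>The normalisation belongs to the left end of the window and the clock to its right end;
  the ratio of the two values of \<open>w\<close> converts one into the other.\<close>

lemma R_window_tendsto:
  fixes m :: "nat \<Rightarrow> nat"
  assumes m: "\<And>n. n \<le> m n" and lim: "(\<lambda>n. w n / w (m n)) \<longlonglongrightarrow> a"
  shows "(\<lambda>n. w n * R (m n)) \<longlonglongrightarrow> a * (c\<^sup>2 / D)"
proof -
  have "filterlim m at_top sequentially"
    by (rule filterlim_at_top_mono[OF filterlim_ident]) (use m in auto)
  then have "(\<lambda>n. w (m n) * R (m n)) \<longlonglongrightarrow> c\<^sup>2 / D"
    by (rule filterlim_compose[OF R_tendsto])
  then have "(\<lambda>n. w n / w (m n) * (w (m n) * R (m n))) \<longlonglongrightarrow> a * (c\<^sup>2 / D)"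
    by (rule tendsto_mult[OF lim])
  moreover have "eventually (\<lambda>n. w n / w (m n) * (w (m n) * R (m n)) = w n * R (m n)) sequentially"
    using eventually_gt_at_top[of 0]
  proof eventually_elim
    case (elim n)
    then have "w (m n) > 0" using m[of n] by (intro w_pos) auto
    then show ?case by simp
  qed
  ultimately show ?thesis by (rule Lim_transform_eventually)
qed

text \<open>A window of length \<open>n powr \<gamma> * t\<close> is short compared with
  \<open>n\<close>, so all its terms are close to \<open>n powr - \<gamma>\<close> and their sum is
  close to \<open>t\<close>. Rounding the right end down costs at most one term.\<close>

lemma window_sum_sublinear:
  assumes g: "\<gamma> < 1" and T: "T > 0" and e: "e > 0"
  shows "eventually (\<lambda>n. \<forall>t\<in>{0..T}. \<bar>(\<Sum>k=n..<nat \<lfloor>real n + real n powr \<gamma> * t\<rfloor>. real k powr (- \<gamma>)) - t\<bar> \<le> e) sequentially"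
proof -
  \<comment> \<open>The ratio of the power at the right end of the longest window to the power at
    its left end.\<close>
  define u where "u n = (1 + real n powr (\<gamma> - 1) * T) powr (- \<gamma>)" for n :: nat
  have "(\<lambda>n. T * (1 - u n) + real n powr (- \<gamma>)) \<longlonglongrightarrow> T * (1 - (1 + 0 * T) powr (- \<gamma>)) + 0"
    unfolding u_def using g gamma by (intro tendsto_intros) (simp, real_asymp, simp, simp, real_asymp)
  then have "(\<lambda>n. T * (1 - u n) + real n powr (- \<gamma>)) \<longlonglongrightarrow> 0" by simp
  then have "eventually (\<lambda>n. T * (1 - u n) + real n powr (- \<gamma>) < e) sequentially"
    using e by (intro order_tendstoD(2)) auto
  then show ?thesis using eventually_gt_at_top[of 0]
  proof eventually_elim
    case (elim n)
    define p where "p = real n powr \<gamma>"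
    have p: "p > 0" "real n powr (- \<gamma>) = 1 / p" using elim by (simp_all add: p_def powr_minus inverse_eq_divide)
    have u: "0 < u n" "u n \<le> 1"
    proof -
      have "1 + real n powr (\<gamma> - 1) * T > 0" using T by (intro add_pos_nonneg) auto
      then show "0 < u n" by (simp add: u_def)
      have "(1 + real n powr (\<gamma> - 1) * T) powr (- \<gamma>) \<le> 1 powr (- \<gamma>)"
        using T gamma by (intro powr_mono2') auto
      then show "u n \<le> 1" by (simp add: u_def)
    qed
    have up: "(real n + p * T) powr (- \<gamma>) = u n / p"
    proof -
      have "real n + p * T = real n * (1 + real n powr (\<gamma> - 1) * T)"
        using elim(2) by (simp add: p_def powr_diff field_simps)
      moreover have "1 + real n powr (\<gamma> - 1) * T \<ge> 0" using T by simp
      ultimately show ?thesis using p(2) by (simp add: powr_mult u_def)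
    qed
    show ?case
    proof
      fix t assume t: "t \<in> {0..T}"
      define m where "m = nat \<lfloor>real n + real n powr \<gamma> * t\<rfloor>"
      have "real m = of_int \<lfloor>real n + p * t\<rfloor>"
        unfolding m_def p_def using t by (intro of_nat_nat) simp
      then have m: "real m \<le> real n + p * t" "real n + p * t < real m + 1" by linarith+
      have nm: "n \<le> m" unfolding m_def using t by (intro le_nat_floor) simp
      have pT: "p * t \<le> p * T" using t p by (intro mult_left_mono) auto
      have "(\<Sum>k=n..<m. real k powr (- \<gamma>)) \<le> (\<Sum>k=n..<m. 1 / p)"
        unfolding p(2)[symmetric] using elim(2) gamma by (intro sum_mono powr_mono2') auto
      also have "\<dots> = (real m - real n) / p" using nm by (simp add: of_nat_diff)
      also have "\<dots> \<le> t" using m p by (simp add: field_simps)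
      finally have 1: "(\<Sum>k=n..<m. real k powr (- \<gamma>)) \<le> t" .
      have "(t - 1 / p) * u n = (p * t - 1) * (u n / p)" using p by (simp add: field_simps)
      also have "\<dots> \<le> (real m - real n) * (u n / p)" using m u p by (intro mult_right_mono) auto
      also have "\<dots> = (\<Sum>k=n..<m. u n / p)" using nm by (simp add: of_nat_diff)
      also have "\<dots> \<le> (\<Sum>k=n..<m. real k powr (- \<gamma>))"
        unfolding up[symmetric] using elim(2) gamma m pT by (intro sum_mono powr_mono2') auto
      finally have 2: "(t - 1 / p) * u n \<le> (\<Sum>k=n..<m. real k powr (- \<gamma>))" .
      have "t - (t - 1 / p) * u n = t * (1 - u n) + 1 / p * u n" by (simp add: algebra_simps)
      also have "\<dots> \<le> T * (1 - u n) + 1 / p * 1"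
        using t u p by (intro add_mono mult_right_mono mult_left_mono) auto
      finally have "t - (t - 1 / p) * u n < e" using elim(1) p(2) by simp
      then show "\<bar>(\<Sum>k=n..<nat \<lfloor>real n + real n powr \<gamma> * t\<rfloor>. real k powr (- \<gamma>)) - t\<bar> \<le> e"
        unfolding m_def[symmetric] using 1 2 by (simp add: abs_le_iff)
    qed
  qed
qed

lemma window_ratio_sublinear:
  assumes g: "\<gamma> < 1" and t: "t \<ge> 0"
  shows "(\<lambda>n. real n / real (nat \<lfloor>real n + real n powr \<gamma> * t\<rfloor>)) \<longlonglongrightarrow> 1"
proof (rule tendsto_sandwich)
  show "eventually (\<lambda>n. 1 / (1 + real n powr (\<gamma> - 1) * t) \<le> real n / real (nat \<lfloor>real n + real n powr \<gamma> * t\<rfloor>)) sequentially"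
    using eventually_gt_at_top[of 0]
  proof eventually_elim
    case (elim n)
    define m where "m = nat \<lfloor>real n + real n powr \<gamma> * t\<rfloor>"
    have "real m = of_int \<lfloor>real n + real n powr \<gamma> * t\<rfloor>" unfolding m_def using t by (intro of_nat_nat) simp
    then have m: "real m \<le> real n + real n powr \<gamma> * t" by linarith
    have nm: "n \<le> m" unfolding m_def using t by (intro le_nat_floor) simp
    have "real n / (real n + real n powr \<gamma> * t) \<le> real n / real m"
      using m nm elim by (intro divide_left_mono) auto
    moreover have "real n / (real n + real n powr \<gamma> * t) = 1 / (1 + real n powr (\<gamma> - 1) * t)"
      using elim t by (simp add: powr_diff field_simps add_pos_nonneg)
    ultimately show ?case unfolding m_def by simp
  qed
  show "eventually (\<lambda>n. real n / real (nat \<lfloor>real n + real n powr \<gamma> * t\<rfloor>) \<le> 1) sequentially"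
    proof (intro always_eventually allI)
    fix n
    have "n \<le> nat \<lfloor>real n + real n powr \<gamma> * t\<rfloor>" using t by (intro le_nat_floor) simp
    then show "real n / real (nat \<lfloor>real n + real n powr \<gamma> * t\<rfloor>) \<le> 1" by (intro divide_le_eq_1[THEN iffD2]) auto
  qed
  have "(\<lambda>n. 1 / (1 + real n powr (\<gamma> - 1) * t)) \<longlonglongrightarrow> 1 / (1 + 0 * t)"
    using g by (intro tendsto_intros) (real_asymp, simp)
  then show "(\<lambda>n. 1 / (1 + real n powr (\<gamma> - 1) * t)) \<longlonglongrightarrow> 1" by simp
qed simp

text \<open>Both bounds use \<open>ln y \<le> y - 1\<close>, at \<open>(k + 1) / k\<close> and at
  its reciprocal; the discrepancies \<open>1 / k - 1 / (k + 1)\<close> telescope.\<close>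

lemma harmonic_window:
  assumes "0 < n" "n \<le> m"
  shows "ln (real m / real n) \<le> (\<Sum>k=n..<m. 1 / real k)"
    and "(\<Sum>k=n..<m. 1 / real k) \<le> ln (real m / real n) + (1 / real n - 1 / real m)"
proof -
  have *: "ln (real (Suc k)) - ln (real k) \<le> 1 / real k" "1 / real k \<le> ln (real (Suc k)) - ln (real k) + (1 / real k - 1 / real (Suc k))"
    if "k > 0" for k
  proof -
    have "ln (real (Suc k)) - ln (real k) = ln (real (Suc k) / real k)" using that by (subst ln_div) auto
    also have "\<dots> \<le> real (Suc k) / real k - 1" using that by (intro ln_le_minus_one) auto
    also have "\<dots> = 1 / real k" using that by (simp add: field_simps)
    finally show "ln (real (Suc k)) - ln (real k) \<le> 1 / real k" .
    have "ln (real k) - ln (real (Suc k)) = ln (real k / real (Suc k))" using that by (subst ln_div) auto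
    also have "\<dots> \<le> real k / real (Suc k) - 1" using that by (intro ln_le_minus_one) auto
    also have "\<dots> = - 1 / real (Suc k)" by (simp add: field_simps)
    finally show "1 / real k \<le> ln (real (Suc k)) - ln (real k) + (1 / real k - 1 / real (Suc k))" by simp
  qed
  have "ln (real m) - ln (real n) \<le> (\<Sum>k=n..<m. 1 / real k) \<and>
      (\<Sum>k=n..<m. 1 / real k) \<le> ln (real m) - ln (real n) + (1 / real n - 1 / real m)"
    using assms(2)
  proof (induction m rule: dec_induct)
    case (step m)
    then show ?case using *[of m] assms(1) by (simp del: of_nat_Suc)
  qed simp
  moreover have "ln (real m / real n) = ln (real m) - ln (real n)" using assms by (subst ln_div) auto
  ultimately show "ln (real m / real n) \<le> (\<Sum>k=n..<m. 1 / real k)"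
    "(\<Sum>k=n..<m. 1 / real k) \<le> ln (real m / real n) + (1 / real n - 1 / real m)" by simp_all
qed

text \<open>For \<gamma> = 1 the window grows by the factor \<open>1 + t\<close>, and its harmonic
  sum is nearly \<open>ln (1 + t)\<close>. Rounding costs at most \<open>1 / m\<close> from below,
  and from above the error is at most \<open>1 / n\<close>.\<close>

lemma window_sum_linear:
  assumes g: "\<gamma> = 1" and e: "e > 0"
  shows "eventually (\<lambda>n. \<forall>t\<in>{0..T}. \<bar>(\<Sum>k=n..<nat \<lfloor>real n + real n * t\<rfloor>. real k powr (- \<gamma>)) - ln (1 + t)\<bar> \<le> e) sequentially"
proof -
  have "eventually (\<lambda>n. 1 / real n < e) sequentially" using e by real_asymp
  then show ?thesis using eventually_gt_at_top[of 0]
  proof eventually_elim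
    case (elim n)
    show ?case
    proof
      fix t assume t: "t \<in> {0..T}"
      define m where "m = nat \<lfloor>real n + real n * t\<rfloor>"
      have "real m = of_int \<lfloor>real n + real n * t\<rfloor>" unfolding m_def using t by (intro of_nat_nat) simp
      then have m: "real m \<le> real n + real n * t" "real n + real n * t < real m + 1" by linarith+
      have nm: "n \<le> m" unfolding m_def using t by (intro le_nat_floor) simp
      then have m0: "m > 0" using elim by simp
      have S: "(\<Sum>k=n..<m. real k powr (- \<gamma>)) = (\<Sum>k=n..<m. 1 / real k)"
        using elim by (intro sum.cong) (auto simp: g powr_minus inverse_eq_divide)
      have mn: "1 / real m \<le> 1 / real n" using nm elim by (intro divide_left_mono) auto
      have "ln (real m / real n) \<le> ln (1 + t)"
        using m m0 elim t by (intro ln_mono) (auto simp: field_simps)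
      moreover have "ln (1 + t) - ln (real m / real n) \<le> 1 / real m"
      proof -
        have "ln (1 + t) - ln (real m / real n) = ln ((1 + t) / (real m / real n))"
          using t m0 elim by (subst ln_div) auto
        also have "\<dots> \<le> (1 + t) / (real m / real n) - 1"
          using t m0 elim by (intro ln_le_minus_one) auto
        also have "\<dots> = (real n + real n * t - real m) / real m" using m0 elim by (simp add: field_simps)
        also have "\<dots> \<le> 1 / real m" using m m0 by (intro divide_right_mono) auto
        finally show ?thesis .
      qed
      moreover note harmonic_window[OF elim(2) nm]
      moreover have "0 \<le> 1 / real m" by simp
      ultimately show "\<bar>(\<Sum>k=n..<nat \<lfloor>real n + real n * t\<rfloor>. real k powr (- \<gamma>)) - ln (1 + t)\<bar> \<le> e"
        unfolding m_def[symmetric] S using elim(1) mn by (simp add: abs_le_iff)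
    qed
  qed
qed

lemma window_ratio_linear:
  assumes t: "t \<ge> 0"
  shows "(\<lambda>n. real n / real (nat \<lfloor>real n + real n * t\<rfloor>)) \<longlonglongrightarrow> 1 / (1 + t)"
proof (rule tendsto_sandwich)
  have *: "1 / (1 + t) \<le> real n / real m \<and> real n / real m \<le> real n / (real n * (1 + t) - 1)"
    if n: "n > 1" and m_def: "m = nat \<lfloor>real n + real n * t\<rfloor>" for n m
  proof -
    have "real m = of_int \<lfloor>real n + real n * t\<rfloor>" unfolding m_def using t by (intro of_nat_nat) simp
    then have m: "real m \<le> real n + real n * t" "real n + real n * t < real m + 1" by linarith+
    have nm: "n \<le> m" unfolding m_def using t by (intro le_nat_floor) simp
    have pos: "real n * (1 + t) - 1 > 0"
    proof -
      have "real n * 1 \<le> real n * (1 + t)" using t by (intro mult_left_mono) auto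
      moreover have "real n > 1" using n by simp
      ultimately show ?thesis by linarith
    qed
    have "real n / real m \<le> real n / (real n * (1 + t) - 1)"
    proof (rule divide_left_mono)
      show "real n * (1 + t) - 1 \<le> real m" using m by (simp add: algebra_simps)
      show "0 < real m * (real n * (1 + t) - 1)" using pos nm n by (intro mult_pos_pos) auto
    qed simp
    moreover have "1 / (1 + t) \<le> real n / real m" using m nm n t by (simp add: field_simps)
    ultimately show ?thesis by simp
  qed
  show "eventually (\<lambda>n. 1 / (1 + t) \<le> real n / real (nat \<lfloor>real n + real n * t\<rfloor>)) sequentially"
    using eventually_gt_at_top[of 1] by eventually_elim (use * in blast)
  show "eventually (\<lambda>n. real n / real (nat \<lfloor>real n + real n * t\<rfloor>) \<le> real n / (real n * (1 + t) - 1)) sequentially"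
    using eventually_gt_at_top[of 1] by eventually_elim (use * in blast)
  have "1 + t > 0" using t by simp
  then have "(\<lambda>n. real n / (real n * (1 + t) - 1)) \<longlonglongrightarrow> inverse (1 + t)" by real_asymp
  then show "(\<lambda>n. real n / (real n * (1 + t) - 1)) \<longlonglongrightarrow> 1 / (1 + t)" by (simp add: inverse_eq_divide)
qed simp

end

section \<open>The interacting reinforced system\<close>

lemma (in prob_space) expectation_abs_le_sqrt:
  fixes X :: "'a \<Rightarrow> real"
  assumes [measurable]: "X \<in> borel_measurable M" and "\<And>\<omega>. \<omega> \<in> space M \<Longrightarrow> \<bar>X \<omega>\<bar> \<le> C"
  shows "expectation (\<lambda>\<omega>. \<bar>X \<omega>\<bar>) \<le> sqrt (expectation (\<lambda>\<omega>. (X \<omega>)\<^sup>2))"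
proof (rule real_le_rsqrt)
  have i1: "integrable M (\<lambda>\<omega>. \<bar>X \<omega>\<bar>)"
    by (rule integrable_const_bound[where B=C]) (use assms in auto)
  have i2: "integrable M (\<lambda>\<omega>. \<bar>X \<omega>\<bar>\<^sup>2)"
  proof (rule integrable_const_bound[where B="C\<^sup>2"], rule AE_I2)
    fix \<omega> assume "\<omega> \<in> space M"
    then have "\<bar>X \<omega>\<bar>\<^sup>2 \<le> C\<^sup>2" using assms(2) by (intro power_mono) auto
    then show "norm (\<bar>X \<omega>\<bar>\<^sup>2) \<le> C\<^sup>2" by simp
  qed measurable
  show "(expectation (\<lambda>\<omega>. \<bar>X \<omega>\<bar>))\<^sup>2 \<le> expectation (\<lambda>\<omega>. (X \<omega>)\<^sup>2)"
    using variance_eq[OF i1 i2] variance_positive[of "\<lambda>\<omega>. \<bar>X \<omega>\<bar>"] by simp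
qed

locale reinforced_system = prob_space M for M :: "'a measure" +
  fixes N :: nat and \<rho> \<alpha> q :: real and r :: "nat \<Rightarrow> real"
    and Z :: "nat \<Rightarrow> nat \<Rightarrow> 'a \<Rightarrow> real" and I :: "nat \<Rightarrow> nat \<Rightarrow> 'a \<Rightarrow> real"
  assumes N: "N \<ge> 1" and rho: "0 \<le> \<rho>" "\<rho> < 1" and alpha: "0 \<le> \<alpha>" "\<alpha> \<le> 1"
    and q: "0 < q" "q < 1" and r01: "\<And>n. 0 \<le> r n \<and> r n < 1"
    and Z_meas: "\<And>n i. i \<in> {1..N} \<Longrightarrow> Z n i \<in> borel_measurable M"
    and Z_range: "\<And>n i \<omega>. i \<in> {1..N} \<Longrightarrow> \<omega> \<in> space M \<Longrightarrow> 0 \<le> Z n i \<omega> \<and> Z n i \<omega> \<le> 1"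
    and I_meas: "\<And>n i. i \<in> {1..N} \<Longrightarrow> I (Suc n) i \<in> borel_measurable M"
    and I_range: "\<And>n i \<omega>. i \<in> {1..N} \<Longrightarrow> \<omega> \<in> space M \<Longrightarrow> I (Suc n) i \<omega> \<in> {0, 1}"
    and Z_rec: "\<And>n i \<omega>. i \<in> {1..N} \<Longrightarrow> \<omega> \<in> space M \<Longrightarrow>
        Z (Suc n) i \<omega> = (1 - r n) * Z n i \<omega> + r n * (\<rho> * I (Suc n) i \<omega> + (1 - \<rho>) * q)"
    and I_indep: "\<And>n. cond_indep M (nat_filtration M N Z n) N (I (Suc n))"
    and I_prob: "\<And>n i. i \<in> {1..N} \<Longrightarrow>
        AE \<omega> in M. real_cond_exp M (nat_filtration M N Z n)
                      (indicator {\<omega>\<in>space M. I (Suc n) i \<omega> = 1}) \<omega>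
                    = (1 - \<alpha>) * Z n i \<omega> + \<alpha> * avg N Z n \<omega>"
begin

abbreviation G :: "nat \<Rightarrow> 'a measure" where "G n \<equiv> nat_filtration M N Z n"

definition p :: "nat \<Rightarrow> nat \<Rightarrow> 'a \<Rightarrow> real" where
  "p n i \<omega> = (1 - \<alpha>) * Z n i \<omega> + \<alpha> * avg N Z n \<omega>"

text \<open>The noise of the mean. It is conditionally centred because the interaction preserves
  averages: the \<open>p n i\<close> have average \<open>avg N Z n\<close> for every
  \<alpha>.\<close>

definition \<xi> :: "nat \<Rightarrow> 'a \<Rightarrow> real" where
  "\<xi> n \<omega> = (\<Sum>i=1..N. I (Suc n) i \<omega>) / real N - avg N Z n \<omega>"

text \<open>The conditional variance of \<open>\<xi> n\<close>: the variances of conditionally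
  independent Bernoulli variables add up.\<close>

definition \<kappa> :: "nat \<Rightarrow> 'a \<Rightarrow> real" where
  "\<kappa> n \<omega> = (\<Sum>i=1..N. p n i \<omega> * (1 - p n i \<omega>)) / (real N)\<^sup>2"

section \<open>The natural filtration and elementary bounds\<close>

lemma generators: "{Z k i -` A \<inter> space M |k i A. k \<le> n \<and> i \<in> {1..N} \<and> A \<in> sets borel} \<subseteq> sets M"
  using Z_meas by (auto intro: measurable_sets)

lemma space_G [simp]: "space (G n) = space M"
  unfolding nat_filtration_def by (rule space_measure_of) auto

lemma sets_G: "sets (G n) = sigma_sets (space M) {Z k i -` A \<inter> space M |k i A. k \<le> n \<and> i \<in> {1..N} \<and> A \<in> sets borel}"
  unfolding nat_filtration_def by (rule sets_measure_of) auto

lemma subalgebra_G: "subalgebra M (G n)"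
  unfolding subalgebra_def sets_G using sets.sigma_sets_subset[OF generators] by simp

lemma subalgebra_G_Suc: "subalgebra (G (Suc n)) (G n)"
  unfolding subalgebra_def sets_G space_G
  by (intro conjI refl sigma_sets_mono' Collect_mono) (blast intro: le_SucI)

lemma Z_meas_G:
  assumes "i \<in> {1..N}" "k \<le> n"
  shows "Z k i \<in> borel_measurable (G n)"
proof (rule measurableI)
  fix A :: "real set" assume "A \<in> sets borel"
  then show "Z k i -` A \<inter> space (G n) \<in> sets (G n)"
    unfolding sets_G space_G using assms by (intro sigma_sets.Basic) blast
qed simp

lemma avg_meas_G: "k \<le> n \<Longrightarrow> avg N Z k \<in> borel_measurable (G n)"
  unfolding avg_def[abs_def] by (intro borel_measurable_divide borel_measurable_sum Z_meas_G) auto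

lemma G_measD: "f \<in> borel_measurable (G n) \<Longrightarrow> f \<in> borel_measurable M"
  by (rule measurable_from_subalg[OF subalgebra_G])

lemma p_meas_G: "i \<in> {1..N} \<Longrightarrow> p n i \<in> borel_measurable (G n)"
  unfolding p_def[abs_def]
  by (intro borel_measurable_add borel_measurable_times Z_meas_G avg_meas_G) auto

lemma avg_range:
  assumes "\<omega> \<in> space M"
  shows "0 \<le> avg N Z n \<omega>" "avg N Z n \<omega> \<le> 1"
proof -
  show "0 \<le> avg N Z n \<omega>" unfolding avg_def using Z_range assms by (intro divide_nonneg_nonneg sum_nonneg) auto
  have "(\<Sum>i=1..N. Z n i \<omega>) \<le> (\<Sum>i=1..N. 1)" using Z_range assms by (intro sum_mono) auto
  then show "avg N Z n \<omega> \<le> 1" unfolding avg_def using N by simp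
qed

lemma p_range:
  assumes "\<omega> \<in> space M" "i \<in> {1..N}"
  shows "0 \<le> p n i \<omega>" "p n i \<omega> \<le> 1"
proof -
  show "0 \<le> p n i \<omega>" unfolding p_def using Z_range[OF assms(2,1)] avg_range[OF assms(1)] alpha by simp
  have "p n i \<omega> \<le> (1 - \<alpha>) * 1 + \<alpha> * 1"
    unfolding p_def using Z_range[OF assms(2,1)] avg_range[OF assms(1)] alpha
    by (intro add_mono mult_left_mono) auto
  then show "p n i \<omega> \<le> 1" by simp
qed

lemma integrable_bdd:
  fixes f :: "'a \<Rightarrow> real"
  assumes "f \<in> borel_measurable M" "\<And>\<omega>. \<omega> \<in> space M \<Longrightarrow> \<bar>f \<omega>\<bar> \<le> B"
  shows "integrable M f"
  using assms by (intro integrable_const_bound[where B=B] AE_I2) auto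

lemma bounded_mult:
  fixes x y :: real
  shows "\<bar>x\<bar> \<le> B \<Longrightarrow> \<bar>y\<bar> \<le> 1 \<Longrightarrow> \<bar>x * y\<bar> \<le> B"
  using mult_mono[of "\<bar>x\<bar>" B "\<bar>y\<bar>" 1] by (simp add: abs_mult)

section \<open>Conditional moments of the noise\<close>

lemma I_abs: "i \<in> {1..N} \<Longrightarrow> \<omega> \<in> space M \<Longrightarrow> \<bar>I (Suc n) i \<omega>\<bar> \<le> 1"
  using I_range[of i \<omega> n] by auto

lemma p_abs: "i \<in> {1..N} \<Longrightarrow> \<omega> \<in> space M \<Longrightarrow> \<bar>p n i \<omega>\<bar> \<le> 1"
  using p_range[of \<omega> i n] by auto

text \<open>A variable with values 0 and 1 is the indicator of its being 1, so the assumed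
  conditional probability is its conditional expectation; testing against \<open>H\<close> removes
  the conditioning.\<close>

lemma expectation_I:
  assumes H: "H \<in> borel_measurable (G n)" "\<And>\<omega>. \<omega> \<in> space M \<Longrightarrow> \<bar>H \<omega>\<bar> \<le> B" and i: "i \<in> {1..N}"
  shows "expectation (\<lambda>\<omega>. H \<omega> * I (Suc n) i \<omega>) = expectation (\<lambda>\<omega>. H \<omega> * p n i \<omega>)"
proof -
  interpret C: finite_measure_subalgebra M "G n"
    by unfold_locales (rule subalgebra_G)
  note [measurable] = G_measD[OF H(1)] I_meas[OF i] G_measD[OF p_meas_G[OF i]]
  define J where "J = (indicator {\<omega>\<in>space M. I (Suc n) i \<omega> = 1} :: 'a \<Rightarrow> real)"
  have [measurable]: "J \<in> borel_measurable M" unfolding J_def by measurable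
  have JI: "J \<omega> = I (Suc n) i \<omega>" if "\<omega> \<in> space M" for \<omega>
    using I_range[OF i that, of n] that by (auto simp: J_def)
  have "expectation (\<lambda>\<omega>. H \<omega> * I (Suc n) i \<omega>) = expectation (\<lambda>\<omega>. H \<omega> * J \<omega>)"
    by (intro Bochner_Integration.integral_cong) (auto simp: JI)
  also have "\<dots> = expectation (\<lambda>\<omega>. H \<omega> * real_cond_exp M (G n) J \<omega>)"
  proof (rule C.real_cond_exp_intg(2)[symmetric])
    show "integrable M (\<lambda>\<omega>. H \<omega> * J \<omega>)"
      by (rule integrable_bdd[where B=B]) (auto intro!: bounded_mult H(2) simp: JI I_abs[OF i])
  qed (use H in measurable)
  also have "\<dots> = expectation (\<lambda>\<omega>. H \<omega> * p n i \<omega>)"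
  proof (rule integral_cong_AE)
    show "AE \<omega> in M. H \<omega> * real_cond_exp M (G n) J \<omega> = H \<omega> * p n i \<omega>"
      using I_prob[OF i, of n] unfolding J_def p_def by eventually_elim simp
  qed measurable
  finally show ?thesis .
qed

text \<open>Conditional independence is given for all \<open>N\<close> variables at once. Choosing
  \<open>UNIV\<close> for every index other than \<open>i\<close> and \<open>j\<close> makes the
  other factors 1 and isolates the pair.\<close>

lemma expectation_II:
  assumes H: "H \<in> borel_measurable (G n)" "\<And>\<omega>. \<omega> \<in> space M \<Longrightarrow> \<bar>H \<omega>\<bar> \<le> B"
    and i: "i \<in> {1..N}" and j: "j \<in> {1..N}" and ij: "i \<noteq> j"
  shows "expectation (\<lambda>\<omega>. H \<omega> * (I (Suc n) i \<omega> * I (Suc n) j \<omega>)) = expectation (\<lambda>\<omega>. H \<omega> * (p n i \<omega> * p n j \<omega>))"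
proof -
  interpret C: finite_measure_subalgebra M "G n"
    by unfold_locales (rule subalgebra_G)
  note [measurable] = G_measD[OF H(1)] I_meas[OF i] I_meas[OF j] G_measD[OF p_meas_G[OF i]] G_measD[OF p_meas_G[OF j]]
  define A where "A k = (if k = i \<or> k = j then {1::real} else UNIV)" for k
  define J where "J \<omega> = (\<Prod>k=1..N. indicator (A k) (I (Suc n) k \<omega>) :: real)" for \<omega>
  have prod2: "(\<Prod>k=1..N. f k) = f i * f j" if "\<And>k. k \<noteq> i \<Longrightarrow> k \<noteq> j \<Longrightarrow> f k = 1" for f :: "nat \<Rightarrow> real"
  proof -
    have "(\<Prod>k=1..N. f k) = (\<Prod>k\<in>{i, j}. f k)"
      by (rule prod.mono_neutral_right) (use i j that in auto)
    then show ?thesis using ij by simp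
  qed
  have ind: "indicator {1} (I (Suc n) k \<omega>) = I (Suc n) k \<omega>" if "k \<in> {1..N}" "\<omega> \<in> space M" for k \<omega>
    using I_range[OF that, of n] by auto
  have JI: "J \<omega> = I (Suc n) i \<omega> * I (Suc n) j \<omega>" if "\<omega> \<in> space M" for \<omega>
    unfolding J_def by (subst prod2) (auto simp: A_def ind[OF i that] ind[OF j that])
  have [measurable]: "J \<in> borel_measurable M"
    by (subst measurable_cong[of M _ "\<lambda>\<omega>. I (Suc n) i \<omega> * I (Suc n) j \<omega>"]) (auto simp: JI)
  have ce: "AE \<omega> in M. real_cond_exp M (G n) (\<lambda>\<omega>. indicator (A k) (I (Suc n) k \<omega>)) \<omega> = p n k \<omega>"
    if k: "k \<in> {1..N}" "k = i \<or> k = j" for k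
  proof -
    note [measurable] = I_meas[OF k(1)]
    have "AE \<omega> in M. real_cond_exp M (G n) (\<lambda>\<omega>. indicator (A k) (I (Suc n) k \<omega>)) \<omega> =
        real_cond_exp M (G n) (indicator {\<omega>\<in>space M. I (Suc n) k \<omega> = 1}) \<omega>"
      by (rule C.real_cond_exp_cong) (use k in \<open>auto simp: A_def indicator_def intro!: AE_I2\<close>)
    then show ?thesis using I_prob[OF k(1), of n] unfolding p_def by eventually_elim simp
  qed
  have ce1: "AE \<omega> in M. real_cond_exp M (G n) (\<lambda>\<omega>. indicator (A k) (I (Suc n) k \<omega>)) \<omega> = 1"
    if k: "k \<noteq> i" "k \<noteq> j" for k
    using C.real_cond_exp_F_meas[of "\<lambda>_. 1"] k by (simp add: A_def)
  have "AE \<omega> in M. \<forall>k\<in>{1..N}. real_cond_exp M (G n) (\<lambda>\<omega>. indicator (A k) (I (Suc n) k \<omega>)) \<omega>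
      = (if k = i \<or> k = j then p n k \<omega> else 1)"
    by (rule AE_finite_allI) (use ce ce1 in auto)
  moreover have "AE \<omega> in M. real_cond_exp M (G n) J \<omega>
      = (\<Prod>k=1..N. real_cond_exp M (G n) (\<lambda>\<omega>. indicator (A k) (I (Suc n) k \<omega>)) \<omega>)"
    using I_indep[of n] unfolding cond_indep_def J_def[abs_def] by (rule allE[of _ A]) (auto simp: A_def)
  ultimately have cJ: "AE \<omega> in M. real_cond_exp M (G n) J \<omega> = p n i \<omega> * p n j \<omega>"
  proof eventually_elim
    case (elim \<omega>)
    have "(\<Prod>k=1..N. real_cond_exp M (G n) (\<lambda>\<omega>. indicator (A k) (I (Suc n) k \<omega>)) \<omega>)
        = (\<Prod>k=1..N. if k = i \<or> k = j then p n k \<omega> else 1)"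
      using elim(1) by (intro prod.cong) auto
    also have "\<dots> = p n i \<omega> * p n j \<omega>" by (subst prod2) auto
    finally show ?case using elim(2) by simp
  qed
  have "expectation (\<lambda>\<omega>. H \<omega> * (I (Suc n) i \<omega> * I (Suc n) j \<omega>)) = expectation (\<lambda>\<omega>. H \<omega> * J \<omega>)"
    by (intro Bochner_Integration.integral_cong) (auto simp: JI)
  also have "\<dots> = expectation (\<lambda>\<omega>. H \<omega> * real_cond_exp M (G n) J \<omega>)"
  proof (rule C.real_cond_exp_intg(2)[symmetric])
    show "integrable M (\<lambda>\<omega>. H \<omega> * J \<omega>)"
      by (rule integrable_bdd[where B=B]) (auto intro!: bounded_mult H(2) simp: JI I_abs[OF i] I_abs[OF j])
  qed (use H in measurable)
  also have "\<dots> = expectation (\<lambda>\<omega>. H \<omega> * (p n i \<omega> * p n j \<omega>))"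
    by (rule integral_cong_AE) (use cJ in \<open>auto elim: eventually_mono\<close>)
  finally show ?thesis .
qed

lemma sum_p: "(\<Sum>i=1..N. p n i \<omega>) = real N * avg N Z n \<omega>"
proof -
  have "(\<Sum>i=1..N. Z n i \<omega>) = real N * avg N Z n \<omega>" using N by (simp add: avg_def)
  then show ?thesis unfolding p_def by (simp add: sum.distrib sum_distrib_left[symmetric]) (simp add: algebra_simps)
qed

lemma \<xi>_eq: "\<xi> n \<omega> = (\<Sum>i=1..N. I (Suc n) i \<omega> - p n i \<omega>) / real N"
  unfolding \<xi>_def sum_subtractf sum_p using N by (simp add: diff_divide_distrib)

lemma \<xi>_meas [measurable]: "\<xi> n \<in> borel_measurable M"
  unfolding \<xi>_def[abs_def]
  by (intro borel_measurable_diff borel_measurable_divide borel_measurable_sum I_meas G_measD[OF avg_meas_G]) auto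

lemma \<xi>_abs:
  assumes "\<omega> \<in> space M"
  shows "\<bar>\<xi> n \<omega>\<bar> \<le> 1"
proof -
  have "0 \<le> I (Suc n) i \<omega> \<and> I (Suc n) i \<omega> \<le> 1" if "i \<in> {1..N}" for i
    using I_range[OF that assms, of n] by auto
  then have "0 \<le> (\<Sum>i=1..N. I (Suc n) i \<omega>)" "(\<Sum>i=1..N. I (Suc n) i \<omega>) \<le> (\<Sum>i=1..N. 1)"
    by (intro sum_nonneg sum_mono; simp)+
  then have "0 \<le> (\<Sum>i=1..N. I (Suc n) i \<omega>) / real N" "(\<Sum>i=1..N. I (Suc n) i \<omega>) / real N \<le> 1"
    using N by auto
  then show ?thesis unfolding \<xi>_def using avg_range[OF assms, of n] by linarith
qed

lemma expectation_centered_product: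
  assumes H: "H \<in> borel_measurable (G n)" "\<And>\<omega>. \<omega> \<in> space M \<Longrightarrow> \<bar>H \<omega>\<bar> \<le> B"
    and i: "i \<in> {1..N}" and j: "j \<in> {1..N}"
  shows "integrable M (\<lambda>\<omega>. H \<omega> * ((I (Suc n) i \<omega> - p n i \<omega>) * (I (Suc n) j \<omega> - p n j \<omega>)))"
    and "expectation (\<lambda>\<omega>. H \<omega> * ((I (Suc n) i \<omega> - p n i \<omega>) * (I (Suc n) j \<omega> - p n j \<omega>)))
      = (if i = j then expectation (\<lambda>\<omega>. H \<omega> * (p n i \<omega> * (1 - p n i \<omega>))) else 0)"
proof -
  note [measurable] = G_measD[OF H(1)] I_meas[OF i] I_meas[OF j] G_measD[OF p_meas_G[OF i]] G_measD[OF p_meas_G[OF j]]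
  note a = I_abs[OF i] I_abs[OF j] p_abs[OF i] p_abs[OF j]
  have Hp: "(\<lambda>\<omega>. H \<omega> * p n k \<omega>) \<in> borel_measurable (G n)" "\<And>\<omega>. \<omega> \<in> space M \<Longrightarrow> \<bar>H \<omega> * p n k \<omega>\<bar> \<le> B" if "k \<in> {1..N}" for k
    using H p_meas_G[OF that] p_abs[OF that] by (auto intro!: bounded_mult)
  have i1: "integrable M (\<lambda>\<omega>. H \<omega> * (I (Suc n) i \<omega> * I (Suc n) j \<omega>))"
    by (rule integrable_bdd[where B=B]) (auto intro!: bounded_mult H(2) a)
  have i2: "integrable M (\<lambda>\<omega>. H \<omega> * p n j \<omega> * I (Suc n) i \<omega>)"
    by (rule integrable_bdd[where B=B]) (auto intro!: bounded_mult H(2) a)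
  have i3: "integrable M (\<lambda>\<omega>. H \<omega> * p n i \<omega> * I (Suc n) j \<omega>)"
    by (rule integrable_bdd[where B=B]) (auto intro!: bounded_mult H(2) a)
  have i4: "integrable M (\<lambda>\<omega>. H \<omega> * (p n i \<omega> * p n j \<omega>))"
    by (rule integrable_bdd[where B=B]) (auto intro!: bounded_mult H(2) a)
  have i5: "integrable M (\<lambda>\<omega>. H \<omega> * p n i \<omega>)"
    by (rule integrable_bdd[where B=B]) (auto intro!: bounded_mult H(2) a)
  have eq: "H \<omega> * ((I (Suc n) i \<omega> - p n i \<omega>) * (I (Suc n) j \<omega> - p n j \<omega>)) =
      H \<omega> * (I (Suc n) i \<omega> * I (Suc n) j \<omega>) - H \<omega> * p n j \<omega> * I (Suc n) i \<omega>
      - H \<omega> * p n i \<omega> * I (Suc n) j \<omega> + H \<omega> * (p n i \<omega> * p n j \<omega>)" for \<omega>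
    by (simp add: algebra_simps)
  show "integrable M (\<lambda>\<omega>. H \<omega> * ((I (Suc n) i \<omega> - p n i \<omega>) * (I (Suc n) j \<omega> - p n j \<omega>)))"
    unfolding eq using i1 i2 i3 i4 by simp
  have "expectation (\<lambda>\<omega>. H \<omega> * ((I (Suc n) i \<omega> - p n i \<omega>) * (I (Suc n) j \<omega> - p n j \<omega>)))
    = expectation (\<lambda>\<omega>. H \<omega> * (I (Suc n) i \<omega> * I (Suc n) j \<omega>)) - expectation (\<lambda>\<omega>. H \<omega> * p n j \<omega> * I (Suc n) i \<omega>)
      - expectation (\<lambda>\<omega>. H \<omega> * p n i \<omega> * I (Suc n) j \<omega>) + expectation (\<lambda>\<omega>. H \<omega> * (p n i \<omega> * p n j \<omega>))"
    unfolding eq using i1 i2 i3 i4 by simp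
  also have "\<dots> = expectation (\<lambda>\<omega>. H \<omega> * (I (Suc n) i \<omega> * I (Suc n) j \<omega>)) - expectation (\<lambda>\<omega>. H \<omega> * (p n i \<omega> * p n j \<omega>))"
  proof -
    have "expectation (\<lambda>\<omega>. H \<omega> * p n j \<omega> * I (Suc n) i \<omega>) = expectation (\<lambda>\<omega>. H \<omega> * (p n i \<omega> * p n j \<omega>))"
      using expectation_I[OF Hp[OF j] i] by (simp add: mult_ac)
    moreover have "expectation (\<lambda>\<omega>. H \<omega> * p n i \<omega> * I (Suc n) j \<omega>) = expectation (\<lambda>\<omega>. H \<omega> * (p n i \<omega> * p n j \<omega>))"
      using expectation_I[OF Hp[OF i] j] by (simp add: mult_ac)
    ultimately show ?thesis by linarith
  qed
  also have "\<dots> = (if i = j then expectation (\<lambda>\<omega>. H \<omega> * (p n i \<omega> * (1 - p n i \<omega>))) else 0)"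
  proof (cases "i = j")
    case True
    have "expectation (\<lambda>\<omega>. H \<omega> * (I (Suc n) i \<omega> * I (Suc n) i \<omega>)) = expectation (\<lambda>\<omega>. H \<omega> * I (Suc n) i \<omega>)"
      using I_range[OF i, of _ n] by (intro Bochner_Integration.integral_cong refl) force
    then show ?thesis using True i4 i5 expectation_I[OF H i] by (simp add: right_diff_distrib)
  qed (simp add: expectation_II[OF H i j])
  finally show "expectation (\<lambda>\<omega>. H \<omega> * ((I (Suc n) i \<omega> - p n i \<omega>) * (I (Suc n) j \<omega> - p n j \<omega>)))
      = (if i = j then expectation (\<lambda>\<omega>. H \<omega> * (p n i \<omega> * (1 - p n i \<omega>))) else 0)" .
qed

lemma \<xi>_mean:
  assumes H: "H \<in> borel_measurable (G n)" "\<And>\<omega>. \<omega> \<in> space M \<Longrightarrow> \<bar>H \<omega>\<bar> \<le> B"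
  shows "expectation (\<lambda>\<omega>. H \<omega> * \<xi> n \<omega>) = 0"
proof -
  note [measurable] = G_measD[OF H(1)]
  have i1: "integrable M (\<lambda>\<omega>. H \<omega> * I (Suc n) i \<omega>)" if "i \<in> {1..N}" for i
    using I_meas[OF that] by (intro integrable_bdd[where B=B]) (auto intro!: bounded_mult H(2) I_abs[OF that])
  have i2: "integrable M (\<lambda>\<omega>. H \<omega> * p n i \<omega>)" if "i \<in> {1..N}" for i
    using G_measD[OF p_meas_G[OF that]] by (intro integrable_bdd[where B=B]) (auto intro!: bounded_mult H(2) p_abs[OF that])
  have "expectation (\<lambda>\<omega>. H \<omega> * \<xi> n \<omega>) = expectation (\<lambda>\<omega>. (\<Sum>i=1..N. H \<omega> * I (Suc n) i \<omega> - H \<omega> * p n i \<omega>) / real N)"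
    by (simp add: \<xi>_eq sum_distrib_left right_diff_distrib)
  also have "\<dots> = (\<Sum>i=1..N. expectation (\<lambda>\<omega>. H \<omega> * I (Suc n) i \<omega>) - expectation (\<lambda>\<omega>. H \<omega> * p n i \<omega>)) / real N"
    using i1 i2 by simp
  also have "\<dots> = 0" using expectation_I[OF H] by simp
  finally show ?thesis .
qed

text \<open>The square is a double sum whose off-diagonal terms vanish by conditional
  independence.\<close>

lemma \<xi>_variance:
  assumes H: "H \<in> borel_measurable (G n)" "\<And>\<omega>. \<omega> \<in> space M \<Longrightarrow> \<bar>H \<omega>\<bar> \<le> B"
  shows "expectation (\<lambda>\<omega>. H \<omega> * (\<xi> n \<omega>)\<^sup>2) = expectation (\<lambda>\<omega>. H \<omega> * \<kappa> n \<omega>)"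
proof -
  note [measurable] = G_measD[OF H(1)]
  have i2: "integrable M (\<lambda>\<omega>. H \<omega> * (p n i \<omega> * (1 - p n i \<omega>)))" if "i \<in> {1..N}" for i
    using G_measD[OF p_meas_G[OF that]] p_range[OF _ that]
    by (intro integrable_bdd[where B=B]) (auto intro!: bounded_mult H(2) p_abs[OF that])
  have "H \<omega> * (\<xi> n \<omega>)\<^sup>2 = (\<Sum>i=1..N. \<Sum>j=1..N. H \<omega> * ((I (Suc n) i \<omega> - p n i \<omega>) * (I (Suc n) j \<omega> - p n j \<omega>))) / (real N)\<^sup>2" for \<omega>
    unfolding \<xi>_eq power_divide power2_eq_square[of "sum _ _"] sum_product by (simp add: sum_distrib_left)
  then have "expectation (\<lambda>\<omega>. H \<omega> * (\<xi> n \<omega>)\<^sup>2)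
    = expectation (\<lambda>\<omega>. (\<Sum>i=1..N. \<Sum>j=1..N. H \<omega> * ((I (Suc n) i \<omega> - p n i \<omega>) * (I (Suc n) j \<omega> - p n j \<omega>))) / (real N)\<^sup>2)"
    by simp
  also have "\<dots> = (\<Sum>i=1..N. \<Sum>j=1..N. expectation (\<lambda>\<omega>. H \<omega> * ((I (Suc n) i \<omega> - p n i \<omega>) * (I (Suc n) j \<omega> - p n j \<omega>)))) / (real N)\<^sup>2"
  proof -
    define f where "f i j \<omega> = H \<omega> * ((I (Suc n) i \<omega> - p n i \<omega>) * (I (Suc n) j \<omega> - p n j \<omega>))" for i j \<omega>
    have fi: "integrable M (f i j)" if "i \<in> {1..N}" "j \<in> {1..N}" for i j
      unfolding f_def[abs_def] by (rule expectation_centered_product(1)[OF H that])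
    have "expectation (\<lambda>\<omega>. \<Sum>i=1..N. \<Sum>j=1..N. f i j \<omega>) = (\<Sum>i=1..N. expectation (\<lambda>\<omega>. \<Sum>j=1..N. f i j \<omega>))"
      by (intro Bochner_Integration.integral_sum Bochner_Integration.integrable_sum fi)
    also have "\<dots> = (\<Sum>i=1..N. \<Sum>j=1..N. expectation (f i j))"
      by (intro sum.cong refl Bochner_Integration.integral_sum fi)
    finally show ?thesis unfolding f_def by simp
  qed
  also have "\<dots> = (\<Sum>i=1..N. expectation (\<lambda>\<omega>. H \<omega> * (p n i \<omega> * (1 - p n i \<omega>)))) / (real N)\<^sup>2"
    by (simp add: expectation_centered_product(2)[OF H])
  also have "\<dots> = expectation (\<lambda>\<omega>. (\<Sum>i=1..N. H \<omega> * (p n i \<omega> * (1 - p n i \<omega>))) / (real N)\<^sup>2)"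
    using i2 by simp
  also have "\<dots> = expectation (\<lambda>\<omega>. H \<omega> * \<kappa> n \<omega>)"
    by (simp add: \<kappa>_def sum_distrib_left)
  finally show ?thesis .
qed

text \<open>The share \<rho> of each update reproduces the current mean up to noise, so only the
  share \<open>1 - \<rho>\<close> pulls towards \<open>q\<close>.\<close>

lemma avg_rec:
  assumes "\<omega> \<in> space M"
  shows "avg N Z (Suc n) \<omega> - q = (1 - (1 - \<rho>) * r n) * (avg N Z n \<omega> - q) + r n * \<rho> * \<xi> n \<omega>"
proof -
  have "(\<Sum>i=1..N. Z (Suc n) i \<omega>) =
     (1 - r n) * (\<Sum>i=1..N. Z n i \<omega>) + r n * \<rho> * (\<Sum>i=1..N. I (Suc n) i \<omega>) + real N * (r n * (1 - \<rho>) * q)"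
  proof -
    have "(\<Sum>i=1..N. Z (Suc n) i \<omega>) = (\<Sum>i=1..N. (1 - r n) * Z n i \<omega> + r n * \<rho> * I (Suc n) i \<omega> + r n * (1 - \<rho>) * q)"
    proof (intro sum.cong refl)
      fix i assume "i \<in> {1..N}"
      from Z_rec[OF this assms, of n]
      show "Z (Suc n) i \<omega> = (1 - r n) * Z n i \<omega> + r n * \<rho> * I (Suc n) i \<omega> + r n * (1 - \<rho>) * q"
        by (simp add: algebra_simps)
    qed
    then show ?thesis by (simp add: sum.distrib sum_distrib_left[symmetric])
  qed
  then have "avg N Z (Suc n) \<omega> = (1 - r n) * avg N Z n \<omega> + r n * \<rho> * ((\<Sum>i=1..N. I (Suc n) i \<omega>) / real N) + r n * (1 - \<rho>) * q"
    unfolding avg_def using N by (simp add: add_divide_distrib)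
  then show ?thesis unfolding \<xi>_def by (simp add: algebra_simps)
qed

section \<open>Mean-square convergence of the components\<close>

definition msd :: "nat \<Rightarrow> real" where
  "msd n = (\<Sum>i=1..N. expectation (\<lambda>\<omega>. (Z n i \<omega> - q)\<^sup>2))"

lemma deviation_abs: "i \<in> {1..N} \<Longrightarrow> \<omega> \<in> space M \<Longrightarrow> \<bar>Z n i \<omega> - q\<bar> \<le> 1"
  using Z_range[of i \<omega> n] q by auto

lemma integrable_deviation_sq: "i \<in> {1..N} \<Longrightarrow> integrable M (\<lambda>\<omega>. (Z n i \<omega> - q)\<^sup>2)"
  using deviation_abs Z_meas by (intro integrable_bdd[where B=1]) (auto simp: abs_square_le_1)

text \<open>Components, not just their mean, must be controlled, since the conditional variance
  depends on each of them. By Cauchy-Schwarz the mean-field term does not increase the sum of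
  squares, so the deviations contract at the same rate as the mean, up to an error of order
  \<open>(r n)^2\<close>.\<close>

lemma msd_rec: "msd (Suc n) \<le> (1 - (1 - \<rho>) * r n)\<^sup>2 * msd n + real N * (r n)\<^sup>2"
proof -
  define y where "y i \<omega> = Z n i \<omega> - q" for i \<omega>
  have ym: "y i \<in> borel_measurable (G n)" if "i \<in> {1..N}" for i
    unfolding y_def[abs_def] by (intro borel_measurable_diff Z_meas_G that) auto
  have yb: "\<bar>y i \<omega>\<bar> \<le> 1" if "i \<in> {1..N}" "\<omega> \<in> space M" for i \<omega>
    unfolding y_def by (rule deviation_abs[OF that])
  have i0: "integrable M (\<lambda>\<omega>. (y i \<omega>)\<^sup>2)" if "i \<in> {1..N}" for i
    unfolding y_def by (rule integrable_deviation_sq[OF that])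
  have i1: "integrable M (\<lambda>\<omega>. y i \<omega> * I (Suc n) i \<omega>)" if "i \<in> {1..N}" for i
    using G_measD[OF ym[OF that]] I_meas[OF that] by (intro integrable_bdd[where B=1]) (auto intro!: bounded_mult yb I_abs that)
  have i2: "integrable M (\<lambda>\<omega>. y i \<omega>)" if "i \<in> {1..N}" for i
    using G_measD[OF ym[OF that]] by (intro integrable_bdd[where B=1]) (auto intro!: yb that)
  have i3: "integrable M (\<lambda>\<omega>. y i \<omega> * p n i \<omega>)" if "i \<in> {1..N}" for i
    using G_measD[OF ym[OF that]] G_measD[OF p_meas_G[OF that]] by (intro integrable_bdd[where B=1]) (auto intro!: bounded_mult yb p_abs that)
  have rr: "0 \<le> r n" "r n \<le> 1" using r01[of n] by auto
  have one: "expectation (\<lambda>\<omega>. (Z (Suc n) i \<omega> - q)\<^sup>2) \<le>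
      (1 - r n)\<^sup>2 * expectation (\<lambda>\<omega>. (y i \<omega>)\<^sup>2) + 2 * (1 - r n) * r n * \<rho> * expectation (\<lambda>\<omega>. y i \<omega> * (p n i \<omega> - q)) + (r n)\<^sup>2"
    if i: "i \<in> {1..N}" for i
  proof -
    have "expectation (\<lambda>\<omega>. (Z (Suc n) i \<omega> - q)\<^sup>2) \<le> expectation (\<lambda>\<omega>. (1 - r n)\<^sup>2 * (y i \<omega>)\<^sup>2 +
        2 * (1 - r n) * r n * \<rho> * (y i \<omega> * I (Suc n) i \<omega> - q * y i \<omega>) + (r n)\<^sup>2)"
    proof (rule integral_mono)
      fix \<omega> assume \<omega>: "\<omega> \<in> space M"
      define z where "z = \<rho> * (I (Suc n) i \<omega> - q)"
      have "\<bar>I (Suc n) i \<omega> - q\<bar> \<le> 1" using I_range[OF i \<omega>, of n] q by auto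
      then have "\<bar>z\<bar> \<le> 1" unfolding z_def using rho mult_mono[of \<rho> 1 "\<bar>I (Suc n) i \<omega> - q\<bar>" 1] by (simp add: abs_mult)
      then have "(r n)\<^sup>2 * z\<^sup>2 \<le> (r n)\<^sup>2 * 1" by (intro mult_left_mono) (auto simp: abs_square_le_1)
      moreover have zz: "Z (Suc n) i \<omega> - q = (1 - r n) * y i \<omega> + r n * z"
        using Z_rec[OF i \<omega>, of n] by (simp add: y_def z_def algebra_simps)
      have "(Z (Suc n) i \<omega> - q)\<^sup>2 = (1 - r n)\<^sup>2 * (y i \<omega>)\<^sup>2 + 2 * (1 - r n) * r n * (y i \<omega> * z) + (r n)\<^sup>2 * z\<^sup>2"
        unfolding zz by (simp add: power2_eq_square algebra_simps)
      ultimately show "(Z (Suc n) i \<omega> - q)\<^sup>2 \<le> (1 - r n)\<^sup>2 * (y i \<omega>)\<^sup>2 +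
          2 * (1 - r n) * r n * \<rho> * (y i \<omega> * I (Suc n) i \<omega> - q * y i \<omega>) + (r n)\<^sup>2"
        by (simp add: z_def algebra_simps)
    qed (use i0[OF i] i1[OF i] i2[OF i] integrable_deviation_sq[OF i] in auto)
    also have "\<dots> = (1 - r n)\<^sup>2 * expectation (\<lambda>\<omega>. (y i \<omega>)\<^sup>2) +
        2 * (1 - r n) * r n * \<rho> * (expectation (\<lambda>\<omega>. y i \<omega> * I (Suc n) i \<omega>) - q * expectation (y i)) + (r n)\<^sup>2"
      using i0[OF i] i1[OF i] i2[OF i] by (simp add: prob_space)
    also have "expectation (\<lambda>\<omega>. y i \<omega> * I (Suc n) i \<omega>) - q * expectation (y i) = expectation (\<lambda>\<omega>. y i \<omega> * (p n i \<omega> - q))"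
    proof -
      have "expectation (\<lambda>\<omega>. y i \<omega> * I (Suc n) i \<omega>) = expectation (\<lambda>\<omega>. y i \<omega> * p n i \<omega>)"
        by (rule expectation_I[OF ym[OF i] _ i]) (rule yb[OF i])
      then show ?thesis using i2[OF i] i3[OF i] by (simp add: right_diff_distrib mult.commute[of q])
    qed
    finally show ?thesis .
  qed
  have cross: "(\<Sum>i=1..N. expectation (\<lambda>\<omega>. y i \<omega> * (p n i \<omega> - q))) \<le> msd n"
  proof -
    have "(\<Sum>i=1..N. expectation (\<lambda>\<omega>. y i \<omega> * (p n i \<omega> - q))) = expectation (\<lambda>\<omega>. \<Sum>i=1..N. y i \<omega> * (p n i \<omega> - q))"
      using i2 i3 by (subst Bochner_Integration.integral_sum) (auto simp: right_diff_distrib)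
    also have "\<dots> \<le> expectation (\<lambda>\<omega>. \<Sum>i=1..N. (y i \<omega>)\<^sup>2)"
    proof (rule integral_mono)
      fix \<omega> assume \<omega>: "\<omega> \<in> space M"
      define Y where "Y = (\<Sum>i=1..N. y i \<omega>)"
      have av: "avg N Z n \<omega> - q = Y / real N"
        unfolding avg_def Y_def y_def using N by (simp add: sum_subtractf diff_divide_distrib)
      have pq: "p n i \<omega> - q = (1 - \<alpha>) * y i \<omega> + \<alpha> * (Y / real N)" for i
        unfolding av[symmetric] p_def y_def by (simp add: algebra_simps)
      have CS: "Y * Y / real N \<le> (\<Sum>i=1..N. (y i \<omega>)\<^sup>2)"
      proof -
        have "Y\<^sup>2 \<le> (\<Sum>i=1..N. (y i \<omega>)\<^sup>2) * (\<Sum>i=1..N. 1\<^sup>2)"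
          using Cauchy_Schwarz_ineq_sum[of "\<lambda>i. y i \<omega>" "\<lambda>_. 1" "{1..N}"] by (simp add: Y_def)
        then show ?thesis using N by (simp add: power2_eq_square divide_le_eq)
      qed
      have "(\<Sum>i=1..N. y i \<omega> * (p n i \<omega> - q)) = (1 - \<alpha>) * (\<Sum>i=1..N. (y i \<omega>)\<^sup>2) + \<alpha> * (Y * Y / real N)"
      proof -
        have "(\<Sum>i=1..N. y i \<omega> * (p n i \<omega> - q)) = (\<Sum>i=1..N. (1 - \<alpha>) * (y i \<omega>)\<^sup>2 + y i \<omega> * (\<alpha> * (Y / real N)))"
          unfolding pq by (simp add: algebra_simps power2_eq_square)
        also have "\<dots> = (1 - \<alpha>) * (\<Sum>i=1..N. (y i \<omega>)\<^sup>2) + Y * (\<alpha> * (Y / real N))"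
          by (simp only: sum.distrib sum_distrib_left[symmetric] sum_distrib_right[symmetric] Y_def[symmetric])
        finally show ?thesis by simp
      qed
      also have "\<dots> \<le> (1 - \<alpha>) * (\<Sum>i=1..N. (y i \<omega>)\<^sup>2) + \<alpha> * (\<Sum>i=1..N. (y i \<omega>)\<^sup>2)"
        using CS alpha by (intro add_left_mono mult_left_mono) auto
      finally show "(\<Sum>i=1..N. y i \<omega> * (p n i \<omega> - q)) \<le> (\<Sum>i=1..N. (y i \<omega>)\<^sup>2)" by (simp add: algebra_simps)
    qed (use i0 i2 i3 in \<open>auto simp: right_diff_distrib\<close>)
    also have "\<dots> = msd n" unfolding msd_def y_def[symmetric] using i0 by simp
    finally show ?thesis .
  qed
  have msd0: "0 \<le> msd n" unfolding msd_def by (intro sum_nonneg) simp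
  have "msd (Suc n) \<le> (\<Sum>i=1..N. (1 - r n)\<^sup>2 * expectation (\<lambda>\<omega>. (y i \<omega>)\<^sup>2) +
      2 * (1 - r n) * r n * \<rho> * expectation (\<lambda>\<omega>. y i \<omega> * (p n i \<omega> - q)) + (r n)\<^sup>2)"
    unfolding msd_def[of "Suc n"] by (intro sum_mono one)
  also have "\<dots> = (1 - r n)\<^sup>2 * msd n + 2 * (1 - r n) * r n * \<rho> * (\<Sum>i=1..N. expectation (\<lambda>\<omega>. y i \<omega> * (p n i \<omega> - q))) + real N * (r n)\<^sup>2"
    by (simp add: sum.distrib sum_distrib_left[symmetric] msd_def y_def)
  also have "\<dots> \<le> (1 - r n)\<^sup>2 * msd n + 2 * (1 - r n) * r n * \<rho> * msd n + real N * (r n)\<^sup>2"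
    using cross rr rho by (intro add_mono mult_left_mono) auto
  also have "\<dots> = (1 - (1 - \<rho>) * r n)\<^sup>2 * msd n - (r n * \<rho>)\<^sup>2 * msd n + real N * (r n)\<^sup>2"
    by (simp add: power2_eq_square algebra_simps)
  also have "\<dots> \<le> (1 - (1 - \<rho>) * r n)\<^sup>2 * msd n + real N * (r n)\<^sup>2" using msd0 by simp
  finally show ?thesis .
qed

section \<open>The conditional variance near its limit\<close>

lemma \<kappa>_meas: "\<kappa> n \<in> borel_measurable M"
proof -
  have "(\<lambda>\<omega>. p n i \<omega> * (1 - p n i \<omega>)) \<in> borel_measurable M" if "i \<in> {1..N}" for i
    using G_measD[OF p_meas_G[OF that]] by measurable
  then show ?thesis unfolding \<kappa>_def[abs_def] by (intro borel_measurable_divide borel_measurable_sum) auto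
qed

text \<open>The function \<open>p (1 - p)\<close> minus its value at \<open>q\<close> is
  \<open>(p - q) (1 - p - q)\<close>, whose second factor has modulus at most 1. Mixing each
  component with the mean does not increase the total deviation.\<close>

lemma \<kappa>_dev:
  assumes \<omega>: "\<omega> \<in> space M"
  shows "\<bar>\<kappa> n \<omega> - q * (1 - q) / real N\<bar> \<le> (\<Sum>i=1..N. \<bar>Z n i \<omega> - q\<bar>)"
proof -
  define Y where "Y = (\<Sum>i=1..N. \<bar>Z n i \<omega> - q\<bar>)"
  have Y0: "Y \<ge> 0" unfolding Y_def by (intro sum_nonneg) auto
  have "q * (1 - q) / real N = (\<Sum>i=1..N. q * (1 - q)) / (real N)\<^sup>2" using N by (simp add: power2_eq_square)
  then have "\<kappa> n \<omega> - q * (1 - q) / real N = (\<Sum>i=1..N. (p n i \<omega> - q) * (1 - p n i \<omega> - q)) / (real N)\<^sup>2"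
    unfolding \<kappa>_def by (simp only: diff_divide_distrib[symmetric] sum_subtractf[symmetric])
      (simp add: algebra_simps)
  also have "\<bar>\<dots>\<bar> \<le> (\<Sum>i=1..N. \<bar>p n i \<omega> - q\<bar>) / (real N)\<^sup>2"
    unfolding abs_divide
  proof (simp, intro divide_right_mono order_trans[OF sum_abs sum_mono])
    fix i assume i: "i \<in> {Suc 0..N}"
    then have "\<bar>1 - p n i \<omega> - q\<bar> \<le> 1" using p_range[OF \<omega>, of i n] q by auto
    then show "\<bar>(p n i \<omega> - q) * (1 - p n i \<omega> - q)\<bar> \<le> \<bar>p n i \<omega> - q\<bar>" by (intro bounded_mult) auto
  qed simp
  also have "\<dots> \<le> (\<Sum>i=1..N. \<bar>p n i \<omega> - q\<bar>)"
  proof -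
    have "1 \<le> (real N)\<^sup>2" using N by simp
    then have "(\<Sum>i=1..N. \<bar>p n i \<omega> - q\<bar>) / (real N)\<^sup>2 \<le> (\<Sum>i=1..N. \<bar>p n i \<omega> - q\<bar>) / 1"
      using N by (intro divide_left_mono sum_nonneg) auto
    then show ?thesis by simp
  qed
  also have "\<dots> \<le> (\<Sum>i=1..N. (1 - \<alpha>) * \<bar>Z n i \<omega> - q\<bar> + \<alpha> * (Y / real N))"
  proof (rule sum_mono)
    fix i
    have "\<bar>avg N Z n \<omega> - q\<bar> \<le> Y / real N"
    proof -
      have "avg N Z n \<omega> - q = (\<Sum>i=1..N. Z n i \<omega> - q) / real N"
        unfolding avg_def using N by (simp add: sum_subtractf diff_divide_distrib)
      then show ?thesis unfolding Y_def by (simp add: divide_right_mono)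
    qed
    then have "\<alpha> * \<bar>avg N Z n \<omega> - q\<bar> \<le> \<alpha> * (Y / real N)" using alpha by (intro mult_left_mono) auto
    moreover have "p n i \<omega> - q = (1 - \<alpha>) * (Z n i \<omega> - q) + \<alpha> * (avg N Z n \<omega> - q)" by (simp add: p_def algebra_simps)
    then have "\<bar>p n i \<omega> - q\<bar> \<le> (1 - \<alpha>) * \<bar>Z n i \<omega> - q\<bar> + \<alpha> * \<bar>avg N Z n \<omega> - q\<bar>"
      using alpha abs_triangle_ineq[of "(1 - \<alpha>) * (Z n i \<omega> - q)" "\<alpha> * (avg N Z n \<omega> - q)"] by (simp add: abs_mult)
    ultimately show "\<bar>p n i \<omega> - q\<bar> \<le> (1 - \<alpha>) * \<bar>Z n i \<omega> - q\<bar> + \<alpha> * (Y / real N)" by linarith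
  qed
  also have "\<dots> = (1 - \<alpha>) * Y + \<alpha> * Y"
    using N by (simp add: sum.distrib sum_distrib_left[symmetric] Y_def)
  also have "\<dots> = Y" by (simp add: algebra_simps)
  finally show ?thesis unfolding Y_def .
qed

lemma \<kappa>_dev_expectation: "expectation (\<lambda>\<omega>. \<bar>\<kappa> n \<omega> - q * (1 - q) / real N\<bar>) \<le> real N * sqrt (msd n)"
proof -
  have i: "integrable M (\<lambda>\<omega>. \<bar>Z n i \<omega> - q\<bar>)" if "i \<in> {1..N}" for i
    using Z_meas[OF that] deviation_abs[OF that] by (intro integrable_bdd[where B=1]) auto
  have iS: "integrable M (\<lambda>\<omega>. \<Sum>i=1..N. \<bar>Z n i \<omega> - q\<bar>)" using i by auto
  have m [measurable]: "\<kappa> n \<in> borel_measurable M" by (rule \<kappa>_meas)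
  have "integrable M (\<lambda>\<omega>. \<bar>\<kappa> n \<omega> - q * (1 - q) / real N\<bar>)"
    by (rule Bochner_Integration.integrable_bound[OF iS]) (use \<kappa>_dev in \<open>auto intro!: AE_I2 order_trans[OF \<kappa>_dev]\<close>)
  then have "expectation (\<lambda>\<omega>. \<bar>\<kappa> n \<omega> - q * (1 - q) / real N\<bar>) \<le> expectation (\<lambda>\<omega>. \<Sum>i=1..N. \<bar>Z n i \<omega> - q\<bar>)"
    using iS \<kappa>_dev by (intro integral_mono) auto
  also have "\<dots> = (\<Sum>i=1..N. expectation (\<lambda>\<omega>. \<bar>Z n i \<omega> - q\<bar>))" using i by simp
  also have "\<dots> \<le> (\<Sum>i=1..N. sqrt (msd n))"
  proof (rule sum_mono)
    fix i assume i: "i \<in> {1..N}"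
    have "expectation (\<lambda>\<omega>. \<bar>Z n i \<omega> - q\<bar>) \<le> sqrt (expectation (\<lambda>\<omega>. (Z n i \<omega> - q)\<^sup>2))"
      using Z_meas[OF i] deviation_abs[OF i] by (intro expectation_abs_le_sqrt) auto
    also have "\<dots> \<le> sqrt (msd n)"
      unfolding msd_def using i by (intro real_sqrt_le_mono member_le_sum) auto
    finally show "expectation (\<lambda>\<omega>. \<bar>Z n i \<omega> - q\<bar>) \<le> sqrt (msd n)" .
  qed
  finally show ?thesis by simp
qed

end

section \<open>Fluctuations around the limit\<close>

text \<open>The functions \<open>h\<close> and \<open>V\<close> are prescribed only for \<open>t \<ge> 0\<close>, since \<open>(1 + t) powr x\<close> and \<open>exp (x * ln (1 + t))\<close>
  differ at \<open>t = -1\<close>.\<close>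

lemma (in reinforced_system) fluctuation_clt:
  fixes \<gamma> c :: real and v :: "nat \<Rightarrow> real" and \<phi> a h V :: "real \<Rightarrow> real"
  assumes ss: "step_sizes r \<gamma> c (1 - \<rho>)" and BM: "brownian_motion M' W"
    and v: "\<And>n. v n \<ge> 0" and \<phi>: "continuous_on {0..} \<phi>"
    and sums: "\<And>T e. T > 0 \<Longrightarrow> e > 0 \<Longrightarrow> eventually (\<lambda>n. \<forall>t\<in>{0..T}.
        \<bar>(\<Sum>k=n..<nat \<lfloor>real n + v n * t\<rfloor>. real k powr (- \<gamma>)) - \<phi> t\<bar> \<le> e) sequentially"
    and ratio: "\<And>t. t \<ge> 0 \<Longrightarrow> (\<lambda>n. real n / real (nat \<lfloor>real n + v n * t\<rfloor>)) \<longlonglongrightarrow> a t"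
    and a: "\<And>t. t \<ge> 0 \<Longrightarrow> a t > 0"
    and h: "\<And>t. t \<ge> 0 \<Longrightarrow> h t = exp (c * (1 - \<rho>) * \<phi> t)"
    and V: "\<And>t. t \<ge> 0 \<Longrightarrow> V t = q * (1 - q) / real N * (\<rho>\<^sup>2 *
        (a t powr \<gamma> * exp (2 * (c * (1 - \<rho>) * \<phi> t)) * (c\<^sup>2 / (2 * c * (1 - \<rho>) - (if \<gamma> = 1 then 1 else 0)))))"
    and V_cont: "continuous_on {0..} V" and V_mono: "\<rho> > 0 \<Longrightarrow> strict_mono_on {0..} V"
  shows "conv_distr_D M (\<lambda>n \<omega> t. real n powr (\<gamma> / 2) * h t * (avg N Z (nat \<lfloor>real n + v n * t\<rfloor>) \<omega> - q))
    M' (\<lambda>\<omega> t. W (V t) \<omega>)"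
proof -
  interpret SS: step_sizes r \<gamma> c "1 - \<rho>" by (rule ss)
  interpret M': prob_space M' using BM by (simp add: brownian_motion_def)
  note b_pos = SS.b_pos
  define m where "m n t = nat \<lfloor>real n + v n * t\<rfloor>" for n and t :: real
  have nm: "n \<le> m n t" if "t \<ge> 0" for n t unfolding m_def using that v[of n] by (intro le_nat_floor) simp
  \<comment> \<open>Equal to \<open>n powr (\<gamma> / 2) / b n\<close>, the scale of the
    martingale; see \<open>ccb\<close>.\<close>
  define cc where "cc n = sqrt (SS.w n)" for n
  have w0: "0 \<le> SS.w n" for n by (simp add: SS.w_def)
  have cc0: "0 \<le> cc n" for n using w0 by (simp add: cc_def)
  have cc2: "(cc n)\<^sup>2 = SS.w n" for n using w0 by (simp add: cc_def)
  have cc_lim: "cc \<longlonglongrightarrow> 0" using tendsto_real_sqrt[OF SS.w_tendsto_0] unfolding cc_def by simp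
  have ccb: "real n powr (\<gamma> / 2) = cc n * SS.b n" for n
  proof (rule power2_eq_imp_eq)
    show "(real n powr (\<gamma> / 2))\<^sup>2 = (cc n * SS.b n)\<^sup>2"
      using b_pos[of n] by (simp add: power_mult_distrib cc2 SS.w_def) (simp add: power2_eq_square powr_add[symmetric])
  qed (use cc0[of n] b_pos[of n] in auto)
  \<comment> \<open>The deterministic factor between the rescaled process and the scaled martingale,
    which tends to 1 uniformly on bounded time intervals.\<close>
  define \<theta> where "\<theta> n t = exp (c * (1 - \<rho>) * \<phi> t) * SS.b n / SS.b (m n t)" for n t
  define K where "K k \<omega> = SS.b k * (avg N Z k \<omega> - q)" for k \<omega>
  define X where "X n \<omega> t = real n powr (\<gamma> / 2) * h t * (avg N Z (m n t) \<omega> - q)" for n \<omega> t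
  have X_eq: "X n \<omega> t = \<theta> n t * (cc n * K (m n t) \<omega>)" if "t \<ge> 0" for n \<omega> t
    using b_pos[of "m n t"] by (simp add: X_def h[OF that] \<theta>_def K_def ccb)
  have \<theta>_lim: "eventually (\<lambda>n. \<forall>t\<in>{0..T}. \<bar>\<theta> n t - 1\<bar> \<le> e) sequentially" if "T > 0" "e > 0" for T e
  proof -
    have "compact (\<phi> ` {0..T})" by (intro compact_continuous_image continuous_on_subset[OF \<phi>]) auto
    then have "bounded (\<phi> ` {0..T})" by (rule compact_imp_bounded)
    then obtain C where "\<forall>t\<in>{0..T}. \<bar>\<phi> t\<bar> \<le> C" unfolding bounded_iff by auto
    then show ?thesis
      unfolding \<theta>_def using nm sums[OF that(1)] that(2)
      by (intro SS.window_uniform[where C=C]) (auto simp: m_def)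
  qed
  have h_cont: "continuous_on {0..} h"
    by (rule continuous_on_cong[THEN iffD1, of "{0..}" "{0..}" "\<lambda>t. exp (c * (1 - \<rho>) * \<phi> t)"])
      (auto simp: h intro!: continuous_intros \<phi>)
  have X_step: "X n \<omega> = step_path (\<lambda>t. real n powr (\<gamma> / 2) * h t) (real n) (v n) (\<lambda>i. avg N Z i \<omega> - q)" for n \<omega>
    by (simp add: X_def[abs_def] step_path_def m_def)
  have X_cadlag: "X n \<omega> \<in> cadlag_paths" for n \<omega>
    unfolding X_step by (intro step_path_cadlag continuous_intros h_cont v)
  have avg_m [measurable]: "avg N Z i \<in> borel_measurable M" for i by (rule G_measD[OF avg_meas_G[OF order_refl]])
  have X_meas: "(\<lambda>\<omega>. \<Psi> (X n \<omega>)) \<in> borel_measurable M" if "loc_unif_continuous \<Psi>" for n \<Psi>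
    unfolding X_step by (rule measurable_step_path_functional[OF that _ v]) (auto intro!: continuous_intros h_cont)
  have K0: "\<bar>K 0 \<omega>\<bar> \<le> 1" if "\<omega> \<in> space M" for \<omega>
    using avg_range[OF that, of 0] q by (auto simp: K_def SS.b_0)
  have K_inc: "K (Suc k) \<omega> - K k \<omega> = SS.b (Suc k) * r k * \<rho> * \<xi> k \<omega>" if "\<omega> \<in> space M" for k \<omega>
    unfolding K_def avg_rec[OF that] SS.b_rec[of k] by (simp add: algebra_simps)
  have "conv_distr_D M X M' (\<lambda>\<omega> t. W (V t) \<omega>)"
  \<comment> \<open>Without noise the clock is constantly 0, so it is not strictly increasing and
    the martingale theorem does not apply. Then \<open>K\<close> is constant in time and
    \<open>cc n\<close> drives the process to the zero path, which is the limit.\<close>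
  proof (cases "\<rho> = 0")
    case True
    have V0: "V t = 0" if "t \<ge> 0" for t using V[OF that] True by simp
    have W0: "W 0 \<omega> = 0" if "\<omega> \<in> space M'" for \<omega> using BM that by (simp add: brownian_motion_def)
    have Yc: "continuous_on {0..} (\<lambda>t. W (V t) \<omega>)" for \<omega>
      by (rule continuous_on_cong[THEN iffD1, of "{0..}" "{0..}" "\<lambda>t. W 0 \<omega>"]) (auto simp: V0)
    have K_const: "K k \<omega> = K 0 \<omega>" if "\<omega> \<in> space M" for k \<omega>
    proof (induction k)
      case (Suc k)
      then show ?case using K_inc[OF that, of k] True by simp
    qed simp
    show ?thesis
    proof (rule conv_distr_D_lipschitzI[OF prob_space_axioms M'.prob_space_axioms])
      show "X n \<omega> \<in> cadlag_paths" for n \<omega> by (rule X_cadlag)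
      show "(\<lambda>t. W (V t) \<omega>) \<in> cadlag_paths" for \<omega> by (rule continuous_imp_cadlag[OF Yc])
      show "(\<lambda>\<omega>. \<Psi> (X n \<omega>)) \<in> borel_measurable M" if "loc_unif_continuous \<Psi>" for n \<Psi> by (rule X_meas[OF that])
    next
      fix \<Psi> assume \<Psi>: "loc_unif_continuous \<Psi>"
      show "(\<lambda>\<omega>. \<Psi> (\<lambda>t. W (V t) \<omega>)) \<in> borel_measurable M'"
        using BM by (intro measurable_continuous_path_functional[OF \<Psi> Yc]) (auto simp: V0 brownian_motion_def)
    next
      fix \<Psi> L B
      assume \<Psi>: "lipschitz_functional L \<Psi>" "L \<ge> 0" "\<forall>f\<in>cadlag_paths. \<bar>\<Psi> f\<bar> \<le> B"
      have "\<Psi> (\<lambda>t. W (V t) \<omega>) = \<Psi> (\<lambda>_. 0)" if "\<omega> \<in> space M'" for \<omega>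
      proof -
        have "path_dist (\<lambda>t. W (V t) \<omega>) (\<lambda>_. 0) \<le> 0"
          by (rule path_dist_le_uniform) (simp add: V0 W0[OF that])
        then have "L * path_dist (\<lambda>t. W (V t) \<omega>) (\<lambda>_. 0) \<le> 0" by (rule mult_nonneg_nonpos[OF \<Psi>(2)])
        then show ?thesis
          using \<Psi>(1)[unfolded lipschitz_functional_def, rule_format, OF continuous_imp_cadlag[OF Yc] zero_cadlag, of \<omega>] by linarith
      qed
      then have Y: "(\<integral>\<omega>. \<Psi> (\<lambda>t. W (V t) \<omega>) \<partial>M') = \<Psi> (\<lambda>_. 0)"
        by (subst Bochner_Integration.integral_cong[OF refl, of _ _ "\<lambda>_. \<Psi> (\<lambda>_. 0)"]) (auto simp: M'.prob_space)
      have lc: "loc_unif_continuous \<Psi>" by (rule lipschitz_functional_imp_continuous[OF \<Psi>(1)])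
      have iX: "integrable M (\<lambda>\<omega>. \<Psi> (X n \<omega>))" for n
        by (rule integrable_bdd[OF X_meas[OF lc], where B=B]) (use \<Psi>(3) X_cadlag in auto)
      show "(\<lambda>n. expectation (\<lambda>\<omega>. \<Psi> (X n \<omega>))) \<longlonglongrightarrow> (\<integral>\<omega>. \<Psi> (\<lambda>t. W (V t) \<omega>) \<partial>M')"
        unfolding Y
      proof (rule LIMSEQ_I)
        fix e :: real assume e: "e > 0"
        define \<epsilon> where "\<epsilon> = e / (4 * (L + 1))"
        have \<epsilon>: "\<epsilon> > 0" "L * (2 * \<epsilon> + \<epsilon>) < e"
        proof -
          show "\<epsilon> > 0" using e \<Psi>(2) by (simp add: \<epsilon>_def)
          then have "L * (2 * \<epsilon> + \<epsilon>) \<le> (L + 1) * (3 * \<epsilon>)" using \<Psi>(2) by (intro mult_mono) auto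
          also have "\<dots> = 3 * e / 4" using \<Psi>(2) by (simp add: \<epsilon>_def divide_simps)
          also have "\<dots> < e" using e by simp
          finally show "L * (2 * \<epsilon> + \<epsilon>) < e" .
        qed
        define T where "T = 1 / \<epsilon>"
        have T: "T > 0" "1 / (1 + T) \<le> \<epsilon>" using \<epsilon> by (auto simp: T_def field_simps)
        have "eventually (\<lambda>n. cc n < \<epsilon>) sequentially" using cc_lim \<epsilon> by (intro order_tendstoD(2)) auto
        with \<theta>_lim[OF T(1), of 1]
        have "eventually (\<lambda>n. norm (expectation (\<lambda>\<omega>. \<Psi> (X n \<omega>)) - \<Psi> (\<lambda>_. 0)) < e) sequentially"
        proof (rule eventually_elim2)
          fix n assume \<theta>n: "\<forall>t\<in>{0..T}. \<bar>\<theta> n t - 1\<bar> \<le> 1" and cn: "cc n < \<epsilon>"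
          have "\<bar>\<Psi> (X n \<omega>) - \<Psi> (\<lambda>_. 0)\<bar> \<le> L * (2 * \<epsilon> + \<epsilon>)" if \<omega>: "\<omega> \<in> space M" for \<omega>
          proof -
            have "path_dist (X n \<omega>) (\<lambda>_. 0) \<le> 2 * \<epsilon> + 1 / (1 + T)"
            proof (rule path_dist_le_compact)
              fix t assume t: "0 \<le> t" "t < T"
              have "\<bar>\<theta> n t - 1\<bar> \<le> 1" using \<theta>n t by auto
              then have "\<bar>\<theta> n t\<bar> \<le> 2" by linarith
              moreover have "\<bar>cc n * K (m n t) \<omega>\<bar> \<le> \<epsilon> * 1"
                unfolding abs_mult K_const[OF \<omega>, of "m n t"] using cc0[of n] cn K0[OF \<omega>] by (intro mult_mono) auto
              ultimately have "\<bar>\<theta> n t * (cc n * K (m n t) \<omega>)\<bar> \<le> 2 * (\<epsilon> * 1)"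
                unfolding abs_mult[of "\<theta> n t"] by (intro mult_mono) auto
              then show "\<bar>X n \<omega> t - 0\<bar> \<le> 2 * \<epsilon>" using X_eq[OF t(1)] by simp
            qed (use T \<epsilon> in auto)
            then have "L * path_dist (X n \<omega>) (\<lambda>_. 0) \<le> L * (2 * \<epsilon> + \<epsilon>)"
              using T(2) \<Psi>(2) by (intro mult_left_mono) auto
            then show ?thesis
              using \<Psi>(1)[unfolded lipschitz_functional_def, rule_format, OF X_cadlag zero_cadlag, of n \<omega>] by linarith
          qed
          then have "\<bar>expectation (\<lambda>\<omega>. \<Psi> (X n \<omega>) - \<Psi> (\<lambda>_. 0))\<bar> \<le> expectation (\<lambda>_. L * (2 * \<epsilon> + \<epsilon>))"
            using iX by (intro norm_integral_le[where 'b=real, unfolded real_norm_def]) auto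
          then show "norm (expectation (\<lambda>\<omega>. \<Psi> (X n \<omega>)) - \<Psi> (\<lambda>_. 0)) < e"
            using iX \<epsilon>(2) by (simp add: prob_space)
        qed simp
        then show "\<exists>no. \<forall>n\<ge>no. norm (expectation (\<lambda>\<omega>. \<Psi> (X n \<omega>)) - \<Psi> (\<lambda>_. 0)) < e"
          by (simp add: eventually_sequentially)
      qed
    qed
  next
    case False
    then have \<rho>0: "\<rho> > 0" using rho by simp
    define \<sigma>2 where "\<sigma>2 = q * (1 - q) / real N"
    define s where "s k = \<rho> * (r k * SS.b (Suc k))" for k
    have s0: "0 \<le> s k" for k using rho r01[of k] b_pos[of "Suc k"] by (simp add: s_def)
    have \<sigma>2: "0 < \<sigma>2" "\<sigma>2 \<le> 1"
    proof -
      show "0 < \<sigma>2" using q N by (simp add: \<sigma>2_def)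
      have "q * (1 - q) \<le> 1 * 1" using q by (intro mult_mono) auto
      then have "q * (1 - q) / real N \<le> 1 / 1" using N q by (intro frac_le) auto
      then show "\<sigma>2 \<le> 1" by (simp add: \<sigma>2_def)
    qed
    have inc: "K (Suc k) \<omega> - K k \<omega> = s k * \<xi> k \<omega>" if "\<omega> \<in> space M" for k \<omega>
      using K_inc[OF that, of k] by (simp add: s_def mult_ac)
    have K_meas: "K j \<in> borel_measurable (G k)" if "j \<le> k" for j k
      unfolding K_def[abs_def] using avg_meas_G[OF that] by measurable
    \<comment> \<open>Multiplication by the square of \<open>b\<close> cancels the contraction
      factor in \<open>msd_rec\<close>, and the remaining terms add up to \<open>R\<close>.\<close>
    have msd_b: "(SS.b n)\<^sup>2 * msd n \<le> msd 0 + real N * SS.R n" for n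
    proof (induction n)
      case 0
      then show ?case by (simp add: SS.b_0 SS.R_def)
    next
      case (Suc n)
      have "(SS.b (Suc n))\<^sup>2 * msd (Suc n) \<le> (SS.b (Suc n))\<^sup>2 * ((1 - (1 - \<rho>) * r n)\<^sup>2 * msd n + real N * (r n)\<^sup>2)"
        by (intro mult_left_mono msd_rec) auto
      also have "\<dots> = (SS.b n)\<^sup>2 * msd n + real N * ((r n)\<^sup>2 * (SS.b (Suc n))\<^sup>2)"
      proof -
        have bn: "(SS.b n)\<^sup>2 = (1 - (1 - \<rho>) * r n)\<^sup>2 * (SS.b (Suc n))\<^sup>2"
          by (subst SS.b_rec[of n]) (rule power_mult_distrib)
        show ?thesis unfolding bn by (simp only: distrib_left mult_ac)
      qed
      also have "\<dots> \<le> msd 0 + real N * SS.R (Suc n)"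
        using Suc by (simp add: SS.R_def algebra_simps)
      finally show ?case .
    qed
    have msd_nonneg: "0 \<le> msd n" for n unfolding msd_def by (intro sum_nonneg) simp
    \<comment> \<open>Dividing by the square of \<open>b\<close> is multiplying by
      \<open>w n * n powr - \<gamma>\<close>. Since \<open>w n * R n\<close> converges, the
      additional power forces the limit 0.\<close>
    have msd_lim: "msd \<longlonglongrightarrow> 0"
    proof (rule tendsto_sandwich[OF _ _ tendsto_const])
      have "(\<lambda>n. real n powr (- \<gamma>)) \<longlonglongrightarrow> 0"
        using SS.gamma by (intro tendsto_neg_powr filterlim_real_sequentially) auto
      then have "(\<lambda>n. real n powr (- \<gamma>) * (SS.w n * msd 0 + real N * (SS.w n * SS.R n))) \<longlonglongrightarrow> 0 * (0 * msd 0 + real N * (c\<^sup>2 / SS.D))"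
        by (intro tendsto_intros SS.w_tendsto_0 SS.R_tendsto)
      then show "(\<lambda>n. real n powr (- \<gamma>) * (SS.w n * msd 0 + real N * (SS.w n * SS.R n))) \<longlonglongrightarrow> 0" by simp
      show "eventually (\<lambda>n. msd n \<le> real n powr (- \<gamma>) * (SS.w n * msd 0 + real N * (SS.w n * SS.R n))) sequentially"
        using eventually_gt_at_top[of 0]
      proof eventually_elim
        case (elim n)
        have "msd n \<le> (msd 0 + real N * SS.R n) / (SS.b n)\<^sup>2"
          using msd_b[of n] b_pos[of n] by (simp add: field_simps)
        also have "\<dots> = real n powr (- \<gamma>) * (SS.w n * msd 0 + real N * (SS.w n * SS.R n))"
          using elim b_pos[of n] by (simp add: SS.w_def powr_minus field_simps)
        finally show ?case .
      qed
    qed (auto simp: msd_nonneg)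
    have \<xi>2: "expectation (\<lambda>\<omega>. H \<omega> * (s k * \<xi> k \<omega>)\<^sup>2) = (s k)\<^sup>2 * expectation (\<lambda>\<omega>. H \<omega> * \<kappa> k \<omega>)"
      if "H \<in> borel_measurable (G k)" "\<forall>\<omega>\<in>space M. \<bar>H \<omega>\<bar> \<le> B" for H k B
    proof -
      have "expectation (\<lambda>\<omega>. H \<omega> * (s k * \<xi> k \<omega>)\<^sup>2) = expectation (\<lambda>\<omega>. (s k)\<^sup>2 * (H \<omega> * (\<xi> k \<omega>)\<^sup>2))"
        by (intro Bochner_Integration.integral_cong) (auto simp: power_mult_distrib)
      then show ?thesis using \<xi>_variance[OF that(1), of B] that(2) by simp
    qed
    interpret BMt: bounded_martingale M G "\<lambda>k \<omega>. K (Suc k) \<omega> - K k \<omega>" s \<kappa> \<sigma>2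
    proof
      show "subalgebra M (G k)" for k by (rule subalgebra_G)
      show "subalgebra (G (Suc k)) (G k)" for k by (rule subalgebra_G_Suc)
      show "(\<lambda>\<omega>. K (Suc k) \<omega> - K k \<omega>) \<in> borel_measurable (G (Suc k))" for k
        by (intro borel_measurable_diff K_meas) auto
      show "\<bar>K (Suc k) \<omega> - K k \<omega>\<bar> \<le> s k" if "\<omega> \<in> space M" for k \<omega>
        unfolding inc[OF that] using \<xi>_abs[OF that, of k] s0[of k] by (intro bounded_mult) auto
      show "\<kappa> k \<in> borel_measurable M" for k by (rule \<kappa>_meas)
      show "\<bar>\<kappa> k \<omega>\<bar> \<le> 1" if "\<omega> \<in> space M" for k \<omega>
      proof -
        have "0 \<le> (\<Sum>i=1..N. p k i \<omega> * (1 - p k i \<omega>))"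
          using p_range[OF that] by (intro sum_nonneg mult_nonneg_nonneg) auto
        moreover have "(\<Sum>i=1..N. p k i \<omega> * (1 - p k i \<omega>)) \<le> (\<Sum>i=1..N. 1 * 1)"
          using p_range[OF that] by (intro sum_mono mult_mono) auto
        moreover have "(\<Sum>i=1..N. 1 * 1 :: real) \<le> (real N)\<^sup>2" using N by (simp add: power2_eq_square)
        ultimately have "0 \<le> (\<Sum>i=1..N. p k i \<omega> * (1 - p k i \<omega>)) \<and>
            (\<Sum>i=1..N. p k i \<omega> * (1 - p k i \<omega>)) \<le> (real N)\<^sup>2" by linarith
        then show ?thesis unfolding \<kappa>_def using N by (simp add: divide_le_eq)
      qed
      show "expectation (\<lambda>\<omega>. H \<omega> * (K (Suc k) \<omega> - K k \<omega>)) = 0"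
        if "H \<in> borel_measurable (G k)" "\<forall>\<omega>\<in>space M. \<bar>H \<omega>\<bar> \<le> B" for k H B
      proof -
        have "expectation (\<lambda>\<omega>. H \<omega> * (K (Suc k) \<omega> - K k \<omega>)) = expectation (\<lambda>\<omega>. s k * (H \<omega> * \<xi> k \<omega>))"
          by (intro Bochner_Integration.integral_cong) (auto simp: inc)
        then show ?thesis using \<xi>_mean[OF that(1), of B] that(2) by simp
      qed
      show "expectation (\<lambda>\<omega>. H \<omega> * (K (Suc k) \<omega> - K k \<omega>)\<^sup>2) = (s k)\<^sup>2 * expectation (\<lambda>\<omega>. H \<omega> * \<kappa> k \<omega>)"
        if "H \<in> borel_measurable (G k)" "\<forall>\<omega>\<in>space M. \<bar>H \<omega>\<bar> \<le> B" for k H B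
      proof -
        have "expectation (\<lambda>\<omega>. H \<omega> * (K (Suc k) \<omega> - K k \<omega>)\<^sup>2) = expectation (\<lambda>\<omega>. H \<omega> * (s k * \<xi> k \<omega>)\<^sup>2)"
          by (intro Bochner_Integration.integral_cong) (auto simp: inc)
        then show ?thesis using \<xi>2[OF that] by simp
      qed
      show "0 \<le> \<sigma>2" "\<sigma>2 \<le> 1" using \<sigma>2 by auto
      show "(\<lambda>k. expectation (\<lambda>\<omega>. \<bar>\<kappa> k \<omega> - \<sigma>2\<bar>)) \<longlonglongrightarrow> 0"
      proof (rule tendsto_sandwich[OF _ _ tendsto_const])
        have "(\<lambda>k. real N * sqrt (msd k)) \<longlonglongrightarrow> real N * sqrt 0" by (intro tendsto_intros msd_lim)
        then show "(\<lambda>k. real N * sqrt (msd k)) \<longlonglongrightarrow> 0" by simp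
      qed (auto simp: \<sigma>2_def \<kappa>_dev_expectation)
    qed
    have S_eq: "BMt.S k \<omega> = K k \<omega> - K 0 \<omega>" for k \<omega>
      unfolding BMt.S_def by (rule sum_lessThan_telescope)
    have Q_eq: "BMt.Q k = \<rho>\<^sup>2 * SS.R k" for k
      by (simp add: BMt.Q_def SS.R_def s_def sum_distrib_left power_mult_distrib mult_ac)
    \<comment> \<open>The clock before multiplication by the limiting conditional variance, as the
      martingale theorem has \<open>\<sigma>2 * l\<close> in its limit.\<close>
    define l where "l t = V t / \<sigma>2" for t
    have l_eq: "l t = \<rho>\<^sup>2 * (a t powr \<gamma> * exp (2 * (c * (1 - \<rho>) * \<phi> t)) * (c\<^sup>2 / SS.D))" if "t \<ge> 0" for t
      using V[OF that] \<sigma>2(1) by (simp add: l_def \<sigma>2_def[symmetric] SS.D_def)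
    have \<theta>_pt: "(\<lambda>n. exp (c * (1 - \<rho>) * \<phi> t) * SS.b n / SS.b (m n t)) \<longlonglongrightarrow> 1" if t: "t \<ge> 0" for t
    proof (rule LIMSEQ_I)
      fix e :: real assume e: "e > 0"
      then have "eventually (\<lambda>n. \<forall>u\<in>{0..t + 1}. \<bar>\<theta> n u - 1\<bar> \<le> e / 2) sequentially"
        using t by (intro \<theta>_lim) auto
      then have "eventually (\<lambda>n. norm (\<theta> n t - 1) < e) sequentially"
      proof eventually_elim
        case (elim n)
        then have "\<bar>\<theta> n t - 1\<bar> \<le> e / 2" using t by auto
        then show ?case using e by simp
      qed
      then show "\<exists>no. \<forall>n\<ge>no. norm (exp (c * (1 - \<rho>) * \<phi> t) * SS.b n / SS.b (m n t) - 1) < e"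
        by (simp add: eventually_sequentially \<theta>_def)
    qed
    have w_lim: "(\<lambda>n. SS.w n / SS.w (m n t)) \<longlonglongrightarrow> a t powr \<gamma> * exp (2 * (c * (1 - \<rho>) * \<phi> t))" if t: "t \<ge> 0" for t
      using ratio[OF t] by (intro SS.w_ratio_tendsto[OF \<theta>_pt[OF t] _ a[OF t]]) (simp add: m_def)
    interpret SM: scaled_martingale M G "\<lambda>k \<omega>. K (Suc k) \<omega> - K k \<omega>" s \<kappa> \<sigma>2 cc m l X
    proof
      show "0 \<le> cc n" for n by (rule cc0)
      show "cc \<longlonglongrightarrow> 0" by (rule cc_lim)
      show "m n u \<le> m n t" if "0 \<le> u" "u \<le> t" for n u t
        unfolding m_def using that v[of n] by (intro nat_mono floor_mono add_left_mono mult_left_mono) auto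
      show "(\<lambda>n. (cc n)\<^sup>2 * BMt.Q (m n t)) \<longlonglongrightarrow> l t" if t: "t \<ge> 0" for t
      proof -
        have "(\<lambda>n. \<rho>\<^sup>2 * (SS.w n * SS.R (m n t))) \<longlonglongrightarrow> l t"
          unfolding l_eq[OF t] by (intro tendsto_intros SS.R_window_tendsto nm t w_lim)
        then show ?thesis by (simp add: cc2 Q_eq mult_ac)
      qed
      show "eventually (\<lambda>n. \<forall>k<m n t. cc n * s k \<le> \<delta>) sequentially" if t: "t \<ge> 0" "\<delta> > 0" for t \<delta>
      proof -
        have "eventually (\<lambda>n. \<forall>k<m n t. SS.w n * ((r k)\<^sup>2 * (SS.b (Suc k))\<^sup>2) \<le> \<delta>\<^sup>2) sequentially"
          using t(2) by (intro SS.increments_small[OF w_lim[OF t(1)]]) simp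
        then show ?thesis
        proof (elim eventually_mono, intro allI impI)
          fix n k assume A: "\<forall>k<m n t. SS.w n * ((r k)\<^sup>2 * (SS.b (Suc k))\<^sup>2) \<le> \<delta>\<^sup>2" and k: "k < m n t"
          have "(cc n * s k)\<^sup>2 = \<rho>\<^sup>2 * (SS.w n * ((r k)\<^sup>2 * (SS.b (Suc k))\<^sup>2))"
            by (simp add: power_mult_distrib cc2 s_def mult_ac)
          also have "\<dots> \<le> 1 * (SS.w n * ((r k)\<^sup>2 * (SS.b (Suc k))\<^sup>2))"
            using rho w0[of n] by (intro mult_right_mono) (auto simp: abs_square_le_1)
          also have "\<dots> \<le> \<delta>\<^sup>2" using A k by simp
          finally show "cc n * s k \<le> \<delta>" by (rule power2_le_imp_le) (use t(2) in simp)
        qed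
      qed
      show "X n \<omega> \<in> cadlag_paths" for n \<omega> by (rule X_cadlag)
      show "(\<lambda>\<omega>. \<Psi> (X n \<omega>)) \<in> borel_measurable M" if "loc_unif_continuous \<Psi>" for n \<Psi> by (rule X_meas[OF that])
      show "eventually (\<lambda>n. \<forall>\<omega>\<in>space M. \<forall>t\<in>{0..T}. \<bar>X n \<omega> t - cc n * BMt.S (m n t) \<omega>\<bar>
          \<le> e * (1 + \<bar>cc n * BMt.S (m n t) \<omega>\<bar>)) sequentially" if T: "T > 0" and e: "e > 0" for T e
      proof -
        \<comment> \<open>The bound by 1 gives \<open>\<bar>\<theta> n t\<bar> \<le> 2\<close>.
          Together with \<open>cc n < e / 2\<close> this makes the contribution of the initial value
          \<open>K 0\<close>, which the martingale sum omits, at most \<open>e\<close>.\<close>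
        define e1 where "e1 = min e 1"
        have e1: "e1 > 0" "e1 \<le> e" "e1 \<le> 1" using e by (auto simp: e1_def)
        have "eventually (\<lambda>n. cc n < e / 2) sequentially" using cc_lim e by (intro order_tendstoD(2)) auto
        with \<theta>_lim[OF T e1(1)] show ?thesis
        proof eventually_elim
          case (elim n)
          show ?case
          proof (intro ballI)
            fix \<omega> t assume \<omega>: "\<omega> \<in> space M" and t: "t \<in> {0..T}"
            define y where "y = cc n * BMt.S (m n t) \<omega>"
            have \<theta>1: "\<bar>\<theta> n t - 1\<bar> \<le> e1" using elim(1) t by blast
            then have \<theta>2: "\<bar>\<theta> n t\<bar> \<le> 2" using e1(3) by linarith
            have "X n \<omega> t = \<theta> n t * (cc n * K (m n t) \<omega>)" using t by (intro X_eq) auto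
            then have "X n \<omega> t - y = (\<theta> n t - 1) * y + \<theta> n t * (cc n * K 0 \<omega>)"
              unfolding y_def S_eq by (simp add: algebra_simps)
            also have "\<bar>\<dots>\<bar> \<le> \<bar>\<theta> n t - 1\<bar> * \<bar>y\<bar> + \<bar>\<theta> n t\<bar> * (cc n * \<bar>K 0 \<omega>\<bar>)"
              using cc0[of n] by (intro order_trans[OF abs_triangle_ineq]) (simp add: abs_mult)
            also have "\<dots> \<le> e * \<bar>y\<bar> + 2 * (e / 2 * 1)"
              using \<theta>1 \<theta>2 e1 elim(2) K0[OF \<omega>] cc0[of n] e by (intro add_mono mult_mono) auto
            finally show "\<bar>X n \<omega> t - cc n * BMt.S (m n t) \<omega>\<bar> \<le> e * (1 + \<bar>cc n * BMt.S (m n t) \<omega>\<bar>)"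
              unfolding y_def by (simp add: algebra_simps)
          qed
        qed
      qed
    qed
    have "conv_distr_D M X M' (\<lambda>\<omega> t. W (\<sigma>2 * l t) \<omega>)"
    proof (rule SM.functional_clt[OF BM \<sigma>2(1)])
      show "continuous_on {0..} l" unfolding l_def using \<sigma>2(1) by (intro continuous_intros V_cont) auto
      show "strict_mono_on {0..} l"
        using V_mono[OF \<rho>0] \<sigma>2(1) unfolding l_def strict_mono_on_def by (auto intro!: divide_strict_right_mono)
      show "l 0 > 0" unfolding l_eq[OF order_refl] using \<rho>0 a[of 0] SS.D_pos SS.c by simp
    qed
    then show ?thesis using \<sigma>2(1) by (simp add: l_def)
  qed
  then show ?thesis unfolding X_def[abs_def] m_def .
qed


theorem theorem2p8:
  fixes M :: "'a measure" and M' :: "'b measure" and W :: "real \<Rightarrow> 'b \<Rightarrow> real"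
    and N :: nat and \<rho> \<alpha> q \<gamma> c :: real and r :: "nat \<Rightarrow> real"
    and Z :: "nat \<Rightarrow> nat \<Rightarrow> 'a \<Rightarrow> real" and I :: "nat \<Rightarrow> nat \<Rightarrow> 'a \<Rightarrow> real"
  assumes M: "prob_space M"
    and N: "N \<ge> 1"
    and rho: "0 \<le> \<rho>" "\<rho> < 1"
    and alpha: "0 \<le> \<alpha>" "\<alpha> \<le> 1"
    and q: "0 < q" "q < 1"
    and r: "\<And>n. 0 \<le> r n \<and> r n < 1"
    and gamma: "1/2 < \<gamma>" "\<gamma> \<le> 1"
    and c: "c > 0"
    and r_lim: "(\<lambda>n. real n powr \<gamma> * r n) \<longlonglongrightarrow> c"
    and Z_meas: "\<And>n i. i \<in> {1..N} \<Longrightarrow> Z n i \<in> borel_measurable M"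
    and Z_range: "\<And>n i \<omega>. i \<in> {1..N} \<Longrightarrow> \<omega> \<in> space M \<Longrightarrow> 0 \<le> Z n i \<omega> \<and> Z n i \<omega> \<le> 1"
    and I_meas: "\<And>n i. i \<in> {1..N} \<Longrightarrow> I (Suc n) i \<in> borel_measurable M"
    and I_range: "\<And>n i \<omega>. i \<in> {1..N} \<Longrightarrow> \<omega> \<in> space M \<Longrightarrow> I (Suc n) i \<omega> \<in> {0, 1}"
    and Z_rec: "\<And>n i \<omega>. i \<in> {1..N} \<Longrightarrow> \<omega> \<in> space M \<Longrightarrow>
        Z (Suc n) i \<omega> = (1 - r n) * Z n i \<omega> + r n * (\<rho> * I (Suc n) i \<omega> + (1 - \<rho>) * q)"
    and I_indep: "\<And>n. cond_indep M (nat_filtration M N Z n) N (I (Suc n))"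
    and I_prob: "\<And>n i. i \<in> {1..N} \<Longrightarrow>
        AE \<omega> in M. real_cond_exp M (nat_filtration M N Z n)
                      (indicator {\<omega>\<in>space M. I (Suc n) i \<omega> = 1}) \<omega>
                    = (1 - \<alpha>) * Z n i \<omega> + \<alpha> * avg N Z n \<omega>"
    and exch: "\<And>\<pi>. \<pi> permutes {1..N} \<Longrightarrow>
        distr M (PiM {1..N} (\<lambda>_. borel)) (\<lambda>\<omega>. restrict (\<lambda>i. Z 0 (\<pi> i) \<omega>) {1..N})
      = distr M (PiM {1..N} (\<lambda>_. borel)) (\<lambda>\<omega>. restrict (\<lambda>i. Z 0 i \<omega>) {1..N})"
    and mean0: "\<And>i. i \<in> {1..N} \<Longrightarrow> (\<integral>\<omega>. Z 0 i \<omega> \<partial>M) = 1/2"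
    and var0: "(\<integral>\<omega>. avg N Z 0 \<omega> * (1 - avg N Z 0 \<omega>) \<partial>M) > 0"
    and BM: "brownian_motion M' W"
  shows
    "(\<gamma> < 1 \<longrightarrow>
       conv_distr_D M
         (\<lambda>n \<omega> t. real n powr (\<gamma>/2) * exp (c * (1 - \<rho>) * t)
                    * (avg N Z (nat \<lfloor>real n + real n powr \<gamma> * t\<rfloor>) \<omega> - q))
         M'
         (\<lambda>\<omega> t. W (c * q * (1 - q) * \<rho>\<^sup>2 / (2 * real N * (1 - \<rho>)) * exp (2 * c * (1 - \<rho>) * t)) \<omega>))
   \<and>
    (\<gamma> = 1 \<longrightarrow> 2 * c * (1 - \<rho>) > 1 \<longrightarrow>
       conv_distr_D M
         (\<lambda>n \<omega> t. sqrt (real n) * (1 + t) powr (c * (1 - \<rho>))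
                    * (avg N Z (nat \<lfloor>real n + real n * t\<rfloor>) \<omega> - q))
         M'
         (\<lambda>\<omega> t. W (c\<^sup>2 * q * (1 - q) * \<rho>\<^sup>2 / (real N * (2 * c * (1 - \<rho>) - 1))
                    * (1 + t) powr (2 * c * (1 - \<rho>) - 1)) \<omega>))"
proof -
  interpret reinforced_system M N \<rho> \<alpha> q r Z I
    by (rule reinforced_system.intro[OF M reinforced_system_axioms.intro])
      (fact N rho alpha q r Z_meas Z_range I_meas I_range Z_rec I_indep I_prob)+
  have N0: "real N > 0" using N by simp
  show ?thesis
  proof (intro conjI impI)
    assume \<gamma>1: "\<gamma> < 1"
    have ss: "step_sizes r \<gamma> c (1 - \<rho>)"
      by unfold_locales (use r gamma c rho r_lim \<gamma>1 in auto)
    interpret SS: step_sizes r \<gamma> c "1 - \<rho>" by (rule ss)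
    define A where "A = c * q * (1 - q) * \<rho>\<^sup>2 / (2 * real N * (1 - \<rho>))"
    have "conv_distr_D M (\<lambda>n \<omega> t. real n powr (\<gamma> / 2) * exp (c * (1 - \<rho>) * t)
          * (avg N Z (nat \<lfloor>real n + real n powr \<gamma> * t\<rfloor>) \<omega> - q))
        M' (\<lambda>\<omega> t. W (A * exp (2 * c * (1 - \<rho>) * t)) \<omega>)"
    \<comment> \<open>The index in the window stays comparable to \<open>n\<close>, so the ratio of
      the ends tends to 1 and the power sums tend to \<open>t\<close> itself.\<close>
    proof (rule fluctuation_clt[OF ss BM, where \<phi>="\<lambda>t. t" and a="\<lambda>_. 1" and v="\<lambda>n. real n powr \<gamma>"])
      show "A * exp (2 * c * (1 - \<rho>) * t) = q * (1 - q) / real N * (\<rho>\<^sup>2 *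
          (1 powr \<gamma> * exp (2 * (c * (1 - \<rho>) * t)) * (c\<^sup>2 / (2 * c * (1 - \<rho>) - (if \<gamma> = 1 then 1 else 0)))))" for t
      proof -
        have "c\<^sup>2 / (2 * c * (1 - \<rho>)) = c / (2 * (1 - \<rho>))" using c by (simp add: power2_eq_square)
        then show ?thesis using \<gamma>1 by (simp add: A_def mult_ac)
      qed
      show "continuous_on {0..} (\<lambda>t. A * exp (2 * c * (1 - \<rho>) * t))" by (intro continuous_intros)
      show "strict_mono_on {0..} (\<lambda>t. A * exp (2 * c * (1 - \<rho>) * t))" if "\<rho> > 0"
      proof -
        have "A > 0" unfolding A_def using that c q rho N0 by simp
        then show ?thesis using c rho by (auto simp: strict_mono_on_def)
      qed
    qed (use SS.window_sum_sublinear[OF \<gamma>1] SS.window_ratio_sublinear[OF \<gamma>1] in auto)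
    then show "conv_distr_D M (\<lambda>n \<omega> t. real n powr (\<gamma>/2) * exp (c * (1 - \<rho>) * t)
                    * (avg N Z (nat \<lfloor>real n + real n powr \<gamma> * t\<rfloor>) \<omega> - q)) M'
         (\<lambda>\<omega> t. W (c * q * (1 - q) * \<rho>\<^sup>2 / (2 * real N * (1 - \<rho>)) * exp (2 * c * (1 - \<rho>) * t)) \<omega>)"
      unfolding A_def .
  next
    assume \<gamma>1: "\<gamma> = 1" and gap: "2 * c * (1 - \<rho>) > 1"
    have ss: "step_sizes r \<gamma> c (1 - \<rho>)"
      by unfold_locales (use r gamma c rho r_lim gap in auto)
    interpret SS: step_sizes r \<gamma> c "1 - \<rho>" by (rule ss)
    define A where "A = c\<^sup>2 * q * (1 - q) * \<rho>\<^sup>2 / (real N * (2 * c * (1 - \<rho>) - 1))"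
    have "conv_distr_D M (\<lambda>n \<omega> t. real n powr (\<gamma> / 2) * (1 + t) powr (c * (1 - \<rho>))
          * (avg N Z (nat \<lfloor>real n + real n * t\<rfloor>) \<omega> - q))
        M' (\<lambda>\<omega> t. W (A * (1 + t) powr (2 * c * (1 - \<rho>) - 1)) \<omega>)"
    \<comment> \<open>The window now stretches by \<open>1 + t\<close>. Its harmonic sum tends to
      \<open>ln (1 + t)\<close>, which turns exponentials into powers, and the ratio
      \<open>1 / (1 + t)\<close> lowers the exponent of the clock by 1.\<close>
    proof (rule fluctuation_clt[OF ss BM, where \<phi>="\<lambda>t. ln (1 + t)" and a="\<lambda>t. 1 / (1 + t)" and v="\<lambda>n. real n"])
      show "continuous_on {0..} (\<lambda>t::real. ln (1 + t))" by (intro continuous_intros) auto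
      show "(1 + t) powr (c * (1 - \<rho>)) = exp (c * (1 - \<rho>) * ln (1 + t))" if "t \<ge> 0" for t
        using that by (simp add: powr_def)
      show "A * (1 + t) powr (2 * c * (1 - \<rho>) - 1) = q * (1 - q) / real N * (\<rho>\<^sup>2 *
          ((1 / (1 + t)) powr \<gamma> * exp (2 * (c * (1 - \<rho>) * ln (1 + t))) * (c\<^sup>2 / (2 * c * (1 - \<rho>) - (if \<gamma> = 1 then 1 else 0)))))"
        if t: "t \<ge> 0" for t
      proof -
        have "exp (2 * (c * (1 - \<rho>) * ln (1 + t))) = (1 + t) powr (2 * c * (1 - \<rho>))"
          using t by (simp add: powr_def mult_ac)
        then have "(1 / (1 + t)) powr \<gamma> * exp (2 * (c * (1 - \<rho>) * ln (1 + t))) = (1 + t) powr (2 * c * (1 - \<rho>) - 1)"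
          using t by (simp add: \<gamma>1 powr_diff)
        then show ?thesis using \<gamma>1 by (simp add: A_def)
      qed
      show "continuous_on {0..} (\<lambda>t. A * (1 + t) powr (2 * c * (1 - \<rho>) - 1))" by (intro continuous_intros) auto
      show "strict_mono_on {0..} (\<lambda>t. A * (1 + t) powr (2 * c * (1 - \<rho>) - 1))" if "\<rho> > 0"
      proof -
        have "A > 0" unfolding A_def using that c q rho N0 gap by simp
        then show ?thesis using gap by (auto simp: strict_mono_on_def intro!: powr_less_mono2)
      qed
    qed (use SS.window_sum_linear[OF \<gamma>1] SS.window_ratio_linear in auto)
    moreover have "real n powr (\<gamma> / 2) = sqrt (real n)" for n by (simp add: \<gamma>1 powr_half_sqrt)
    ultimately show "conv_distr_D M (\<lambda>n \<omega> t. sqrt (real n) * (1 + t) powr (c * (1 - \<rho>))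
                    * (avg N Z (nat \<lfloor>real n + real n * t\<rfloor>) \<omega> - q)) M'
         (\<lambda>\<omega> t. W (c\<^sup>2 * q * (1 - q) * \<rho>\<^sup>2 / (real N * (2 * c * (1 - \<rho>) - 1))
                    * (1 + t) powr (2 * c * (1 - \<rho>) - 1)) \<omega>)"
      unfolding A_def by simp
  qed
qed

end
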